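(* Let $k$ be a positive integer and let $\Lambda$ be a left and right noetherian ring which is quasi $k$-Gorenstein. Then for each $M$ in $\mathrm{mod}\,\Lambda$ there are a projective module $P$ in $\mathrm{mod}\,\Lambda$ and a chain of epimorphisms in $\mathrm{mod}\,\Lambda$ $$M\oplus P=M_0\twoheadrightarrow M_1\twoheadrightarrow\cdots\twoheadrightarrow M_{k-1}\twoheadrightarrow M_k$$ such that: (1) For any $0\leq d\leq k-1$, $B_d=\mathrm{Ker}(M_d\to M_{d+1})$ is a $d$th syzygy of $\mathrm{Ext}_\Lambda^{d+1}(D(M),\Lambda)$ (or equivalently, if $d\geq 2$, $B_d$ is a $d$th syzygy of $\mathrm{Ext}_\Lambda^{d-1}(M^*,\Lambda)$). (2) $M_d\in\Omega^d(\mathrm{mod}\,\Lambda)$ for any $0\leq d\leq k$. (3) $\mathrm{r.pd}_\Lambda(B_d^* )\leq d-1$ for any $0\leq d\leq k-1$. (4) For any $0\leq d\leq k-1$, the exact sequence $0\to B_d\to M_d\to M_{d+1}\to 0$ is dual exact, that is, the induced sequence $0\to M_{d+1}^*\to M_d^*\to B_d^*\to 0$ is exact.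
   Context: $\mathrm{mod}\,\Lambda$ (resp. $\mathrm{mod}\,\Lambda^{op}$) is the category of finitely generated left (resp. right) $\Lambda$-modules. $(-)^*=\mathrm{Hom}_\Lambda(-,\Lambda)$, interchanging left and right modules; likewise $\mathrm{Ext}^i_\Lambda(-,\Lambda)$ interchanges $\mathrm{mod}\,\Lambda$ and $\mathrm{mod}\,\Lambda^{op}$. For a finitely generated (left or right) module $X$ and an integer $i\ge 0$, $\mathrm{grade}\,X\geq i$ means $\mathrm{Ext}_\Lambda^j(X,\Lambda)=0$ for all $0\leq j<i$. $\Lambda$ is quasi $k$-Gorenstein if $\mathrm{grade}\,\mathrm{Ext}^i_\Lambda(N,\Lambda)\geq i$ for every $N\in \mathrm{mod}\,\Lambda^{op}$ and every $1\leq i\leq k$. $\mathrm{r.pd}_\Lambda$ denotes right projective dimension; a bound $\mathrm{r.pd}_\Lambda(X)\le -1$ means $X=0$. $\Omega^d(\mathrm{mod}\,\Lambda)$ is the full subcategory of $\mathrm{mod}\,\Lambda$ of $d$th syzygy modules, i.e. modules $M$ admitting an exact sequence $0\to M\to P_{d-1}\to\cdots\to P_0$ with all $P_i$ finitely generated projective; $\Omega^0(\mathrm{mod}\,\Lambda)=\mathrm{mod}\,\Lambda$. For a finitely generated module $X$, a $d$th syzygy of $X$ is a module $B$ fitting in an exact sequence $0\to B\to P_{d-1}\to\cdots\to P_0\to X\to 0$ with all $P_i$ finitely generated projective (the $0$th syzygy of $X$ is $X$). For $M\in\mathrm{mod}\,\Lambda$, choose a presentation $P_1\to P_0\to M\to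 0$ with $P_0,P_1$ finitely generated projective and set $D(M)=\mathrm{Coker}(P_0^*\to P_1^* )\in\mathrm{mod}\,\Lambda^{op}$. Up to isomorphism, the modules $\mathrm{Ext}^i_\Lambda(D(M),\Lambda)$, $i\geq 1$, do not depend on the choice of presentation. *)

theory Defs
  imports "HOL-Algebra.Module" "HOL-Algebra.AbelCoset"
begin

text \<open>
  The library's locale \<open>module\<close> requires a commutative ring. Here modules over a possibly
  noncommutative ring are set up on the library's record type \<open>module\<close>, whose fields \<open>mult\<close> and
  \<open>one\<close> play no role and are left undefined in the constructions below.

  Right modules over \<open>R\<close> are left modules over the opposite ring \<open>opp R\<close>. As \<open>opp (opp R) = R\<close>,
  every notion below is defined for left modules only and serves both sides.
\<close>

definition opp :: "('r, 'z) ring_scheme \<Rightarrow> ('r, 'z) ring_scheme"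
  where "opp R = R\<lparr>mult := \<lambda>x y. y \<otimes>\<^bsub>R\<^esub> x\<rparr>"

lemma opp_opp [simp]: "opp (opp R) = R"
  by (simp add: opp_def)

locale left_module = R?: ring R + M?: abelian_group M
    for R :: "('r, 'z) ring_scheme" (structure) and M :: "('r, 'm) module" (structure) +
  assumes smult_closed: "\<lbrakk>a \<in> carrier R; x \<in> carrier M\<rbrakk> \<Longrightarrow> a \<odot>\<^bsub>M\<^esub> x \<in> carrier M"
    and smult_l_distr: "\<lbrakk>a \<in> carrier R; b \<in> carrier R; x \<in> carrier M\<rbrakk> \<Longrightarrow>
      (a \<oplus>\<^bsub>R\<^esub> b) \<odot>\<^bsub>M\<^esub> x = a \<odot>\<^bsub>M\<^esub> x \<oplus>\<^bsub>M\<^esub> b \<odot>\<^bsub>M\<^esub> x"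
    and smult_r_distr: "\<lbrakk>a \<in> carrier R; x \<in> carrier M; y \<in> carrier M\<rbrakk> \<Longrightarrow>
      a \<odot>\<^bsub>M\<^esub> (x \<oplus>\<^bsub>M\<^esub> y) = a \<odot>\<^bsub>M\<^esub> x \<oplus>\<^bsub>M\<^esub> a \<odot>\<^bsub>M\<^esub> y"
    and smult_assoc: "\<lbrakk>a \<in> carrier R; b \<in> carrier R; x \<in> carrier M\<rbrakk> \<Longrightarrow>
      (a \<otimes>\<^bsub>R\<^esub> b) \<odot>\<^bsub>M\<^esub> x = a \<odot>\<^bsub>M\<^esub> (b \<odot>\<^bsub>M\<^esub> x)"
    and smult_one: "x \<in> carrier M \<Longrightarrow> \<one>\<^bsub>R\<^esub> \<odot>\<^bsub>M\<^esub> x = x"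

definition lmod_hom ::
    "('r, 'z) ring_scheme \<Rightarrow> ('r, 'm) module \<Rightarrow> ('r, 'n) module \<Rightarrow> ('m \<Rightarrow> 'n) set"
  where "lmod_hom R M N =
    {f \<in> carrier M \<rightarrow> carrier N.
       (\<forall>x\<in>carrier M. \<forall>y\<in>carrier M. f (x \<oplus>\<^bsub>M\<^esub> y) = f x \<oplus>\<^bsub>N\<^esub> f y) \<and>
       (\<forall>r\<in>carrier R. \<forall>x\<in>carrier M. f (r \<odot>\<^bsub>M\<^esub> x) = r \<odot>\<^bsub>N\<^esub> f x)}"

definition lmod_epi ::
    "('r, 'z) ring_scheme \<Rightarrow> ('r, 'm) module \<Rightarrow> ('r, 'n) module \<Rightarrow> ('m \<Rightarrow> 'n) set"
  where "lmod_epi R M N = {f \<in> lmod_hom R M N. f ` carrier M = carrier N}"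

definition lmod_iso ::
    "('r, 'z) ring_scheme \<Rightarrow> ('r, 'm) module \<Rightarrow> ('r, 'n) module \<Rightarrow> bool"
  where "lmod_iso R M N \<longleftrightarrow> (\<exists>f\<in>lmod_hom R M N. bij_betw f (carrier M) (carrier N))"

text \<open>Exactness of \<open>0 \<rightarrow> A \<rightarrow> B \<rightarrow> C \<rightarrow> 0\<close>.\<close>

definition short_exact ::
    "('r, 'z) ring_scheme \<Rightarrow> ('r, 'a) module \<Rightarrow> ('a \<Rightarrow> 'b) \<Rightarrow> ('r, 'b) module \<Rightarrow> ('b \<Rightarrow> 'c) \<Rightarrow>
      ('r, 'c) module \<Rightarrow> bool"
  where "short_exact R A f B g C \<longleftrightarrow>
    f \<in> lmod_hom R A B \<and> inj_on f (carrier A) \<and>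
    f ` carrier A = a_kernel B C g \<and> g \<in> lmod_epi R B C"

definition kernel_module :: "('r, 'm) module \<Rightarrow> ('r, 'n) module \<Rightarrow> ('m \<Rightarrow> 'n) \<Rightarrow> ('r, 'm) module"
  where "kernel_module M N f = M\<lparr>carrier := a_kernel M N f\<rparr>"

definition direct_sum :: "('r, 'm) module \<Rightarrow> ('r, 'n) module \<Rightarrow> ('r, 'm \<times> 'n) module"
  where "direct_sum M N =
    \<lparr>carrier = carrier M \<times> carrier N, mult = undefined, one = undefined,
     zero = (\<zero>\<^bsub>M\<^esub>, \<zero>\<^bsub>N\<^esub>), add = \<lambda>(x, y) (x', y'). (x \<oplus>\<^bsub>M\<^esub> x', y \<oplus>\<^bsub>N\<^esub> y'),
     smult = \<lambda>r (x, y). (r \<odot>\<^bsub>M\<^esub> x, r \<odot>\<^bsub>N\<^esub> y)\<rparr>"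

definition quotient_module :: "('r, 'm) module \<Rightarrow> 'm set \<Rightarrow> ('r, 'm set) module"
  where "quotient_module M N =
    \<lparr>carrier = a_rcosets\<^bsub>M\<^esub> N, mult = undefined, one = undefined,
     zero = N, add = set_add M,
     smult = \<lambda>r S. \<Union>x\<in>S. N +>\<^bsub>M\<^esub> (r \<odot>\<^bsub>M\<^esub> x)\<rparr>"

definition regular_module :: "('r, 'z) ring_scheme \<Rightarrow> ('r, 'r) module"
  where "regular_module R =
    \<lparr>carrier = carrier R, mult = mult R, one = one R, zero = zero R, add = add R, smult = mult R\<rparr>"

definition module_span ::
    "('r, 'z) ring_scheme \<Rightarrow> ('r, 'm) module \<Rightarrow> 'm set \<Rightarrow> 'm set"
  where "module_span R M A = \<Inter>{N. submodule N R M \<and> A \<subseteq> N}"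

definition fg_module :: "('r, 'z) ring_scheme \<Rightarrow> ('r, 'm) module \<Rightarrow> bool"
  where "fg_module R M \<longleftrightarrow> left_module R M \<and>
    (\<exists>A. finite A \<and> A \<subseteq> carrier M \<and> carrier M = module_span R M A)"

definition left_noetherian :: "('r, 'z) ring_scheme \<Rightarrow> bool"
  where "left_noetherian R \<longleftrightarrow> ring R \<and>
    (\<forall>I. submodule I R (regular_module R) \<longrightarrow>
      (\<exists>A. finite A \<and> A \<subseteq> I \<and> I = module_span R (regular_module R) A))"

text \<open>
  HOL cannot quantify over the carrier types of modules. A finitely generated module is isomorphic
  to some \<open>R\<^sup>n/K\<close>, whose elements are sets of vectors, and vectors are functions from indices
  to ring elements. Hence modules with carriers in the following type represent all of
  \<open>mod R\<close> and \<open>mod (opp R)\<close> up to isomorphism, and quantifiers over modules range over it.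
\<close>

type_synonym 'r fg_elem = "(nat \<Rightarrow> 'r) set"

text \<open>
  The lifting property. Since \<open>P\<close> is finitely generated, testing on modules with elements in
  \<open>'r fg_elem\<close> suffices: these include isomorphic copies of \<open>P\<close> and of every \<open>R\<^sup>n\<close>.
\<close>

definition fg_projective :: "('r, 'z) ring_scheme \<Rightarrow> ('r, 'p) module \<Rightarrow> bool"
  where "fg_projective R P \<longleftrightarrow> fg_module R P \<and>
    (\<forall>(M :: ('r, 'r fg_elem) module) (N :: ('r, 'r fg_elem) module) f g.
      left_module R M \<and> left_module R N \<and> f \<in> lmod_epi R M N \<and> g \<in> lmod_hom R P N \<longrightarrow>
      (\<exists>h\<in>lmod_hom R P M. \<forall>x\<in>carrier P. f (h x) = g x))"

text \<open>
  \<open>Hom\<^sub>R(M, R)\<close> with the right action \<open>(f \<cdot> r) m = f m \<otimes> r\<close>, a left module over \<open>opp R\<close>. Homomorphisms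
  are made extensional so that equal maps on the carrier are equal elements.
\<close>

definition dual :: "('r, 'z) ring_scheme \<Rightarrow> ('r, 'm) module \<Rightarrow> ('r, 'm \<Rightarrow> 'r) module"
  where "dual R M =
    \<lparr>carrier = lmod_hom R M (regular_module R) \<inter> extensional (carrier M),
     mult = undefined, one = undefined,
     zero = (\<lambda>m\<in>carrier M. \<zero>\<^bsub>R\<^esub>),
     add = \<lambda>f g. \<lambda>m\<in>carrier M. f m \<oplus>\<^bsub>R\<^esub> g m,
     smult = \<lambda>r f. \<lambda>m\<in>carrier M. f m \<otimes>\<^bsub>R\<^esub> r\<rparr>"

text \<open>The map \<open>N\<^sup>* \<rightarrow> M\<^sup>*\<close> induced by \<open>f: M \<rightarrow> N\<close>.\<close>

definition dual_map :: "('r, 'm) module \<Rightarrow> ('m \<Rightarrow> 'n) \<Rightarrow> ('n \<Rightarrow> 'r) \<Rightarrow> 'm \<Rightarrow> 'r"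
  where "dual_map M f = (\<lambda>\<phi>. \<lambda>m\<in>carrier M. \<phi> (f m))"

text \<open>
  In \<open>\<cdots> \<rightarrow> P\<^sub>1 \<rightarrow> P\<^sub>0 \<rightarrow> X \<rightarrow> 0\<close> the differentials are \<open>\<delta> i : P\<^sub>i\<^sub>+\<^sub>1 \<rightarrow> P\<^sub>i\<close> and \<open>\<epsilon> : P\<^sub>0 \<rightarrow> X\<close>;
  \<open>out_kernel X P \<delta> \<epsilon> i\<close> is the kernel of the map leaving \<open>P\<^sub>i\<close>.
\<close>

definition out_kernel ::
    "('r, 'x) module \<Rightarrow> (nat \<Rightarrow> ('r, 'p) module) \<Rightarrow> (nat \<Rightarrow> 'p \<Rightarrow> 'p) \<Rightarrow> ('p \<Rightarrow> 'x) \<Rightarrow> nat \<Rightarrow> 'p set"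
  where "out_kernel X P \<delta> \<epsilon> i =
    (case i of 0 \<Rightarrow> a_kernel (P 0) X \<epsilon> | Suc j \<Rightarrow> a_kernel (P (Suc j)) (P j) (\<delta> j))"

text \<open>Exactness of \<open>P\<^sub>n\<^sub>-\<^sub>1 \<rightarrow> \<cdots> \<rightarrow> P\<^sub>0 \<rightarrow> X \<rightarrow> 0\<close> for \<open>n \<ge> 1\<close>; the kernel at \<open>P\<^sub>n\<^sub>-\<^sub>1\<close> is arbitrary.\<close>

definition partial_resolution ::
    "('r, 'z) ring_scheme \<Rightarrow> nat \<Rightarrow> ('r, 'x) module \<Rightarrow>
      (nat \<Rightarrow> ('r, 'p) module) \<Rightarrow> (nat \<Rightarrow> 'p \<Rightarrow> 'p) \<Rightarrow> ('p \<Rightarrow> 'x) \<Rightarrow> bool"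
  where "partial_resolution R n X P \<delta> \<epsilon> \<longleftrightarrow>
    (\<forall>i<n. fg_projective R (P i)) \<and>
    \<epsilon> \<in> lmod_epi R (P 0) X \<and>
    (\<forall>i. Suc i < n \<longrightarrow> \<delta> i \<in> lmod_hom R (P (Suc i)) (P i) \<and>
      \<delta> i ` carrier (P (Suc i)) = out_kernel X P \<delta> \<epsilon> i)"

definition projective_resolution ::
    "('r, 'z) ring_scheme \<Rightarrow> ('r, 'x) module \<Rightarrow>
      (nat \<Rightarrow> ('r, 'p) module) \<Rightarrow> (nat \<Rightarrow> 'p \<Rightarrow> 'p) \<Rightarrow> ('p \<Rightarrow> 'x) \<Rightarrow> bool"
  where "projective_resolution R X P \<delta> \<epsilon> \<longleftrightarrow> (\<forall>n\<ge>1. partial_resolution R n X P \<delta> \<epsilon>)"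

text \<open>\<open>H\<^sup>i\<close> of the complex \<open>0 \<rightarrow> P\<^sub>0\<^sup>* \<rightarrow> P\<^sub>1\<^sup>* \<rightarrow> \<cdots>\<close>.\<close>

definition dual_cohomology ::
    "('r, 'z) ring_scheme \<Rightarrow> (nat \<Rightarrow> ('r, 'p) module) \<Rightarrow> (nat \<Rightarrow> 'p \<Rightarrow> 'p) \<Rightarrow> nat \<Rightarrow>
      ('r, ('p \<Rightarrow> 'r) set) module"
  where "dual_cohomology R P \<delta> i = quotient_module
    (kernel_module (dual R (P i)) (dual R (P (Suc i))) (dual_map (P (Suc i)) (\<delta> i)))
    (case i of 0 \<Rightarrow> {\<zero>\<^bsub>dual R (P 0)\<^esub>}
       | Suc j \<Rightarrow> dual_map (P (Suc j)) (\<delta> j) ` carrier (dual R (P j)))"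

text \<open>
  \<open>Ext\<^sup>i\<^sub>R(X, R)\<close> for finitely generated \<open>X\<close> over a left noetherian ring \<open>R\<close>, as a left module
  over \<open>opp R\<close>, computed from a chosen resolution by finitely generated projectives.
\<close>

definition Ext_ring ::
    "('r, 'z) ring_scheme \<Rightarrow> nat \<Rightarrow> ('r, 'x) module \<Rightarrow> ('r, ('r fg_elem \<Rightarrow> 'r) set) module"
  where "Ext_ring R i X =
    (let (P, \<delta>, \<epsilon>) = (SOME (P :: nat \<Rightarrow> ('r, 'r fg_elem) module, \<delta>, \<epsilon>).
       projective_resolution R X P \<delta> \<epsilon>)
     in dual_cohomology R P \<delta> i)"

text \<open>\<open>D(M) = Coker (P\<^sub>0\<^sup>* \<rightarrow> P\<^sub>1\<^sup>*)\<close>, a left module over \<open>opp R\<close>, for a chosen presentation.\<close>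

definition transpose_module ::
    "('r, 'z) ring_scheme \<Rightarrow> ('r, 'm) module \<Rightarrow> ('r, ('r fg_elem \<Rightarrow> 'r) set) module"
  where "transpose_module R M =
    (let (P, \<delta>, \<epsilon>) = (SOME (P :: nat \<Rightarrow> ('r, 'r fg_elem) module, \<delta>, \<epsilon>).
       partial_resolution R 2 M P \<delta> \<epsilon>)
     in quotient_module (dual R (P 1)) (dual_map (P 1) (\<delta> 0) ` carrier (dual R (P 0))))"

definition grade_ge :: "('r, 'z) ring_scheme \<Rightarrow> ('r, 'x) module \<Rightarrow> nat \<Rightarrow> bool"
  where "grade_ge R X i \<longleftrightarrow> (\<forall>j<i. carrier (Ext_ring R j X) = {\<zero>\<^bsub>Ext_ring R j X\<^esub>})"

definition quasi_gorenstein :: "nat \<Rightarrow> ('r, 'z) ring_scheme \<Rightarrow> bool"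
  where "quasi_gorenstein k R \<longleftrightarrow>
    (\<forall>N :: ('r, 'r fg_elem) module. fg_module (opp R) N \<longrightarrow>
      (\<forall>i. 1 \<le> i \<and> i \<le> k \<longrightarrow> grade_ge R (Ext_ring (opp R) i N) i))"

text \<open>
  \<open>pd X \<le> n\<close> for finitely generated \<open>X\<close> over a left noetherian ring. For \<open>n = - 1\<close> the whole
  resolution vanishes, so the bound says \<open>X = 0\<close>.
\<close>

definition pd_le :: "('r, 'z) ring_scheme \<Rightarrow> ('r, 'x) module \<Rightarrow> int \<Rightarrow> bool"
  where "pd_le R X n \<longleftrightarrow>
    (\<exists>(P :: nat \<Rightarrow> ('r, 'r fg_elem) module) \<delta> \<epsilon>. projective_resolution R X P \<delta> \<epsilon> \<and>
      (\<forall>i. int i > n \<longrightarrow> carrier (P i) = {\<zero>\<^bsub>P i\<^esub>}))"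

text \<open>\<open>B\<close> is a \<open>d\<close>th syzygy of \<open>X\<close>: \<open>0 \<rightarrow> B \<rightarrow> P\<^sub>d\<^sub>-\<^sub>1 \<rightarrow> \<cdots> \<rightarrow> P\<^sub>0 \<rightarrow> X \<rightarrow> 0\<close> is exact.\<close>

definition is_syzygy ::
    "('r, 'z) ring_scheme \<Rightarrow> nat \<Rightarrow> ('r, 'x) module \<Rightarrow> ('r, 'b) module \<Rightarrow> bool"
  where "is_syzygy R d X B \<longleftrightarrow> left_module R B \<and>
    (if d = 0 then lmod_iso R B X
     else \<exists>(P :: nat \<Rightarrow> ('r, 'r fg_elem) module) \<delta> \<epsilon> \<iota>. partial_resolution R d X P \<delta> \<epsilon> \<and>
       \<iota> \<in> lmod_hom R B (P (d - 1)) \<and> inj_on \<iota> (carrier B) \<and>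
       \<iota> ` carrier B = out_kernel X P \<delta> \<epsilon> (d - 1))"

text \<open>
  \<open>M \<in> \<Omega>\<^sup>d(mod R)\<close>: \<open>0 \<rightarrow> M \<rightarrow> P\<^sub>d\<^sub>-\<^sub>1 \<rightarrow> \<cdots> \<rightarrow> P\<^sub>0\<close> is exact, with no condition at \<open>P\<^sub>0\<close>.
\<close>

definition syzygy_module :: "('r, 'z) ring_scheme \<Rightarrow> nat \<Rightarrow> ('r, 'm) module \<Rightarrow> bool"
  where "syzygy_module R d M \<longleftrightarrow> fg_module R M \<and>
    (d > 0 \<longrightarrow>
      (\<exists>(P :: nat \<Rightarrow> ('r, 'r fg_elem) module) \<delta> \<iota>.
        (\<forall>i<d. fg_projective R (P i)) \<and>
        (\<forall>i. Suc i < d \<longrightarrow> \<delta> i \<in> lmod_hom R (P (Suc i)) (P i)) \<and>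
        (\<forall>i. Suc (Suc i) < d \<longrightarrow>
          \<delta> (Suc i) ` carrier (P (Suc (Suc i))) = a_kernel (P (Suc i)) (P i) (\<delta> i)) \<and>
        \<iota> \<in> lmod_hom R M (P (d - 1)) \<and> inj_on \<iota> (carrier M) \<and>
        (d \<ge> 2 \<longrightarrow> \<iota> ` carrier M = a_kernel (P (d - 1)) (P (d - 2)) (\<delta> (d - 2)))))"

end

theory Submission
  imports Defs
begin

text \<open>
  Let \<open>Q\<close> be a projective resolution of \<open>D(M)\<close> starting with \<open>P\<^sub>1\<^sup>*, P\<^sub>0\<^sup>*\<close>, and put
  \<open>C\<^sub>i = Coker (Q\<^sub>i\<^sup>* \<rightarrow> Q\<^sub>i\<^sub>+\<^sub>1\<^sup>*)\<close>. Then \<open>C\<^sub>0 \<cong> M\<close>, and \<open>C\<^sub>i\<close> maps to the projective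
  \<open>G\<^sub>i = Q\<^sub>i\<^sub>+\<^sub>2\<^sup>*\<close> with kernel \<open>E\<^sub>i = Ext\<^sup>i\<^sup>+\<^sup>1(D(M), R)\<close> and cokernel \<open>C\<^sub>i\<^sub>+\<^sub>1\<close>.
  The chain is built for any such sequence of modules with \<open>grade E\<^sub>i \<ge> i + 1\<close>, by induction on its
  length. Suppose \<open>C\<^sub>1 \<oplus> P' = M'\<^sub>0 \<rightarrow> \<cdots> \<rightarrow> M'\<^sub>n\<close>, with kernels \<open>B'\<^sub>d\<close>, is the chain
  of \<open>C\<^sub>1\<close>. All \<open>M'\<^sub>d\<close> are quotients of \<open>H = G\<^sub>0 \<oplus> P'\<close>, and
  \<open>K\<^sub>d = Ker (H \<rightarrow> M'\<^sub>d)\<close> is a syzygy of \<open>M'\<^sub>d\<close>. As \<open>K\<^sub>d\<^sub>+\<^sub>1 / K\<^sub>d = B'\<^sub>d\<close>, lifting an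
  epimorphism \<open>F\<^sub>d \<rightarrow> B'\<^sub>d\<close> from a projective gives an epimorphism \<open>K\<^sub>d \<oplus> F\<^sub>d \<rightarrow> K\<^sub>d\<^sub>+\<^sub>1\<close> whose kernel
  is a syzygy of \<open>B'\<^sub>d\<close>. Adding the remaining \<open>F\<^sub>i\<close> to both sides yields the new chain
  \<open>C\<^sub>0 \<oplus> T\<^sub>0 \<rightarrow> K\<^sub>0 \<oplus> T\<^sub>0 \<rightarrow> K\<^sub>1 \<oplus> T\<^sub>1 \<rightarrow> \<cdots>\<close> with \<open>T\<^sub>d = F\<^sub>d \<oplus> \<cdots> \<oplus> F\<^sub>n\<^sub>-\<^sub>1\<close>.
  The grade condition gives \<open>Ext\<^sup>1(B'\<^sub>d, R) = 0\<close>, from which dual exactness and the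
  bound on the projective dimension follow.
\<close>

text \<open>Counting indices shows how the grade condition works. The kernel B'_d is a dth syzygy of
  E_(d+1), so Ext^1(B'_d, R) = Ext^(d+1)(E_(d+1), R), which vanishes since grade E_(d+1) \<ge> d +
  2; the shifted chain itself used up only d + 1. The first step uses Hom(E_0, R) = 0. By the
  vanishing, 0 -> B_(d+1) -> F_d -> B'_d -> 0 stays exact under dualizing, so each passage from B'_d
  to B_(d+1) raises the projective dimension of the dual by at most one, starting from a zero
  module. The alternative description of B_d comes from the shape of Q: from place 2 on it resolves
  the dual of M. Carrier types shape the rest. A chain is a function into a single type, whereas
  sums, quotients and duals produce new types, and \<open>Ext_ring\<close> depends on a choice. So
  modules are repeatedly replaced by isomorphic copies with elements in \<open>fg_elem\<close>, and
  each property in the theorem has to be shown invariant under isomorphism.\<close>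

lemma opp_sel [simp]:
  "carrier (opp R) = carrier R" "zero (opp R) = zero R" "add (opp R) = add R"
  "one (opp R) = one R" "mult (opp R) = (\<lambda>x y. y \<otimes>\<^bsub>R\<^esub> x)"
  by (simp_all add: opp_def)

lemma ring_opp:
  assumes "ring R" shows "ring (opp R)"
proof -
  interpret ring R by fact
  have "abelian_group (opp R)"
    by (rule abelian_groupI) (auto simp: a_ac intro: bexI[of _ "\<ominus>\<^bsub>R\<^esub> _"] simp: r_neg)
  moreover have "monoid (opp R)"
    by (rule monoidI) (auto simp: m_assoc)
  ultimately show ?thesis
    by (rule ringI) (auto simp: l_distr r_distr)
qed

section \<open>Left modules and their submodules\<close>

lemmas left_module_ring = left_module.axioms(1)

text \<open>Inverses are required only through the equation (-1) x + x = 0, so a construction never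
  has to name its own negation; closure under the action then provides the inverse.\<close>

lemma left_moduleI:
  assumes "ring R"
    and "\<And>x y. \<lbrakk>x \<in> carrier M; y \<in> carrier M\<rbrakk> \<Longrightarrow> x \<oplus>\<^bsub>M\<^esub> y \<in> carrier M"
    and "\<zero>\<^bsub>M\<^esub> \<in> carrier M"
    and "\<And>x y z. \<lbrakk>x \<in> carrier M; y \<in> carrier M; z \<in> carrier M\<rbrakk> \<Longrightarrow>
      (x \<oplus>\<^bsub>M\<^esub> y) \<oplus>\<^bsub>M\<^esub> z = x \<oplus>\<^bsub>M\<^esub> (y \<oplus>\<^bsub>M\<^esub> z)"
    and "\<And>x y. \<lbrakk>x \<in> carrier M; y \<in> carrier M\<rbrakk> \<Longrightarrow> x \<oplus>\<^bsub>M\<^esub> y = y \<oplus>\<^bsub>M\<^esub> x"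
    and "\<And>x. x \<in> carrier M \<Longrightarrow> \<zero>\<^bsub>M\<^esub> \<oplus>\<^bsub>M\<^esub> x = x"
    and "\<And>x. x \<in> carrier M \<Longrightarrow> (\<ominus>\<^bsub>R\<^esub> \<one>\<^bsub>R\<^esub>) \<odot>\<^bsub>M\<^esub> x \<oplus>\<^bsub>M\<^esub> x = \<zero>\<^bsub>M\<^esub>"
    and "\<And>a x. \<lbrakk>a \<in> carrier R; x \<in> carrier M\<rbrakk> \<Longrightarrow> a \<odot>\<^bsub>M\<^esub> x \<in> carrier M"
    and "\<And>a b x. \<lbrakk>a \<in> carrier R; b \<in> carrier R; x \<in> carrier M\<rbrakk> \<Longrightarrow>
      (a \<oplus>\<^bsub>R\<^esub> b) \<odot>\<^bsub>M\<^esub> x = a \<odot>\<^bsub>M\<^esub> x \<oplus>\<^bsub>M\<^esub> b \<odot>\<^bsub>M\<^esub> x"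
    and "\<And>a x y. \<lbrakk>a \<in> carrier R; x \<in> carrier M; y \<in> carrier M\<rbrakk> \<Longrightarrow>
      a \<odot>\<^bsub>M\<^esub> (x \<oplus>\<^bsub>M\<^esub> y) = a \<odot>\<^bsub>M\<^esub> x \<oplus>\<^bsub>M\<^esub> a \<odot>\<^bsub>M\<^esub> y"
    and "\<And>a b x. \<lbrakk>a \<in> carrier R; b \<in> carrier R; x \<in> carrier M\<rbrakk> \<Longrightarrow>
      (a \<otimes>\<^bsub>R\<^esub> b) \<odot>\<^bsub>M\<^esub> x = a \<odot>\<^bsub>M\<^esub> (b \<odot>\<^bsub>M\<^esub> x)"
    and "\<And>x. x \<in> carrier M \<Longrightarrow> \<one>\<^bsub>R\<^esub> \<odot>\<^bsub>M\<^esub> x = x"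
  shows "left_module R M"
proof -
  interpret ring R by fact
  have "\<exists>y\<in>carrier M. y \<oplus>\<^bsub>M\<^esub> x = \<zero>\<^bsub>M\<^esub>" if "x \<in> carrier M" for x
    using assms(7)[OF that] assms(8)[of "\<ominus>\<^bsub>R\<^esub> \<one>\<^bsub>R\<^esub>" x] that by auto
  then have "abelian_group M"
    by (intro abelian_groupI assms(2-6))
  then show ?thesis
    by (intro left_module.intro left_module_axioms.intro assms)
qed

context left_module
begin

lemma zero_smult [simp]:
  assumes "x \<in> carrier M" shows "\<zero>\<^bsub>R\<^esub> \<odot>\<^bsub>M\<^esub> x = \<zero>\<^bsub>M\<^esub>"
proof -
  have "\<zero>\<^bsub>R\<^esub> \<odot>\<^bsub>M\<^esub> x \<oplus>\<^bsub>M\<^esub> \<zero>\<^bsub>R\<^esub> \<odot>\<^bsub>M\<^esub> x = \<zero>\<^bsub>M\<^esub> \<oplus>\<^bsub>M\<^esub> \<zero>\<^bsub>R\<^esub> \<odot>\<^bsub>M\<^esub> x"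
    using assms smult_l_distr[of "\<zero>\<^bsub>R\<^esub>" "\<zero>\<^bsub>R\<^esub>" x] smult_closed[of "\<zero>\<^bsub>R\<^esub>" x] by simp
  then show ?thesis
    using assms smult_closed[of "\<zero>\<^bsub>R\<^esub>" x] M.add.right_cancel M.zero_closed by blast
qed

lemma smult_zero [simp]:
  assumes "r \<in> carrier R" shows "r \<odot>\<^bsub>M\<^esub> \<zero>\<^bsub>M\<^esub> = \<zero>\<^bsub>M\<^esub>"
proof -
  have "r \<odot>\<^bsub>M\<^esub> \<zero>\<^bsub>M\<^esub> \<oplus>\<^bsub>M\<^esub> r \<odot>\<^bsub>M\<^esub> \<zero>\<^bsub>M\<^esub> = \<zero>\<^bsub>M\<^esub> \<oplus>\<^bsub>M\<^esub> r \<odot>\<^bsub>M\<^esub> \<zero>\<^bsub>M\<^esub>"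
    using assms smult_r_distr[of r "\<zero>\<^bsub>M\<^esub>" "\<zero>\<^bsub>M\<^esub>"] smult_closed[of r "\<zero>\<^bsub>M\<^esub>"] by simp
  then show ?thesis
    using assms smult_closed[of r "\<zero>\<^bsub>M\<^esub>"] M.add.right_cancel M.zero_closed by blast
qed

lemma minus_one_smult:
  assumes "x \<in> carrier M" shows "(\<ominus>\<^bsub>R\<^esub> \<one>\<^bsub>R\<^esub>) \<odot>\<^bsub>M\<^esub> x = \<ominus>\<^bsub>M\<^esub> x"
proof -
  have "(\<ominus>\<^bsub>R\<^esub> \<one>\<^bsub>R\<^esub>) \<odot>\<^bsub>M\<^esub> x \<oplus>\<^bsub>M\<^esub> x = \<zero>\<^bsub>M\<^esub>"
    using assms smult_l_distr[of "\<ominus>\<^bsub>R\<^esub> \<one>\<^bsub>R\<^esub>" "\<one>\<^bsub>R\<^esub>" x] smult_one[of x] by (simp add: R.l_neg)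
  then show ?thesis
    using assms smult_closed[of "\<ominus>\<^bsub>R\<^esub> \<one>\<^bsub>R\<^esub>" x] M.minus_equality by force
qed

lemma submoduleI:
  assumes "H \<subseteq> carrier M" "\<zero>\<^bsub>M\<^esub> \<in> H"
    and "\<And>x y. \<lbrakk>x \<in> H; y \<in> H\<rbrakk> \<Longrightarrow> x \<oplus>\<^bsub>M\<^esub> y \<in> H"
    and "\<And>r x. \<lbrakk>r \<in> carrier R; x \<in> H\<rbrakk> \<Longrightarrow> r \<odot>\<^bsub>M\<^esub> x \<in> H"
  shows "submodule H R M"
proof -
  have "\<ominus>\<^bsub>M\<^esub> x \<in> H" if "x \<in> H" for x
    using assms(1) assms(4)[of "\<ominus>\<^bsub>R\<^esub> \<one>\<^bsub>R\<^esub>" x] that minus_one_smult[of x] by auto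
  then show ?thesis
    using assms by (intro submodule.intro subgroup.intro submodule_axioms.intro)
      (auto simp: a_inv_def[symmetric])
qed

lemma minus_add_cancel: "\<lbrakk>x \<in> carrier M; y \<in> carrier M\<rbrakk> \<Longrightarrow> (x \<ominus>\<^bsub>M\<^esub> y) \<oplus>\<^bsub>M\<^esub> y = x"
  by (simp add: a_minus_def M.a_assoc M.l_neg)

lemma add_minus_cancel: "\<lbrakk>x \<in> carrier M; y \<in> carrier M\<rbrakk> \<Longrightarrow> (x \<oplus>\<^bsub>M\<^esub> y) \<ominus>\<^bsub>M\<^esub> y = x"
  by (simp add: a_minus_def M.a_assoc M.r_neg)

lemma minus_eq_zero_iff:
  "\<lbrakk>x \<in> carrier M; y \<in> carrier M\<rbrakk> \<Longrightarrow> x \<ominus>\<^bsub>M\<^esub> y = \<zero>\<^bsub>M\<^esub> \<longleftrightarrow> x = y"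
  by (metis a_minus_def M.r_neg minus_add_cancel M.l_zero)

end

lemma submoduleD:
  assumes "submodule H R M"
  shows "H \<subseteq> carrier M" "\<zero>\<^bsub>M\<^esub> \<in> H"
    and "\<And>x y. \<lbrakk>x \<in> H; y \<in> H\<rbrakk> \<Longrightarrow> x \<oplus>\<^bsub>M\<^esub> y \<in> H"
    and "\<And>r x. \<lbrakk>r \<in> carrier R; x \<in> H\<rbrakk> \<Longrightarrow> r \<odot>\<^bsub>M\<^esub> x \<in> H"
    and "\<And>x. x \<in> H \<Longrightarrow> \<ominus>\<^bsub>M\<^esub> x \<in> H"
    and "\<And>x y. \<lbrakk>x \<in> H; y \<in> H\<rbrakk> \<Longrightarrow> x \<ominus>\<^bsub>M\<^esub> y \<in> H"
  using submodule.axioms[OF assms] submodule.smult_closed[OF assms]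
  by (auto simp: subgroup_def a_inv_def a_minus_def)

lemma left_module_submodule:
  assumes "left_module R M" "submodule H R M"
  shows "left_module R (M\<lparr>carrier := H\<rparr>)"
proof -
  interpret left_module R M by fact
  note D = submoduleD[OF assms(2)]
  show ?thesis
    using D(1)
    by (intro left_moduleI)
      (auto simp: D M.a_assoc smult_l_distr smult_r_distr smult_assoc smult_one subset_iff
        minus_one_smult M.l_neg R.ring_axioms intro: M.a_comm)
qed

lemma submodule_submodule_iff:
  assumes "left_module R M" "submodule H R M"
  shows "submodule L R (M\<lparr>carrier := H\<rparr>) \<longleftrightarrow> submodule L R M \<and> L \<subseteq> H"
proof
  interpret left_module R M by fact
  assume "submodule L R (M\<lparr>carrier := H\<rparr>)"
  note D = submoduleD[OF this]
  show "submodule L R M \<and> L \<subseteq> H"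
    using D submoduleD(1)[OF assms(2)] by (auto intro!: submoduleI)
next
  interpret H: left_module R "M\<lparr>carrier := H\<rparr>" by (rule left_module_submodule[OF assms])
  assume "submodule L R M \<and> L \<subseteq> H"
  then show "submodule L R (M\<lparr>carrier := H\<rparr>)"
    using submoduleD[of L R M] by (auto intro!: H.submoduleI)
qed

lemma submodule_carrier: "left_module R M \<Longrightarrow> submodule (carrier M) R M"
proof -
  assume "left_module R M"
  then interpret left_module R M .
  show ?thesis by (rule submoduleI) (auto intro: smult_closed)
qed

lemma submodule_zero: "left_module R M \<Longrightarrow> submodule {\<zero>\<^bsub>M\<^esub>} R M"
proof -
  assume "left_module R M"
  then interpret left_module R M .
  show ?thesis by (rule submoduleI) auto
qed

subsection \<open>Homomorphisms\<close>

lemma lmod_homI: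
  assumes "\<And>x. x \<in> carrier M \<Longrightarrow> f x \<in> carrier N"
    and "\<And>x y. \<lbrakk>x \<in> carrier M; y \<in> carrier M\<rbrakk> \<Longrightarrow> f (x \<oplus>\<^bsub>M\<^esub> y) = f x \<oplus>\<^bsub>N\<^esub> f y"
    and "\<And>r x. \<lbrakk>r \<in> carrier R; x \<in> carrier M\<rbrakk> \<Longrightarrow> f (r \<odot>\<^bsub>M\<^esub> x) = r \<odot>\<^bsub>N\<^esub> f x"
  shows "f \<in> lmod_hom R M N"
  using assms by (auto simp: lmod_hom_def)

lemma hom_closed: "\<lbrakk>f \<in> lmod_hom R M N; x \<in> carrier M\<rbrakk> \<Longrightarrow> f x \<in> carrier N"
  by (auto simp: lmod_hom_def)

lemma hom_add:
  "\<lbrakk>f \<in> lmod_hom R M N; x \<in> carrier M; y \<in> carrier M\<rbrakk> \<Longrightarrow> f (x \<oplus>\<^bsub>M\<^esub> y) = f x \<oplus>\<^bsub>N\<^esub> f y"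
  by (auto simp: lmod_hom_def)

lemma hom_smult:
  "\<lbrakk>f \<in> lmod_hom R M N; r \<in> carrier R; x \<in> carrier M\<rbrakk> \<Longrightarrow> f (r \<odot>\<^bsub>M\<^esub> x) = r \<odot>\<^bsub>N\<^esub> f x"
  by (auto simp: lmod_hom_def)

lemma hom_zero:
  assumes "left_module R M" "left_module R N" "f \<in> lmod_hom R M N"
  shows "f \<zero>\<^bsub>M\<^esub> = \<zero>\<^bsub>N\<^esub>"
proof -
  interpret M: left_module R M by fact
  interpret N: left_module R N by fact
  show ?thesis
    using hom_smult[OF assms(3), of "\<zero>\<^bsub>R\<^esub>" "\<zero>\<^bsub>M\<^esub>"] hom_closed[OF assms(3)] by simp
qed

lemma hom_a_inv:
  assumes "left_module R M" "left_module R N" "f \<in> lmod_hom R M N" "x \<in> carrier M"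
  shows "f (\<ominus>\<^bsub>M\<^esub> x) = \<ominus>\<^bsub>N\<^esub> f x"
proof -
  interpret M: left_module R M by fact
  interpret N: left_module R N by fact
  show ?thesis
    using hom_smult[OF assms(3), of "\<ominus>\<^bsub>R\<^esub> \<one>\<^bsub>R\<^esub>" x] hom_closed[OF assms(3)] assms(4)
    by (simp add: M.minus_one_smult N.minus_one_smult)
qed

lemma hom_minus:
  assumes "left_module R M" "left_module R N" "f \<in> lmod_hom R M N" "x \<in> carrier M" "y \<in> carrier M"
  shows "f (x \<ominus>\<^bsub>M\<^esub> y) = f x \<ominus>\<^bsub>N\<^esub> f y"
proof -
  interpret M: left_module R M by fact
  show ?thesis
    using assms by (simp add: a_minus_def hom_add hom_a_inv)
qed

text \<open>Values off the carrier do not matter for \<open>lmod_hom\<close>. This permits passing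
  from a homomorphism to its restriction, which the extensional elements of \<open>dual\<close>
  require.\<close>

lemma hom_cong:
  assumes "f \<in> lmod_hom R M N" "left_module R M" "\<And>x. x \<in> carrier M \<Longrightarrow> g x = f x"
  shows "g \<in> lmod_hom R M N"
proof -
  interpret left_module R M by fact
  show ?thesis
    using assms(1,3) smult_closed by (intro lmod_homI) (auto simp: hom_closed hom_add hom_smult)
qed

lemma hom_id: "(\<lambda>x. x) \<in> lmod_hom R M M"
  by (simp add: lmod_hom_def)

lemma hom_compose:
  "\<lbrakk>g \<in> lmod_hom R N L; f \<in> lmod_hom R M N\<rbrakk> \<Longrightarrow> (\<lambda>x. g (f x)) \<in> lmod_hom R M L"
  by (auto simp: lmod_hom_def Pi_iff)

lemma hom_zero_map: "left_module R N \<Longrightarrow> (\<lambda>x. \<zero>\<^bsub>N\<^esub>) \<in> lmod_hom R M N"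
proof -
  assume "left_module R N"
  then interpret left_module R N .
  show ?thesis by (rule lmod_homI) auto
qed

lemma hom_add_maps:
  assumes "left_module R N" "f \<in> lmod_hom R M N" "g \<in> lmod_hom R M N"
  shows "(\<lambda>x. f x \<oplus>\<^bsub>N\<^esub> g x) \<in> lmod_hom R M N"
proof -
  interpret left_module R N by fact
  show ?thesis
    using hom_closed[OF assms(2)] hom_closed[OF assms(3)]
    by (intro lmod_homI) (auto simp: hom_add[OF assms(2)] hom_add[OF assms(3)]
        hom_smult[OF assms(2)] hom_smult[OF assms(3)] smult_r_distr M.a_ac)
qed

lemma hom_minus_maps:
  assumes "left_module R N" "f \<in> lmod_hom R M N" "g \<in> lmod_hom R M N"
  shows "(\<lambda>x. f x \<ominus>\<^bsub>N\<^esub> g x) \<in> lmod_hom R M N"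
proof -
  interpret left_module R N by fact
  have neg: "r \<odot>\<^bsub>N\<^esub> (\<ominus>\<^bsub>N\<^esub> x) = \<ominus>\<^bsub>N\<^esub> (r \<odot>\<^bsub>N\<^esub> x)" if "r \<in> carrier R" "x \<in> carrier N" for r x
    using that smult_r_distr[of r "\<ominus>\<^bsub>N\<^esub> x" x] smult_closed M.minus_equality
    by (metis M.a_inv_closed M.l_neg smult_zero)
  have "(\<lambda>x. \<ominus>\<^bsub>N\<^esub> g x) \<in> lmod_hom R M N"
    using hom_closed[OF assms(3)]
    by (intro lmod_homI) (auto simp: hom_add[OF assms(3)] hom_smult[OF assms(3)] neg M.minus_add)
  from hom_add_maps[OF assms(1,2) this] show ?thesis
    by (simp add: a_minus_def)
qed

lemma hom_restrict_domain: "\<lbrakk>f \<in> lmod_hom R M N; H \<subseteq> carrier M\<rbrakk> \<Longrightarrow> f \<in> lmod_hom R (M\<lparr>carrier := H\<rparr>) N"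
  by (simp add: lmod_hom_def Pi_iff subset_iff)

lemma hom_restrict_codomain:
  "\<lbrakk>f \<in> lmod_hom R M N; f ` carrier M \<subseteq> H\<rbrakk> \<Longrightarrow> f \<in> lmod_hom R M (N\<lparr>carrier := H\<rparr>)"
  by (auto simp: lmod_hom_def)

lemma hom_submodule_codomainD:
  "\<lbrakk>f \<in> lmod_hom R M (N\<lparr>carrier := H\<rparr>); H \<subseteq> carrier N\<rbrakk> \<Longrightarrow> f \<in> lmod_hom R M N"
  by (auto simp: lmod_hom_def)

lemma hom_inclusion: "H \<subseteq> carrier M \<Longrightarrow> (\<lambda>x. x) \<in> lmod_hom R (M\<lparr>carrier := H\<rparr>) M"
  by (rule hom_restrict_domain[OF hom_id])

lemma epi_hom: "f \<in> lmod_epi R M N \<Longrightarrow> f \<in> lmod_hom R M N"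
  by (simp add: lmod_epi_def)

lemma epi_image: "f \<in> lmod_epi R M N \<Longrightarrow> f ` carrier M = carrier N"
  by (simp add: lmod_epi_def)

lemma epi_obtain:
  assumes "f \<in> lmod_epi R M N" "y \<in> carrier N"
  obtains x where "x \<in> carrier M" "f x = y"
  using assms(2) unfolding epi_image[OF assms(1), symmetric] by (blast intro: that)

lemma epi_compose:
  "\<lbrakk>g \<in> lmod_epi R N L; f \<in> lmod_epi R M N\<rbrakk> \<Longrightarrow> (\<lambda>x. g (f x)) \<in> lmod_epi R M L"
  unfolding lmod_epi_def mem_Collect_eq by (metis hom_compose image_image)

lemma mem_a_kernel: "x \<in> a_kernel M N f \<longleftrightarrow> x \<in> carrier M \<and> f x = \<zero>\<^bsub>N\<^esub>"
  by (simp add: a_kernel_def')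

lemma submodule_a_kernel:
  assumes "left_module R M" "left_module R N" "f \<in> lmod_hom R M N"
  shows "submodule (a_kernel M N f) R M"
proof -
  interpret M: left_module R M by fact
  interpret N: left_module R N by fact
  show ?thesis
    by (rule M.submoduleI)
      (auto simp: mem_a_kernel hom_zero[OF assms] hom_add[OF assms(3)] hom_smult[OF assms(3)] M.smult_closed)
qed

lemma left_module_kernel:
  assumes "left_module R M" "left_module R N" "f \<in> lmod_hom R M N"
  shows "left_module R (kernel_module M N f)"
  unfolding kernel_module_def using assms left_module_submodule submodule_a_kernel by blast

lemma kernel_module_sel [simp]:
  "carrier (kernel_module M N f) = a_kernel M N f" "zero (kernel_module M N f) = zero M"
  "add (kernel_module M N f) = add M" "smult (kernel_module M N f) = smult M"
  by (simp_all add: kernel_module_def)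

lemma submodule_image:
  assumes "left_module R M" "left_module R N" "f \<in> lmod_hom R M N" "submodule H R M"
  shows "submodule (f ` H) R N"
proof -
  interpret M: left_module R M by fact
  interpret N: left_module R N by fact
  note D = submoduleD[OF assms(4)]
  show ?thesis
  proof (rule N.submoduleI)
    show "\<zero>\<^bsub>N\<^esub> \<in> f ` H"
      using D(2) hom_zero[OF assms(1-3)] by (metis imageI)
    show "x \<oplus>\<^bsub>N\<^esub> y \<in> f ` H" if xy: "x \<in> f ` H" "y \<in> f ` H" for x y
    proof -
      obtain a b where "a \<in> H" "b \<in> H" "x = f a" "y = f b" using xy by blast
      then show ?thesis
        using D(1,3) hom_add[OF assms(3), of a b] by (metis imageI subsetD)
    qed
    show "r \<odot>\<^bsub>N\<^esub> x \<in> f ` H" if rx: "r \<in> carrier R" "x \<in> f ` H" for r x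
    proof -
      obtain a where "a \<in> H" "x = f a" using rx by blast
      then show ?thesis
        using D(1,4) hom_smult[OF assms(3), of r a] rx by (metis imageI subsetD)
    qed
  qed (use D(1) hom_closed[OF assms(3)] in auto)
qed

lemma submodule_preimage:
  assumes "left_module R M" "left_module R N" "f \<in> lmod_hom R M N" "submodule H R N"
  shows "submodule {x \<in> carrier M. f x \<in> H} R M"
proof -
  interpret M: left_module R M by fact
  note D = submoduleD[OF assms(4)]
  show ?thesis
    by (rule M.submoduleI)
      (auto simp: D hom_zero[OF assms(1-3)] hom_add[OF assms(3)] hom_smult[OF assms(3)] M.smult_closed)
qed

lemma submodule_equalizer:
  assumes "left_module R M" "left_module R N" "f \<in> lmod_hom R M N" "g \<in> lmod_hom R M N"
  shows "submodule {x \<in> carrier M. f x = g x} R M"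
proof -
  interpret M: left_module R M by fact
  show ?thesis
    by (rule M.submoduleI)
      (auto simp: hom_zero[OF assms(1,2)] assms hom_add[OF assms(3)] hom_add[OF assms(4)]
        hom_smult[OF assms(3)] hom_smult[OF assms(4)] M.smult_closed)
qed

lemma hom_inj_onI:
  assumes "left_module R M" "left_module R N" "f \<in> lmod_hom R M N"
    and "\<And>x. \<lbrakk>x \<in> carrier M; f x = \<zero>\<^bsub>N\<^esub>\<rbrakk> \<Longrightarrow> x = \<zero>\<^bsub>M\<^esub>"
  shows "inj_on f (carrier M)"
proof (rule inj_onI)
  interpret M: left_module R M by fact
  interpret N: left_module R N by fact
  fix x y assume *: "x \<in> carrier M" "y \<in> carrier M" "f x = f y"
  then have "f (x \<ominus>\<^bsub>M\<^esub> y) = \<zero>\<^bsub>N\<^esub>"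
    using hom_minus[OF assms(1-3), of x y] hom_closed[OF assms(3)] N.minus_eq_zero_iff by simp
  then show "x = y"
    using assms(4) * M.minus_eq_zero_iff M.minus_closed by blast
qed

lemma hom_eq_zero_iff:
  assumes "left_module R M" "left_module R N" "f \<in> lmod_hom R M N" "inj_on f (carrier M)" "x \<in> carrier M"
  shows "f x = \<zero>\<^bsub>N\<^esub> \<longleftrightarrow> x = \<zero>\<^bsub>M\<^esub>"
proof -
  interpret M: left_module R M by fact
  show ?thesis
    using hom_zero[OF assms(1-3)] inj_onD[OF assms(4) _ assms(5) M.M.zero_closed] by auto
qed

lemma hom_inv_into:
  assumes "left_module R M" "left_module R N" "f \<in> lmod_hom R M N" "bij_betw f (carrier M) (carrier N)"
  shows "inv_into (carrier M) f \<in> lmod_hom R N M"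
proof -
  interpret M: left_module R M by fact
  interpret N: left_module R N by fact
  let ?g = "inv_into (carrier M) f"
  have g: "?g y \<in> carrier M" "f (?g y) = y" if "y \<in> carrier N" for y
    using assms(4) that by (auto simp: bij_betw_def inv_into_into f_inv_into_f)
  have inj: "a = b" if "a \<in> carrier M" "b \<in> carrier M" "f a = f b" for a b
    using that assms(4) by (auto simp: bij_betw_def inj_on_def)
  show ?thesis
  proof (rule lmod_homI)
    show "?g (x \<oplus>\<^bsub>N\<^esub> y) = ?g x \<oplus>\<^bsub>M\<^esub> ?g y" if "x \<in> carrier N" "y \<in> carrier N" for x y
      by (rule inj) (use that g in \<open>auto simp: hom_add[OF assms(3)]\<close>)
    show "?g (r \<odot>\<^bsub>N\<^esub> x) = r \<odot>\<^bsub>M\<^esub> ?g x" if "r \<in> carrier R" "x \<in> carrier N" for r x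
      by (rule inj) (use that g in \<open>auto simp: hom_smult[OF assms(3)] M.smult_closed N.smult_closed\<close>)
  qed (rule g)
qed

lemma lmod_iso_refl: "lmod_iso R M M"
  unfolding lmod_iso_def by (rule bexI[OF _ hom_id]) (simp add: bij_betw_def)

lemma lmod_iso_obtain:
  assumes "left_module R M" "left_module R N" "lmod_iso R M N"
  obtains f g where "f \<in> lmod_hom R M N" "g \<in> lmod_hom R N M"
    "\<forall>x\<in>carrier M. g (f x) = x" "\<forall>y\<in>carrier N. f (g y) = y"
proof -
  obtain f where f: "f \<in> lmod_hom R M N" "bij_betw f (carrier M) (carrier N)"
    using assms(3) by (auto simp: lmod_iso_def)
  show ?thesis
    using that[OF f(1) hom_inv_into[OF assms(1,2) f]] f(2)
    by (auto simp: bij_betw_def inv_into_f_f f_inv_into_f)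
qed

lemma lmod_isoI:
  assumes "f \<in> lmod_hom R M N" "g \<in> lmod_hom R N M"
    "\<And>x. x \<in> carrier M \<Longrightarrow> g (f x) = x" "\<And>y. y \<in> carrier N \<Longrightarrow> f (g y) = y"
  shows "lmod_iso R M N"
  unfolding lmod_iso_def
  using assms by (intro bexI[of _ f] bij_betw_byWitness[where f' = g]) (auto simp: hom_closed)

lemma lmod_iso_sym:
  assumes "left_module R M" "left_module R N" "lmod_iso R M N" shows "lmod_iso R N M"
  by (rule lmod_iso_obtain[OF assms]) (auto intro: lmod_isoI)

lemma lmod_iso_trans:
  assumes "lmod_iso R M N" "lmod_iso R N L" shows "lmod_iso R M L"
proof -
  obtain f where f: "f \<in> lmod_hom R M N" "bij_betw f (carrier M) (carrier N)"
    using assms(1) unfolding lmod_iso_def by blast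
  obtain g where g: "g \<in> lmod_hom R N L" "bij_betw g (carrier N) (carrier L)"
    using assms(2) unfolding lmod_iso_def by blast
  show ?thesis
    unfolding lmod_iso_def
    using hom_compose[OF g(1) f(1)] bij_betw_trans[OF f(2) g(2)] unfolding comp_def by blast
qed

lemma iso_epi:
  "\<lbrakk>f \<in> lmod_hom R M N; bij_betw f (carrier M) (carrier N)\<rbrakk> \<Longrightarrow> f \<in> lmod_epi R M N"
  by (simp add: lmod_epi_def bij_betw_def)

text \<open>Both inverse maps are kept as data, because transporting a sequence along isomorphisms
  composes with the map on one side and with its inverse on the other.\<close>

definition iso_pair ::
    "('r, 'z) ring_scheme \<Rightarrow> ('r, 'm) module \<Rightarrow> ('r, 'n) module \<Rightarrow> ('m \<Rightarrow> 'n) \<Rightarrow> ('n \<Rightarrow> 'm) \<Rightarrow> bool"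
  where "iso_pair R M N f g \<longleftrightarrow> f \<in> lmod_hom R M N \<and> g \<in> lmod_hom R N M \<and>
    (\<forall>x\<in>carrier M. g (f x) = x) \<and> (\<forall>y\<in>carrier N. f (g y) = y)"

lemma iso_pairD:
  assumes "iso_pair R M N f g"
  shows "f \<in> lmod_hom R M N" "g \<in> lmod_hom R N M" "\<forall>x\<in>carrier M. g (f x) = x" "\<forall>y\<in>carrier N. f (g y) = y"
  using assms by (simp_all add: iso_pair_def)

lemma iso_pair_bij: "iso_pair R M N f g \<Longrightarrow> bij_betw f (carrier M) (carrier N)"
  unfolding iso_pair_def by (rule bij_betw_byWitness[where f' = g]) (auto simp: hom_closed)

lemma iso_pair_sym: "iso_pair R M N f g \<Longrightarrow> iso_pair R N M g f"
  by (simp add: iso_pair_def)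

lemma iso_pair_lmod_iso: "iso_pair R M N f g \<Longrightarrow> lmod_iso R M N"
  unfolding lmod_iso_def using iso_pair_bij iso_pairD(1) by (rule bexI)

section \<open>Factorization through epimorphisms and quotient modules\<close>

text \<open>Two preimages of an element under \<open>p\<close> differ by an element of the kernel of
  \<open>p\<close>, which \<open>h\<close> kills; so \<open>h\<close> of an arbitrarily chosen
  preimage is well defined.\<close>

lemma factor_through_epi:
  assumes "left_module R A" "left_module R X" "left_module R Y"
    and p: "p \<in> lmod_epi R A X" and h: "h \<in> lmod_hom R A Y"
    and ker: "a_kernel A X p \<subseteq> a_kernel A Y h"
  shows "\<exists>g\<in>lmod_hom R X Y. \<forall>a\<in>carrier A. g (p a) = h a"
proof -
  interpret A: left_module R A by fact
  interpret X: left_module R X by fact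
  interpret Y: left_module R Y by fact
  have ph: "p \<in> lmod_hom R A X" using p by (rule epi_hom)
  define g where "g x = h (inv_into (carrier A) p x)" for x
  have key: "g (p a) = h a" if a: "a \<in> carrier A" for a
  proof -
    define b where "b = inv_into (carrier A) p (p a)"
    have b: "b \<in> carrier A" "p b = p a"
      using a by (auto simp: b_def inv_into_into f_inv_into_f)
    then have "b \<ominus>\<^bsub>A\<^esub> a \<in> a_kernel A X p"
      using a hom_minus[OF assms(1,2) ph] hom_closed[OF ph] X.minus_eq_zero_iff
      by (simp add: mem_a_kernel)
    then have "h (b \<ominus>\<^bsub>A\<^esub> a) = \<zero>\<^bsub>Y\<^esub>" using ker by (auto simp: mem_a_kernel)
    then have "h b = h a"
      using a b hom_minus[OF assms(1,3) h] hom_closed[OF h] Y.minus_eq_zero_iff by simp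
    then show ?thesis by (simp add: g_def b_def)
  qed
  have "g \<in> lmod_hom R X Y"
  proof (rule lmod_homI)
    fix x assume "x \<in> carrier X"
    then obtain a where "a \<in> carrier A" "p a = x" using epi_obtain[OF p] by blast
    then show "g x \<in> carrier Y" using key hom_closed[OF h] by auto
  next
    fix x y assume "x \<in> carrier X" "y \<in> carrier X"
    then obtain a b where "a \<in> carrier A" "p a = x" "b \<in> carrier A" "p b = y"
      using epi_obtain[OF p] by metis
    then show "g (x \<oplus>\<^bsub>X\<^esub> y) = g x \<oplus>\<^bsub>Y\<^esub> g y"
      using key hom_add[OF h] hom_add[OF ph] by (metis A.a_closed)
  next
    fix r x assume r: "r \<in> carrier R" "x \<in> carrier X"
    then obtain a where "a \<in> carrier A" "p a = x" using epi_obtain[OF p] by metis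
    then show "g (r \<odot>\<^bsub>X\<^esub> x) = r \<odot>\<^bsub>Y\<^esub> g x"
      using key hom_smult[OF h] hom_smult[OF ph] r by (metis A.smult_closed)
  qed
  then show ?thesis using key by blast
qed

text \<open>Each epimorphism factors through the other, and the two factors are mutually inverse.
  Isomorphisms with quotients, cokernels and cohomology are obtained in this way without computing
  with cosets.\<close>

lemma iso_of_epis:
  assumes "left_module R A" "left_module R X" "left_module R Y"
    and p: "p \<in> lmod_epi R A X" and q: "q \<in> lmod_epi R A Y"
    and ker: "a_kernel A X p = a_kernel A Y q"
  shows "lmod_iso R X Y"
proof -
  obtain g where g: "g \<in> lmod_hom R X Y" "\<forall>a\<in>carrier A. g (p a) = q a"
    using factor_through_epi[OF assms(1-3) p epi_hom[OF q]] ker by blast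
  obtain h where h: "h \<in> lmod_hom R Y X" "\<forall>a\<in>carrier A. h (q a) = p a"
    using factor_through_epi[OF assms(1,3,2) q epi_hom[OF p]] ker by blast
  show ?thesis
    using g h by (intro lmod_isoI[of g _ _ _ h]) (auto elim!: epi_obtain[OF p] epi_obtain[OF q])
qed

text \<open>The module axioms, being equational given negation as \<open>- 1\<close>, pass to surjective images.\<close>

lemma left_module_surj_image:
  assumes "left_module R M" and surj: "f ` carrier M = carrier N"
    and add: "\<And>x y. \<lbrakk>x \<in> carrier M; y \<in> carrier M\<rbrakk> \<Longrightarrow> f (x \<oplus>\<^bsub>M\<^esub> y) = f x \<oplus>\<^bsub>N\<^esub> f y"
    and smult: "\<And>r x. \<lbrakk>r \<in> carrier R; x \<in> carrier M\<rbrakk> \<Longrightarrow> f (r \<odot>\<^bsub>M\<^esub> x) = r \<odot>\<^bsub>N\<^esub> f x"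
    and zero: "f \<zero>\<^bsub>M\<^esub> = \<zero>\<^bsub>N\<^esub>"
  shows "left_module R N" "f \<in> lmod_epi R M N"
proof -
  interpret M: left_module R M by fact
  have surjE: "\<exists>x\<in>carrier M. y = f x" if "y \<in> carrier N" for y
    using that surj by blast
  have cl: "f x \<in> carrier N" if "x \<in> carrier M" for x
    using that surj by blast
  show "left_module R N"
  proof (rule left_moduleI)
    show "x \<oplus>\<^bsub>N\<^esub> y = y \<oplus>\<^bsub>N\<^esub> x" if "x \<in> carrier N" "y \<in> carrier N" for x y
      using surjE[OF that(1)] surjE[OF that(2)] M.M.a_comm by (auto simp: add[symmetric])
  qed (auto dest!: surjE simp: add[symmetric] smult[symmetric] zero[symmetric] cl
        M.M.a_assoc M.smult_closed M.smult_l_distr M.smult_r_distr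
        M.smult_assoc M.smult_one M.minus_one_smult M.M.l_neg M.R.ring_axioms)
  show "f \<in> lmod_epi R M N"
    using add smult surj cl by (auto simp: lmod_epi_def intro!: lmod_homI)
qed

text \<open>Once the union in the scalar action of \<open>quotient_module\<close> is seen to be a
  single coset, the coset map is a surjection compatible with all operations, and the axioms come
  from \<open>left_module_surj_image\<close>.\<close>

lemma quotient_module_props:
  assumes "left_module R M" "submodule N R M"
  shows left_module_quotient: "left_module R (quotient_module M N)"
    and quotient_map_epi: "(\<lambda>x. N +>\<^bsub>M\<^esub> x) \<in> lmod_epi R M (quotient_module M N)"
    and quotient_map_kernel: "a_kernel M (quotient_module M N) (\<lambda>x. N +>\<^bsub>M\<^esub> x) = N"
proof -
  interpret M: left_module R M by fact
  note D = submoduleD[OF assms(2)]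
  interpret abelian_subgroup N M
    by (intro abelian_subgroupI3 additive_subgroup.intro submodule.axioms(1)[OF assms(2)])
      (rule left_module.axioms(2)[OF assms(1)])
  have eq_iff: "N +>\<^bsub>M\<^esub> x = N +>\<^bsub>M\<^esub> y \<longleftrightarrow> x \<ominus>\<^bsub>M\<^esub> y \<in> N" if "x \<in> carrier M" "y \<in> carrier M" for x y
  proof -
    have "N +>\<^bsub>M\<^esub> x = N +>\<^bsub>M\<^esub> y \<longleftrightarrow> x \<in> N +>\<^bsub>M\<^esub> y"
      using that a_repr_independence'[of x y] a_repr_independenceD[of y x] a_rcos_self[of x] by metis
    also have "\<dots> \<longleftrightarrow> x \<ominus>\<^bsub>M\<^esub> y \<in> N"
      using a_rcos_module[OF that(2,1)] by (simp add: a_minus_def)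
    finally show ?thesis .
  qed
  have smult: "(\<Union>x'\<in>N +>\<^bsub>M\<^esub> x. N +>\<^bsub>M\<^esub> (r \<odot>\<^bsub>M\<^esub> x')) = N +>\<^bsub>M\<^esub> (r \<odot>\<^bsub>M\<^esub> x)"
    if rx: "r \<in> carrier R" "x \<in> carrier M" for r x
  proof -
    have "N +>\<^bsub>M\<^esub> (r \<odot>\<^bsub>M\<^esub> x') = N +>\<^bsub>M\<^esub> (r \<odot>\<^bsub>M\<^esub> x)" if x': "x' \<in> N +>\<^bsub>M\<^esub> x" for x'
    proof -
      obtain n where n: "n \<in> N" "x' = n \<oplus>\<^bsub>M\<^esub> x"
        using x' by (auto simp: a_r_coset_def')
      have nM: "n \<in> carrier M" using D(1) n by blast
      have "r \<odot>\<^bsub>M\<^esub> x' \<ominus>\<^bsub>M\<^esub> r \<odot>\<^bsub>M\<^esub> x = r \<odot>\<^bsub>M\<^esub> n"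
        using n nM rx M.smult_closed by (simp add: M.smult_r_distr M.add_minus_cancel)
      then show ?thesis
        using D(4)[OF rx(1) n(1)] n nM rx M.smult_closed by (subst eq_iff) auto
    qed
    moreover have "x \<in> N +>\<^bsub>M\<^esub> x" using rx a_rcos_self by blast
    ultimately show ?thesis by blast
  qed
  have "(\<lambda>x. N +>\<^bsub>M\<^esub> x) ` carrier M = carrier (quotient_module M N)"
    by (auto simp: quotient_module_def A_RCOSETS_def')
  moreover have "N +>\<^bsub>M\<^esub> \<zero>\<^bsub>M\<^esub> = N"
    using M.a_coset_add_zero D(1) by blast
  ultimately have *: "left_module R (quotient_module M N)"
    "(\<lambda>x. N +>\<^bsub>M\<^esub> x) \<in> lmod_epi R M (quotient_module M N)"
    by (intro left_module_surj_image[OF assms(1), where f = "\<lambda>x. N +>\<^bsub>M\<^esub> x"];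
        simp add: quotient_module_def a_rcos_sum smult)+
  then show "left_module R (quotient_module M N)"
    "(\<lambda>x. N +>\<^bsub>M\<^esub> x) \<in> lmod_epi R M (quotient_module M N)" by blast+
  have "N +>\<^bsub>M\<^esub> x = N \<longleftrightarrow> x \<in> N" if "x \<in> carrier M" for x
    using eq_iff[of x "\<zero>\<^bsub>M\<^esub>"] M.minus_add_cancel[of x "\<zero>\<^bsub>M\<^esub>"] that \<open>N +>\<^bsub>M\<^esub> \<zero>\<^bsub>M\<^esub> = N\<close>
    by simp
  then show "a_kernel M (quotient_module M N) (\<lambda>x. N +>\<^bsub>M\<^esub> x) = N"
    using D(1) by (auto simp: mem_a_kernel quotient_module_def)
qed

subsection \<open>Direct sums\<close>

lemma direct_sum_sel [simp]:
  "carrier (direct_sum M N) = carrier M \<times> carrier N"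
  "zero (direct_sum M N) = (\<zero>\<^bsub>M\<^esub>, \<zero>\<^bsub>N\<^esub>)"
  "(x, y) \<oplus>\<^bsub>direct_sum M N\<^esub> (x', y') = (x \<oplus>\<^bsub>M\<^esub> x', y \<oplus>\<^bsub>N\<^esub> y')"
  "r \<odot>\<^bsub>direct_sum M N\<^esub> (x, y) = (r \<odot>\<^bsub>M\<^esub> x, r \<odot>\<^bsub>N\<^esub> y)"
  by (simp_all add: direct_sum_def)

lemma left_module_direct_sum:
  assumes "left_module R M" "left_module R N" shows "left_module R (direct_sum M N)"
proof -
  interpret M: left_module R M by fact
  interpret N: left_module R N by fact
  show ?thesis
  proof (rule left_moduleI)
    show "x \<oplus>\<^bsub>direct_sum M N\<^esub> y = y \<oplus>\<^bsub>direct_sum M N\<^esub> x"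
      if "x \<in> carrier (direct_sum M N)" "y \<in> carrier (direct_sum M N)" for x y
      using that M.M.a_comm N.M.a_comm by (cases x; cases y) simp
  qed (auto simp: M.R.ring_axioms M.M.a_assoc N.M.a_assoc M.smult_closed N.smult_closed
        M.minus_one_smult N.minus_one_smult M.M.l_neg N.M.l_neg M.smult_l_distr N.smult_l_distr
        M.smult_r_distr N.smult_r_distr M.smult_assoc N.smult_assoc M.smult_one N.smult_one)
qed

lemma hom_fst: "fst \<in> lmod_hom R (direct_sum M N) M"
  by (rule lmod_homI) auto

lemma hom_snd: "snd \<in> lmod_hom R (direct_sum M N) N"
  by (rule lmod_homI) auto

lemma hom_pair:
  "\<lbrakk>f \<in> lmod_hom R X M; g \<in> lmod_hom R X N\<rbrakk> \<Longrightarrow> (\<lambda>x. (f x, g x)) \<in> lmod_hom R X (direct_sum M N)"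
  by (rule lmod_homI) (simp_all add: hom_closed hom_add hom_smult)

lemma hom_inl: "left_module R N \<Longrightarrow> (\<lambda>x. (x, \<zero>\<^bsub>N\<^esub>)) \<in> lmod_hom R M (direct_sum M N)"
  by (rule hom_pair[OF hom_id hom_zero_map])

lemma hom_inr: "left_module R M \<Longrightarrow> (\<lambda>x. (\<zero>\<^bsub>M\<^esub>, x)) \<in> lmod_hom R N (direct_sum M N)"
  by (rule hom_pair[OF hom_zero_map hom_id])

subsection \<open>Finitely generated and noetherian modules\<close>

text \<open>Phrased as "no proper submodule contains \<open>A\<close>", generation becomes an
  induction rule: take for \<open>L\<close> the set of elements with the desired property.\<close>

definition generates :: "('r, 'z) ring_scheme \<Rightarrow> ('r, 'm) module \<Rightarrow> 'm set \<Rightarrow> bool"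
  where "generates R M A \<longleftrightarrow> A \<subseteq> carrier M \<and>
    (\<forall>L. submodule L R M \<longrightarrow> A \<subseteq> L \<longrightarrow> L = carrier M)"

lemma generatesD: "\<lbrakk>generates R M A; submodule L R M; A \<subseteq> L\<rbrakk> \<Longrightarrow> L = carrier M"
  by (simp add: generates_def)

lemma fg_module_iff:
  "fg_module R M \<longleftrightarrow> left_module R M \<and> (\<exists>A. finite A \<and> generates R M A)"
proof -
  have "A \<subseteq> carrier M \<and> carrier M = module_span R M A \<longleftrightarrow> generates R M A" if "left_module R M" for A
    using submodule_carrier[OF that] submoduleD(1)[of _ R M]
    unfolding generates_def module_span_def by blast
  then show ?thesis unfolding fg_module_def by blast
qed

lemma fg_module_left_module: "fg_module R M \<Longrightarrow> left_module R M"
  by (simp add: fg_module_def)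

text \<open>The preimage of a submodule containing the images of the generators is a submodule
  containing \<open>A\<close>, hence everything.\<close>

lemma generates_image:
  assumes "left_module R M" "left_module R N" "f \<in> lmod_epi R M N" "generates R M A"
  shows "generates R N (f ` A)"
  unfolding generates_def
proof (intro conjI allI impI)
  show "f ` A \<subseteq> carrier N"
    using assms(3,4) by (auto simp: generates_def lmod_epi_def)
  fix L assume L: "submodule L R N" "f ` A \<subseteq> L"
  have "{x \<in> carrier M. f x \<in> L} = carrier M"
    using generatesD[OF assms(4) submodule_preimage[OF assms(1,2) epi_hom[OF assms(3)] L(1)]]
      assms(4) L(2) by (auto simp: generates_def)
  then show "L = carrier N"
    using submoduleD(1)[OF L(1)] by (auto elim: epi_obtain[OF assms(3)])
qed

lemma fg_module_image:
  "\<lbrakk>fg_module R M; left_module R N; f \<in> lmod_epi R M N\<rbrakk> \<Longrightarrow> fg_module R N"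
  unfolding fg_module_iff using generates_image by blast

lemma fg_module_iso: "\<lbrakk>fg_module R M; left_module R N; lmod_iso R M N\<rbrakk> \<Longrightarrow> fg_module R N"
  unfolding lmod_iso_def by (meson fg_module_image iso_epi)

text \<open>Generators of the kernel together with preimages of generators of \<open>N\<close>
  suffice: a submodule containing them contains the kernel and maps onto \<open>N\<close>, so every
  element differs from one of its members by an element of the kernel.\<close>

lemma fg_module_extension:
  assumes "left_module R M" "fg_module R N" "f \<in> lmod_epi R M N" "fg_module R (kernel_module M N f)"
  shows "fg_module R M"
proof -
  interpret M: left_module R M by fact
  have N: "left_module R N" using assms(2) by (rule fg_module_left_module)
  interpret N: left_module R N by fact
  have f: "f \<in> lmod_hom R M N" using assms(3) by (rule epi_hom)
  have K: "submodule (a_kernel M N f) R M" by (rule submodule_a_kernel[OF assms(1) N f])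
  obtain A where A: "finite A" "generates R (kernel_module M N f) A"
    using assms(4) by (auto simp: fg_module_iff)
  obtain C where C: "finite C" "generates R N C"
    using assms(2) by (auto simp: fg_module_iff)
  obtain C' where C': "C' \<subseteq> carrier M" "finite C'" "f ` C' = C"
    using C finite_subset_image[of C f "carrier M"] epi_image[OF assms(3)]
    by (auto simp: generates_def)
  have "generates R M (A \<union> C')"
    unfolding generates_def
  proof (intro conjI allI impI)
    show "A \<union> C' \<subseteq> carrier M"
      using A(2) C'(1) by (auto simp: generates_def mem_a_kernel)
    fix L assume L: "submodule L R M" "A \<union> C' \<subseteq> L"
    note D = submoduleD[OF L(1)]
    \<comment> \<open>The generators of the kernel only test submodules of the kernel, so
      \<open>L\<close> is cut down before they are applied.\<close>
    have "submodule (L \<inter> a_kernel M N f) R M"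
      by (rule M.submoduleI) (use D submoduleD[OF K] in auto)
    then have "submodule (L \<inter> a_kernel M N f) R (kernel_module M N f)"
      unfolding kernel_module_def submodule_submodule_iff[OF assms(1) K] by blast
    moreover have "A \<subseteq> L \<inter> a_kernel M N f"
      using L(2) A(2) by (auto simp: generates_def)
    ultimately have "L \<inter> a_kernel M N f = carrier (kernel_module M N f)"
      by (rule generatesD[OF A(2)])
    then have ker: "a_kernel M N f \<subseteq> L"
      by (simp add: inf.absorb_iff2)
    have "C \<subseteq> f ` L"
      unfolding C'(3)[symmetric] using L(2) by (simp add: image_mono)
    then have img: "f ` L = carrier N"
      by (rule generatesD[OF C(2) submodule_image[OF assms(1) N f L(1)]])
    have "x \<in> L" if x: "x \<in> carrier M" for x
    proof -
      obtain l where l: "l \<in> L" "f l = f x"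
        using img hom_closed[OF f x] by (metis imageE)
      then have lM: "l \<in> carrier M" using D(1) by blast
      have "x \<ominus>\<^bsub>M\<^esub> l \<in> a_kernel M N f"
        using x l lM hom_closed[OF f x] by (simp add: mem_a_kernel hom_minus[OF assms(1) N f] N.minus_eq_zero_iff)
      then have "(x \<ominus>\<^bsub>M\<^esub> l) \<oplus>\<^bsub>M\<^esub> l \<in> L" using ker l(1) D(3) by blast
      then show ?thesis using M.minus_add_cancel[OF x lM] by simp
    qed
    then show "L = carrier M" using D(1) by blast
  qed
  then show ?thesis
    using A(1) C'(2) assms(1) unfolding fg_module_iff by blast
qed

definition noetherian_module :: "('r, 'z) ring_scheme \<Rightarrow> ('r, 'm) module \<Rightarrow> bool"
  where "noetherian_module R M \<longleftrightarrow> left_module R M \<and>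
    (\<forall>H. submodule H R M \<longrightarrow> fg_module R (M\<lparr>carrier := H\<rparr>))"

lemma noetherian_moduleD:
  "noetherian_module R M \<Longrightarrow> submodule H R M \<Longrightarrow> fg_module R (M\<lparr>carrier := H\<rparr>)"
  by (simp add: noetherian_module_def)

text \<open>A submodule \<open>H\<close> is an extension of its image in \<open>N\<close> by its
  intersection with the kernel of \<open>f\<close>, and both of these are finitely generated by
  hypothesis.\<close>

lemma noetherian_module_extension:
  assumes "left_module R M" "noetherian_module R N" "f \<in> lmod_epi R M N"
    "noetherian_module R (kernel_module M N f)"
  shows "noetherian_module R M"
  unfolding noetherian_module_def
proof (intro conjI allI impI)
  fix H assume H: "submodule H R M"
  interpret M: left_module R M by fact
  have N: "left_module R N" using assms(2) by (simp add: noetherian_module_def)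
  have f: "f \<in> lmod_hom R M N" using assms(3) by (rule epi_hom)
  have K: "submodule (a_kernel M N f) R M" by (rule submodule_a_kernel[OF assms(1) N f])
  let ?H = "M\<lparr>carrier := H\<rparr>" and ?N = "N\<lparr>carrier := f ` H\<rparr>"
  have fH: "submodule (f ` H) R N" by (rule submodule_image[OF assms(1) N f H])
  have "f \<in> lmod_epi R ?H ?N"
    using hom_restrict_domain[OF f submoduleD(1)[OF H]]
    by (simp add: lmod_epi_def hom_restrict_codomain)
  moreover have "submodule (a_kernel ?H ?N f) R (kernel_module M N f)"
    unfolding kernel_module_def submodule_submodule_iff[OF assms(1) K]
    using submoduleD(1-4)[OF H] submoduleD(1-4)[OF K]
    by (intro conjI M.submoduleI) (simp_all add: mem_a_kernel subset_iff)
  then have "fg_module R ((kernel_module M N f)\<lparr>carrier := a_kernel ?H ?N f\<rparr>)"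
    by (rule noetherian_moduleD[OF assms(4)])
  then have "fg_module R (kernel_module ?H ?N f)"
    by (simp add: kernel_module_def)
  moreover have "fg_module R ?N"
    using assms(2) fH by (simp add: noetherian_module_def)
  ultimately show "fg_module R ?H"
    using fg_module_extension[OF left_module_submodule[OF assms(1) H]] by blast
qed (rule assms(1))

text \<open>A submodule of \<open>N\<close> is the image of its own preimage, and the preimage is
  finitely generated.\<close>

lemma noetherian_module_image:
  assumes "noetherian_module R M" "left_module R N" "f \<in> lmod_epi R M N"
  shows "noetherian_module R N"
  unfolding noetherian_module_def
proof (intro conjI allI impI)
  fix H assume H: "submodule H R N"
  have M: "left_module R M" using assms(1) by (simp add: noetherian_module_def)
  have f: "f \<in> lmod_hom R M N" using assms(3) by (rule epi_hom)
  let ?L = "{x \<in> carrier M. f x \<in> H}"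
  have L: "submodule ?L R M" by (rule submodule_preimage[OF M assms(2) f H])
  have "f ` ?L = H"
    using submoduleD(1)[OF H] by (fastforce elim: epi_obtain[OF assms(3)])
  then have "f \<in> lmod_epi R (M\<lparr>carrier := ?L\<rparr>) (N\<lparr>carrier := H\<rparr>)"
    using hom_restrict_codomain[OF hom_restrict_domain[OF f submoduleD(1)[OF L]], of H]
    by (simp add: lmod_epi_def)
  then show "fg_module R (N\<lparr>carrier := H\<rparr>)"
    by (rule fg_module_image[OF noetherian_moduleD[OF assms(1) L] left_module_submodule[OF assms(2) H]])
qed (rule assms(2))

subsection \<open>Free modules\<close>

text \<open>Vectors are functions supported on \<open>{..<n}\<close>, so that \<open>R\<^sup>n\<close> is a submodule of \<open>R\<^sup>n\<^sup>+\<^sup>1\<close>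
  with literally the same operations.\<close>

definition free_module :: "('r, 'z) ring_scheme \<Rightarrow> nat \<Rightarrow> ('r, nat \<Rightarrow> 'r) module"
  where "free_module R n =
    \<lparr>carrier = {v. (\<forall>i<n. v i \<in> carrier R) \<and> (\<forall>i\<ge>n. v i = \<zero>\<^bsub>R\<^esub>)},
     mult = undefined, one = undefined, zero = (\<lambda>i. \<zero>\<^bsub>R\<^esub>),
     add = (\<lambda>u v i. u i \<oplus>\<^bsub>R\<^esub> v i), smult = (\<lambda>r v i. r \<otimes>\<^bsub>R\<^esub> v i)\<rparr>"

definition unit_vector :: "('r, 'z) ring_scheme \<Rightarrow> nat \<Rightarrow> nat \<Rightarrow> 'r"
  where "unit_vector R i = (\<lambda>j. if j = i then \<one>\<^bsub>R\<^esub> else \<zero>\<^bsub>R\<^esub>)"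

lemma free_module_sel [simp]:
  "zero (free_module R n) = (\<lambda>i. \<zero>\<^bsub>R\<^esub>)"
  "u \<oplus>\<^bsub>free_module R n\<^esub> v = (\<lambda>i. u i \<oplus>\<^bsub>R\<^esub> v i)"
  "r \<odot>\<^bsub>free_module R n\<^esub> v = (\<lambda>i. r \<otimes>\<^bsub>R\<^esub> v i)"
  by (simp_all add: free_module_def)

lemma free_module_carrier:
  "v \<in> carrier (free_module R n) \<longleftrightarrow> (\<forall>i<n. v i \<in> carrier R) \<and> (\<forall>i\<ge>n. v i = \<zero>\<^bsub>R\<^esub>)"
  by (simp add: free_module_def)

lemma regular_module_sel [simp]:
  "carrier (regular_module R) = carrier R" "zero (regular_module R) = zero R"
  "add (regular_module R) = add R" "smult (regular_module R) = mult R"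
  by (simp_all add: regular_module_def)

lemma left_module_regular: "ring R \<Longrightarrow> left_module R (regular_module R)"
proof -
  assume "ring R"
  then interpret ring R .
  show ?thesis
    by (rule left_moduleI) (auto simp: ring_axioms a_ac l_distr r_distr m_assoc l_minus r_neg)
qed

context ring
begin

lemma free_module_entry: "v \<in> carrier (free_module R n) \<Longrightarrow> v i \<in> carrier R"
  by (cases "i < n") (auto simp: free_module_carrier)

lemma left_module_free: "left_module R (free_module R n)"
proof (rule left_moduleI)
  note [simp] = free_module_entry
  show "x \<oplus>\<^bsub>free_module R n\<^esub> y = y \<oplus>\<^bsub>free_module R n\<^esub> x"
    if "x \<in> carrier (free_module R n)" "y \<in> carrier (free_module R n)" for x y
    using that a_comm by simp
qed (auto simp: ring_axioms free_module_carrier free_module_entry a_assoc l_distr r_distr m_assoc l_minus l_neg)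

lemma unit_vector_closed: "i < n \<Longrightarrow> unit_vector R i \<in> carrier (free_module R n)"
  by (simp add: unit_vector_def free_module_carrier)

lemma hom_entry: "(\<lambda>v. v i) \<in> lmod_hom R (free_module R n) (regular_module R)"
  by (rule lmod_homI) (auto simp: free_module_entry)

lemma free_module_truncate:
  "(\<lambda>v. v(n := \<zero>)) \<in> lmod_hom R (free_module R (Suc n)) (free_module R n)"
  by (rule lmod_homI) (auto simp: free_module_carrier fun_eq_iff)

lemma free_module_decompose:
  assumes "v \<in> carrier (free_module R (Suc n))"
  shows "v = v(n := \<zero>) \<oplus>\<^bsub>free_module R m\<^esub> v n \<odot>\<^bsub>free_module R m\<^esub> unit_vector R n"
  using free_module_entry[OF assms] by (auto simp: fun_eq_iff unit_vector_def)

lemma free_module_generates: "generates R (free_module R n) (unit_vector R ` {..<n})"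
  unfolding generates_def
proof (intro conjI allI impI)
  show "unit_vector R ` {..<n} \<subseteq> carrier (free_module R n)"
    by (auto intro: unit_vector_closed)
  fix L assume L: "submodule L R (free_module R n)" "unit_vector R ` {..<n} \<subseteq> L"
  note D = submoduleD[OF L(1)]
  \<comment> \<open>As R^m lies inside R^n with the same operations, \<open>L\<close> can be filled
    coordinate by coordinate.\<close>
  have "carrier (free_module R m) \<subseteq> L" if "m \<le> n" for m
    using that
  proof (induction m)
    case 0
    have "v = (\<lambda>i. \<zero>)" if "v \<in> carrier (free_module R 0)" for v
      using that by (auto simp: free_module_carrier fun_eq_iff)
    then show ?case using D(2) by auto
  next
    case (Suc m)
    show ?case
    proof
      fix v assume v: "v \<in> carrier (free_module R (Suc m))"
      have "v(m := \<zero>) \<in> L"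
        using Suc hom_closed[OF free_module_truncate v] by auto
      moreover have "unit_vector R m \<in> L" using L(2) Suc.prems by auto
      ultimately show "v \<in> L"
        using free_module_decompose[OF v, of n] D(3) D(4)[OF free_module_entry[OF v]] by metis
    qed
  qed
  then show "L = carrier (free_module R n)" using D(1) by blast
qed

lemma fg_module_free: "fg_module R (free_module R n)"
  unfolding fg_module_iff using left_module_free free_module_generates by blast

text \<open>The vectors on which \<open>f\<close> and \<open>g\<close> agree form a submodule, and
  it contains the generating unit vectors.\<close>

lemma free_module_hom_ext:
  assumes "left_module R M" "f \<in> lmod_hom R (free_module R n) M" "g \<in> lmod_hom R (free_module R n) M"
    and "\<And>i. i < n \<Longrightarrow> f (unit_vector R i) = g (unit_vector R i)" and "v \<in> carrier (free_module R n)"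
  shows "f v = g v"
  using generatesD[OF free_module_generates submodule_equalizer[OF left_module_free assms(1-3)]]
    assms(4,5) unit_vector_closed by blast

lemma free_module_hom_exists:
  assumes "left_module R M" "\<And>i. i < n \<Longrightarrow> a i \<in> carrier M"
  shows "\<exists>h\<in>lmod_hom R (free_module R n) M. \<forall>i<n. h (unit_vector R i) = a i"
  using assms(2)
proof (induction n)
  case 0
  show ?case using hom_zero_map[OF assms(1)] by blast
next
  case (Suc n)
  interpret M: left_module R M by fact
  obtain h where h: "h \<in> lmod_hom R (free_module R n) M" "\<forall>i<n. h (unit_vector R i) = a i"
    using Suc by (metis less_Suc_eq)
  have an: "a n \<in> carrier M" using Suc.prems by simp
  \<comment> \<open>The last coordinate contributes \<open>v n\<close> times \<open>a n\<close>; the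
    map obtained for \<open>n\<close> is applied to the vector with that coordinate erased.\<close>
  have "(\<lambda>v. v n \<odot>\<^bsub>M\<^esub> a n) \<in> lmod_hom R (free_module R (Suc n)) M"
    by (rule lmod_homI)
      (use an in \<open>auto simp: free_module_entry M.smult_closed M.smult_l_distr M.smult_assoc\<close>)
  from hom_add_maps[OF assms(1) hom_compose[OF h(1) free_module_truncate] this]
  have hom: "(\<lambda>v. h (v(n := \<zero>)) \<oplus>\<^bsub>M\<^esub> v n \<odot>\<^bsub>M\<^esub> a n) \<in> lmod_hom R (free_module R (Suc n)) M" .
  have 1: "h ((unit_vector R i)(n := \<zero>)) \<oplus>\<^bsub>M\<^esub> unit_vector R i n \<odot>\<^bsub>M\<^esub> a n = a i" if "i < Suc n" for i
  proof (cases "i = n")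
    case True
    have "(unit_vector R i)(n := \<zero>) = zero (free_module R n)"
      using True by (simp add: unit_vector_def fun_eq_iff)
    then show ?thesis
      using True an hom_zero[OF left_module_free assms(1) h(1)] M.smult_one[OF an]
      by (simp add: unit_vector_def)
  next
    case False
    then have "(unit_vector R i)(n := \<zero>) = unit_vector R i"
      by (simp add: unit_vector_def fun_eq_iff)
    then show ?thesis
      using False that h(2) an Suc.prems[of i] by (simp add: unit_vector_def)
  qed
  show ?case
    by (rule bexI[OF _ hom]) (use 1 in blast)
qed

lemma free_module_epi:
  assumes "fg_module R M"
  obtains n p where "p \<in> lmod_epi R (free_module R n) M"
proof -
  have M: "left_module R M" using assms by (rule fg_module_left_module)
  obtain A where A: "finite A" "generates R M A" using assms by (auto simp: fg_module_iff)
  obtain a and n :: nat where a: "bij_betw a {0..<n} A" using ex_bij_betw_nat_finite[OF A(1)] by blast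
  have "a i \<in> carrier M" if "i < n" for i
    using that a A(2) by (auto simp: bij_betw_def generates_def)
  then obtain p where p: "p \<in> lmod_hom R (free_module R n) M" "\<forall>i<n. p (unit_vector R i) = a i"
    using free_module_hom_exists[OF M, of n a] by blast
  have "A \<subseteq> p ` carrier (free_module R n)"
  proof
    fix x assume "x \<in> A"
    then obtain i where "i < n" "x = a i" using a by (auto simp: bij_betw_def)
    then show "x \<in> p ` carrier (free_module R n)" using p(2) unit_vector_closed by (metis imageI)
  qed
  then have "p ` carrier (free_module R n) = carrier M"
    using generatesD[OF A(2) submodule_image[OF left_module_free M p(1) submodule_carrier[OF left_module_free]]]
    by blast
  then show ?thesis using p(1) that by (simp add: lmod_epi_def)
qed

text \<open>Preimages have to be chosen for the unit vectors only. The hypothesis compares images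
  instead of asking \<open>f\<close> to be onto, because lifts are later taken against
  differentials, whose images are kernels.\<close>

lemma free_module_lift:
  assumes "left_module R A" "left_module R B" "f \<in> lmod_hom R A B" "g \<in> lmod_hom R (free_module R n) B"
    and "g ` carrier (free_module R n) \<subseteq> f ` carrier A"
  shows "\<exists>h\<in>lmod_hom R (free_module R n) A. \<forall>x\<in>carrier (free_module R n). f (h x) = g x"
proof -
  have "\<exists>y. y \<in> carrier A \<and> f y = g (unit_vector R i)" if "i < n" for i
    using assms(5) unit_vector_closed[OF that] by (metis imageE image_subset_iff)
  then obtain a where a: "\<And>i. i < n \<Longrightarrow> a i \<in> carrier A \<and> f (a i) = g (unit_vector R i)"
    by metis
  then obtain h where h: "h \<in> lmod_hom R (free_module R n) A" "\<forall>i<n. h (unit_vector R i) = a i"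
    using free_module_hom_exists[OF assms(1), of n a] by blast
  have "f (h x) = g x" if "x \<in> carrier (free_module R n)" for x
    by (rule free_module_hom_ext[OF assms(2) hom_compose[OF assms(3) h(1)] assms(4) _ that]) (simp add: h(2) a)
  then show ?thesis using h(1) by blast
qed

end

text \<open>A finitely generated module is R^n modulo a kernel, and cosets in R^n are sets of
  vectors, so the quotient has elements of type \<open>fg_elem\<close>. This brings modules of
  arbitrary carrier type back to the one over which chains and resolutions range.\<close>

lemma fg_module_copy:
  fixes M :: "('r, 'm) module"
  assumes "fg_module R M"
  obtains N :: "('r, 'r fg_elem) module" and f g where "fg_module R N"
    "f \<in> lmod_hom R M N" "g \<in> lmod_hom R N M"
    "\<forall>x\<in>carrier M. g (f x) = x" "\<forall>y\<in>carrier N. f (g y) = y"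
proof -
  have M: "left_module R M" using assms by (rule fg_module_left_module)
  interpret ring R using left_module_ring[OF M] .
  obtain n p where p: "p \<in> lmod_epi R (free_module R n) M" using free_module_epi[OF assms] by blast
  let ?K = "a_kernel (free_module R n) M p"
  let ?N = "quotient_module (free_module R n) ?K"
  have K: "submodule ?K R (free_module R n)"
    by (rule submodule_a_kernel[OF left_module_free M epi_hom[OF p]])
  note Q = quotient_module_props[OF left_module_free K]
  have iso: "lmod_iso R M ?N"
    by (rule iso_of_epis[OF left_module_free M Q(1) p Q(2)]) (simp add: Q(3))
  have "fg_module R ?N" by (rule fg_module_image[OF fg_module_free Q(1,2)])
  from that[OF this] show ?thesis
    by (rule lmod_iso_obtain[OF M Q(1) iso])
qed

lemma left_noetherian_ring: "left_noetherian R \<Longrightarrow> ring R"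
  by (simp add: left_noetherian_def)

lemma noetherian_regular:
  assumes "left_noetherian R" shows "noetherian_module R (regular_module R)"
  unfolding noetherian_module_def
proof (intro conjI allI impI)
  let ?M = "regular_module R"
  have M: "left_module R ?M" by (rule left_module_regular[OF left_noetherian_ring[OF assms]])
  then show "left_module R ?M" .
  fix I assume I: "submodule I R ?M"
  then obtain A where A: "finite A" "A \<subseteq> I" "I = module_span R ?M A"
    using assms unfolding left_noetherian_def by blast
  have "generates R (?M\<lparr>carrier := I\<rparr>) A"
    unfolding generates_def submodule_submodule_iff[OF M I]
    using A(2,3) unfolding module_span_def by auto
  then show "fg_module R (?M\<lparr>carrier := I\<rparr>)"
    using A(1) left_module_submodule[OF M I] unfolding fg_module_iff by blast
qed

text \<open>The last coordinate maps R^(n+1) onto R, and its kernel is literally the record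
  \<open>free_module R n\<close>, so the extension lemma applies without an isomorphism in
  between.\<close>

lemma noetherian_free:
  assumes "left_noetherian R" shows "noetherian_module R (free_module R n)"
proof (induction n)
  interpret ring R using left_noetherian_ring[OF assms] .
  case 0
  have *: "H = {\<lambda>i. \<zero>\<^bsub>R\<^esub>}" if "submodule H R (free_module R 0)" for H
    using submoduleD(1,2)[OF that] by (auto simp: free_module_carrier fun_eq_iff)
  have "free_module R 0\<lparr>carrier := H\<rparr> = free_module R 0" if "submodule H R (free_module R 0)" for H
    using *[OF that] by (simp add: free_module_def fun_eq_iff set_eq_iff)
  then show ?case
    unfolding noetherian_module_def using left_module_free fg_module_free by auto
next
  interpret ring R using left_noetherian_ring[OF assms] .
  case (Suc n)
  let ?F = "free_module R (Suc n)" and ?f = "\<lambda>v. v n"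
  have "?f \<in> lmod_epi R ?F (regular_module R)"
  proof -
    have "?f ` carrier ?F = carrier R"
    proof (intro equalityI subsetI)
      fix r assume "r \<in> carrier R"
      then show "r \<in> ?f ` carrier ?F"
        by (intro image_eqI[of _ _ "\<lambda>i. if i = n then r else \<zero>\<^bsub>R\<^esub>"]) (auto simp: free_module_carrier)
    qed (auto simp: free_module_entry)
    then show ?thesis by (simp add: lmod_epi_def hom_entry)
  qed
  moreover have "a_kernel ?F (regular_module R) ?f = carrier (free_module R n)"
    by (auto simp: mem_a_kernel free_module_carrier less_Suc_eq) (metis le_antisym not_less_eq_eq)
  then have "kernel_module ?F (regular_module R) ?f = free_module R n"
    by (simp add: kernel_module_def free_module_def)
  ultimately show ?case
    using noetherian_module_extension[OF left_module_free noetherian_regular[OF assms]] Suc by simp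
qed

lemma fg_module_noetherian:
  assumes "left_noetherian R" "fg_module R M" shows "noetherian_module R M"
proof -
  interpret ring R using left_noetherian_ring[OF assms(1)] .
  obtain n p where p: "p \<in> lmod_epi R (free_module R n) M" using free_module_epi[OF assms(2)] by blast
  then show ?thesis
    using noetherian_module_image[OF noetherian_free[OF assms(1)] fg_module_left_module[OF assms(2)]] by blast
qed

lemma fg_module_submodule:
  "\<lbrakk>left_noetherian R; fg_module R M; submodule H R M\<rbrakk> \<Longrightarrow> fg_module R (M\<lparr>carrier := H\<rparr>)"
  by (rule noetherian_moduleD[OF fg_module_noetherian])

lemma fg_module_kernel:
  "\<lbrakk>left_noetherian R; fg_module R M; left_module R N; f \<in> lmod_hom R M N\<rbrakk> \<Longrightarrow>
    fg_module R (kernel_module M N f)"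
  unfolding kernel_module_def
  using fg_module_submodule submodule_a_kernel fg_module_left_module by blast

lemma fg_module_direct_sum:
  assumes "fg_module R M" "fg_module R N" shows "fg_module R (direct_sum M N)"
proof -
  have M: "left_module R M" and N: "left_module R N" using assms by (auto intro: fg_module_left_module)
  interpret M: left_module R M by fact
  interpret N: left_module R N by fact
  have "snd ` (carrier M \<times> carrier N) = carrier N" by force
  then have e: "snd \<in> lmod_epi R (direct_sum M N) N" by (simp add: lmod_epi_def hom_snd)
  let ?K = "kernel_module (direct_sum M N) N snd"
  have K: "left_module R ?K"
    by (rule left_module_kernel[OF left_module_direct_sum[OF M N] N hom_snd])
  have "(\<lambda>x. (x, \<zero>\<^bsub>N\<^esub>)) \<in> lmod_epi R M ?K"
    using hom_inl[OF N, of M] unfolding lmod_epi_def kernel_module_def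
    by (auto simp: mem_a_kernel intro!: hom_restrict_codomain)
  then have "fg_module R ?K" using fg_module_image[OF assms(1) K] by blast
  then show ?thesis using fg_module_extension[OF left_module_direct_sum[OF M N] assms(2) e] by blast
qed

subsection \<open>Projective modules\<close>

lemma fg_projective_fg: "fg_projective R P \<Longrightarrow> fg_module R P"
  by (simp add: fg_projective_def)

lemma fg_projective_left_module: "fg_projective R P \<Longrightarrow> left_module R P"
  by (simp add: fg_projective_def fg_module_def)

text \<open>\<open>fg_projective\<close> grants lifts only between modules of type
  \<open>fg_elem\<close>. So \<open>P\<close> and the free module covering it are both copied into
  that type, and the isomorphism from \<open>P\<close> to its copy is what gets lifted.\<close>

lemma fg_projective_retract_free:
  fixes P :: "('r, 'p) module"
  assumes "fg_projective R P"
  obtains n s p where "s \<in> lmod_hom R P (free_module R n)" "p \<in> lmod_hom R (free_module R n) P"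
    "\<forall>x\<in>carrier P. p (s x) = x"
proof -
  have P: "left_module R P" using assms by (rule fg_projective_left_module)
  interpret ring R using left_module_ring[OF P] .
  obtain n q where q: "q \<in> lmod_epi R (free_module R n) P"
    using free_module_epi[OF fg_projective_fg[OF assms]] by blast
  obtain P' :: "('r, 'r fg_elem) module" and f g where P': "fg_module R P'"
    "f \<in> lmod_hom R P P'" "g \<in> lmod_hom R P' P"
    "\<forall>x\<in>carrier P. g (f x) = x" "\<forall>y\<in>carrier P'. f (g y) = y"
    by (rule fg_module_copy[OF fg_projective_fg[OF assms]]) blast
  obtain L :: "('r, 'r fg_elem) module" and a b where L: "fg_module R L"
    "a \<in> lmod_hom R (free_module R n) L" "b \<in> lmod_hom R L (free_module R n)"
    "\<forall>x\<in>carrier (free_module R n). b (a x) = x" "\<forall>y\<in>carrier L. a (b y) = y"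
    by (rule fg_module_copy[OF fg_module_free]) blast
  let ?e = "\<lambda>l. f (q (b l))"
  have e: "?e \<in> lmod_hom R L P'"
    by (rule hom_compose[OF P'(2) hom_compose[OF epi_hom[OF q] L(3)]])
  moreover have "?e ` carrier L = carrier P'"
  proof (intro equalityI subsetI)
    fix y assume y: "y \<in> carrier P'"
    obtain v where v: "v \<in> carrier (free_module R n)" "q v = g y"
      using epi_obtain[OF q hom_closed[OF P'(3) y]] .
    then have "?e (a v) = y" using y P'(5) L(4) by simp
    then show "y \<in> ?e ` carrier L" using hom_closed[OF L(2) v(1)] by blast
  qed (use hom_closed[OF e] in blast)
  ultimately have "?e \<in> lmod_epi R L P'" by (simp add: lmod_epi_def)
  then obtain h where h: "h \<in> lmod_hom R P L" "\<forall>x\<in>carrier P. ?e (h x) = f x"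
    using assms P'(2) fg_module_left_module[OF P'(1)] fg_module_left_module[OF L(1)]
    unfolding fg_projective_def by blast
  have "q (b (h x)) = x" if x: "x \<in> carrier P" for x
  proof -
    have "q (b (h x)) \<in> carrier P"
      using x h(1) L(3) epi_hom[OF q] by (metis hom_closed)
    then show ?thesis using h(2) x P'(4) by metis
  qed
  then show ?thesis by (intro that[OF hom_compose[OF L(3) h(1)] epi_hom[OF q]] ballI)
qed

text \<open>A retract of a free module inherits its lifting property. In this form it covers modules
  of every carrier type, and any map \<open>f\<close> whose image contains that of
  \<open>g\<close>.\<close>

lemma fg_projective_lift:
  assumes "fg_projective R P" "left_module R A" "left_module R B" "f \<in> lmod_hom R A B"
    "g \<in> lmod_hom R P B" "g ` carrier P \<subseteq> f ` carrier A"
  obtains h where "h \<in> lmod_hom R P A" "\<forall>x\<in>carrier P. f (h x) = g x"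
proof -
  have P: "left_module R P" using assms(1) by (rule fg_projective_left_module)
  interpret ring R using left_module_ring[OF P] .
  obtain n s p where sp: "s \<in> lmod_hom R P (free_module R n)" "p \<in> lmod_hom R (free_module R n) P"
    "\<forall>x\<in>carrier P. p (s x) = x"
    by (rule fg_projective_retract_free[OF assms(1)])
  have "(\<lambda>v. g (p v)) ` carrier (free_module R n) \<subseteq> f ` carrier A"
    using assms(6) hom_closed[OF sp(2)] by blast
  then obtain h where h: "h \<in> lmod_hom R (free_module R n) A"
    "\<forall>v\<in>carrier (free_module R n). f (h v) = g (p v)"
    using free_module_lift[OF assms(2-4) hom_compose[OF assms(5) sp(2)]] by blast
  show ?thesis
    by (rule that[OF hom_compose[OF h(1) sp(1)]]) (simp add: h(2) hom_closed[OF sp(1)] sp(3))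
qed

lemma fg_projective_lift_epi:
  assumes "fg_projective R P" "left_module R A" "left_module R B" "f \<in> lmod_epi R A B"
    "g \<in> lmod_hom R P B"
  obtains h where "h \<in> lmod_hom R P A" "\<forall>x\<in>carrier P. f (h x) = g x"
proof -
  have "g ` carrier P \<subseteq> f ` carrier A"
    unfolding epi_image[OF assms(4)] using hom_closed[OF assms(5)] by auto
  with that show ?thesis
    by (rule fg_projective_lift[OF assms(1-3) epi_hom[OF assms(4)] assms(5), rotated])
qed

lemma fg_projectiveI:
  fixes P :: "('r, 'p) module"
  assumes "fg_module R P"
    and "\<And>(A :: ('r, 'r fg_elem) module) (B :: ('r, 'r fg_elem) module) f g.
      \<lbrakk>left_module R A; left_module R B; f \<in> lmod_epi R A B; g \<in> lmod_hom R P B\<rbrakk> \<Longrightarrow>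
      \<exists>h\<in>lmod_hom R P A. \<forall>x\<in>carrier P. f (h x) = g x"
  shows "fg_projective R P"
  using assms unfolding fg_projective_def by blast

lemma fg_projective_retract:
  assumes "fg_projective R Q" "left_module R P" "s \<in> lmod_hom R P Q" "p \<in> lmod_hom R Q P"
    and ps: "\<And>x. x \<in> carrier P \<Longrightarrow> p (s x) = x"
  shows "fg_projective R P"
proof (rule fg_projectiveI)
  have "p ` carrier Q = carrier P"
  proof (intro equalityI subsetI)
    fix x assume "x \<in> carrier P"
    then show "x \<in> p ` carrier Q" using ps hom_closed[OF assms(3)] by (metis imageI)
  qed (use hom_closed[OF assms(4)] in blast)
  then have "p \<in> lmod_epi R Q P" using assms(4) by (simp add: lmod_epi_def)
  then show "fg_module R P"
    by (rule fg_module_image[OF fg_projective_fg[OF assms(1)] assms(2)])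
next
  fix A B :: "('a, 'a fg_elem) module" and f g
  assume *: "left_module R A" "left_module R B" "f \<in> lmod_epi R A B" "g \<in> lmod_hom R P B"
  obtain h where h: "h \<in> lmod_hom R Q A" "\<forall>x\<in>carrier Q. f (h x) = g (p x)"
    by (rule fg_projective_lift_epi[OF assms(1) *(1-3) hom_compose[OF *(4) assms(4)]])
  show "\<exists>h\<in>lmod_hom R P A. \<forall>x\<in>carrier P. f (h x) = g x"
    by (rule bexI[OF _ hom_compose[OF h(1) assms(3)]]) (simp add: h(2) hom_closed[OF assms(3)] ps)
qed

lemma fg_projective_free: "ring R \<Longrightarrow> fg_projective R (free_module R n)"
proof -
  assume "ring R"
  then interpret ring R .
  show ?thesis
    by (rule fg_projectiveI[OF fg_module_free])
      (rule free_module_lift, auto simp: lmod_epi_def hom_closed)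
qed

lemma fg_projective_trivial:
  assumes "left_module R P" "carrier P = {\<zero>\<^bsub>P\<^esub>}"
  shows "fg_projective R P"
proof -
  interpret ring R using left_module_ring[OF assms(1)] .
  show ?thesis
    by (rule fg_projective_retract[OF fg_projective_free[OF ring_axioms, of 0] assms(1)
          hom_zero_map[OF left_module_free] hom_zero_map[OF assms(1)]])
      (simp add: assms(2))
qed

lemma fg_projective_direct_sum:
  assumes "fg_projective R P" "fg_projective R Q" shows "fg_projective R (direct_sum P Q)"
proof (rule fg_projectiveI)
  show "fg_module R (direct_sum P Q)"
    using assms by (intro fg_module_direct_sum fg_projective_fg)
next
  fix A B :: "('a, 'a fg_elem) module" and f g
  assume *: "left_module R A" "left_module R B" "f \<in> lmod_epi R A B" "g \<in> lmod_hom R (direct_sum P Q) B"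
  have P: "left_module R P" and Q: "left_module R Q" using assms by (auto intro: fg_projective_left_module)
  interpret P: left_module R P by fact
  interpret Q: left_module R Q by fact
  obtain h where h: "h \<in> lmod_hom R P A" "\<forall>x\<in>carrier P. f (h x) = g (x, \<zero>\<^bsub>Q\<^esub>)"
    by (rule fg_projective_lift_epi[OF assms(1) *(1-3) hom_compose[OF *(4) hom_inl[OF Q]]])
  obtain k where k: "k \<in> lmod_hom R Q A" "\<forall>x\<in>carrier Q. f (k x) = g (\<zero>\<^bsub>P\<^esub>, x)"
    by (rule fg_projective_lift_epi[OF assms(2) *(1-3) hom_compose[OF *(4) hom_inr[OF P]]])
  have "f (h x \<oplus>\<^bsub>A\<^esub> k y) = g (x, y)" if "x \<in> carrier P" "y \<in> carrier Q" for x y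
    using that hom_add[OF *(4), of "(x, \<zero>\<^bsub>Q\<^esub>)" "(\<zero>\<^bsub>P\<^esub>, y)"]
    by (simp add: hom_add[OF epi_hom[OF *(3)]] h k hom_closed[OF h(1)] hom_closed[OF k(1)])
  then show "\<exists>h\<in>lmod_hom R (direct_sum P Q) A. \<forall>x\<in>carrier (direct_sum P Q). f (h x) = g x"
    by (intro bexI[OF _ hom_add_maps[OF *(1) hom_compose[OF h(1) hom_fst] hom_compose[OF k(1) hom_snd]]]) auto
qed

lemma fg_projective_copy:
  fixes P :: "('r, 'p) module"
  assumes "fg_projective R P"
  obtains Q :: "('r, 'r fg_elem) module" and f g where "fg_projective R Q"
    "f \<in> lmod_hom R P Q" "g \<in> lmod_hom R Q P"
    "\<forall>x\<in>carrier P. g (f x) = x" "\<forall>y\<in>carrier Q. f (g y) = y"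
proof -
  obtain Q :: "('r, 'r fg_elem) module" and f g where Q: "fg_module R Q"
    "f \<in> lmod_hom R P Q" "g \<in> lmod_hom R Q P"
    "\<forall>x\<in>carrier P. g (f x) = x" "\<forall>y\<in>carrier Q. f (g y) = y"
    by (rule fg_module_copy[OF fg_projective_fg[OF assms]]) blast
  have "fg_projective R Q"
    by (rule fg_projective_retract[OF assms fg_module_left_module[OF Q(1)] Q(3,2)]) (simp add: Q(5))
  then show ?thesis using Q(2-5) by (rule that)
qed

lemma epiI:
  assumes "f \<in> lmod_hom R M N" "\<And>y. y \<in> carrier N \<Longrightarrow> \<exists>x\<in>carrier M. f x = y"
  shows "f \<in> lmod_epi R M N"
proof -
  have "f ` carrier M = carrier N"
    by (intro equalityI subsetI) (use assms(2) hom_closed[OF assms(1)] in \<open>auto simp: image_iff\<close>)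
  then show ?thesis using assms(1) by (simp add: lmod_epi_def)
qed

lemma fg_projective_epi:
  fixes M :: "('r, 'm) module"
  assumes "fg_module R M"
  obtains P :: "('r, 'r fg_elem) module" and p where "fg_projective R P" "p \<in> lmod_epi R P M"
proof -
  interpret ring R using left_module_ring[OF fg_module_left_module[OF assms]] .
  obtain n p where p: "p \<in> lmod_epi R (free_module R n) M" using free_module_epi[OF assms] by blast
  obtain Q :: "('r, 'r fg_elem) module" and f g where Q: "fg_projective R Q"
    "f \<in> lmod_hom R (free_module R n) Q" "g \<in> lmod_hom R Q (free_module R n)"
    "\<forall>x\<in>carrier (free_module R n). g (f x) = x"
    by (rule fg_projective_copy[OF fg_projective_free[OF ring_axioms, of n]]) blast
  have "g \<in> lmod_epi R Q (free_module R n)"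
    by (rule epiI[OF Q(3)]) (metis Q(2,4) hom_closed)
  then show ?thesis using that Q(1) epi_compose[OF p] by blast
qed

subsection \<open>Duals\<close>

lemma dual_sel [simp]:
  "carrier (dual R M) = lmod_hom R M (regular_module R) \<inter> extensional (carrier M)"
  "zero (dual R M) = (\<lambda>m\<in>carrier M. \<zero>\<^bsub>R\<^esub>)"
  "f \<oplus>\<^bsub>dual R M\<^esub> g = (\<lambda>m\<in>carrier M. f m \<oplus>\<^bsub>R\<^esub> g m)"
  "r \<odot>\<^bsub>dual R M\<^esub> f = (\<lambda>m\<in>carrier M. f m \<otimes>\<^bsub>R\<^esub> r)"
  by (simp_all add: dual_def)

lemma dual_memI:
  assumes "left_module R M" "f \<in> lmod_hom R M (regular_module R)"
  shows "(\<lambda>x\<in>carrier M. f x) \<in> carrier (dual R M)"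
  using hom_cong[OF assms(2,1), of "\<lambda>x\<in>carrier M. f x"] by simp

lemma dual_hom: "f \<in> carrier (dual R M) \<Longrightarrow> f \<in> lmod_hom R M (regular_module R)"
  by simp

lemma dual_ext:
  "\<lbrakk>f \<in> carrier (dual R M); g \<in> carrier (dual R M); \<And>x. x \<in> carrier M \<Longrightarrow> f x = g x\<rbrakk> \<Longrightarrow> f = g"
  by (auto intro: extensionalityI)

lemma dual_value_closed: "\<lbrakk>f \<in> carrier (dual R M); x \<in> carrier M\<rbrakk> \<Longrightarrow> f x \<in> carrier R"
  using hom_closed[OF dual_hom] by fastforce

lemma hom_right_smult:
  assumes "ring R" "f \<in> lmod_hom R M (regular_module R)" "r \<in> carrier R"
  shows "(\<lambda>x. f x \<otimes>\<^bsub>R\<^esub> r) \<in> lmod_hom R M (regular_module R)"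
proof -
  interpret ring R by fact
  show ?thesis
    using hom_closed[OF assms(2)] assms(3)
    by (intro lmod_homI) (simp_all add: hom_add[OF assms(2)] hom_smult[OF assms(2)] l_distr m_assoc)
qed

lemma left_module_dual:
  assumes "left_module R M" shows "left_module (opp R) (dual R M)"
proof -
  interpret M: left_module R M by fact
  note reg = left_module_regular[OF M.R.ring_axioms]
  have cl: "(\<lambda>m\<in>carrier M. f m \<oplus>\<^bsub>R\<^esub> g m) \<in> carrier (dual R M)"
    if "f \<in> carrier (dual R M)" "g \<in> carrier (dual R M)" for f g
    using dual_memI[OF assms hom_add_maps[OF reg]] that by fastforce
  have scl: "(\<lambda>m\<in>carrier M. f m \<otimes>\<^bsub>R\<^esub> r) \<in> carrier (dual R M)"
    if "f \<in> carrier (dual R M)" "r \<in> carrier R" for f r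
    using dual_memI[OF assms hom_right_smult[OF M.R.ring_axioms]] that by fastforce
  have zcl: "(\<lambda>m\<in>carrier M. \<zero>\<^bsub>R\<^esub>) \<in> carrier (dual R M)"
    using dual_memI[OF assms hom_zero_map[OF reg]] by simp
  note [simp del] = dual_sel(1)
  note [simp] = cl scl zcl dual_value_closed
  interpret oR: ring "opp R" by (rule ring_opp[OF M.R.ring_axioms])
  have neg: "\<ominus>\<^bsub>opp R\<^esub> \<one>\<^bsub>R\<^esub> = \<ominus>\<^bsub>R\<^esub> \<one>\<^bsub>R\<^esub>"
    by (simp add: a_inv_def opp_def)
  show ?thesis
  proof (rule left_moduleI)
    show "f \<oplus>\<^bsub>dual R M\<^esub> g = g \<oplus>\<^bsub>dual R M\<^esub> f" if "f \<in> carrier (dual R M)" "g \<in> carrier (dual R M)" for f g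
      using that by (intro dual_ext[of _ R M]) (simp_all add: M.R.a_comm)
    show "f \<oplus>\<^bsub>dual R M\<^esub> g \<oplus>\<^bsub>dual R M\<^esub> h = f \<oplus>\<^bsub>dual R M\<^esub> (g \<oplus>\<^bsub>dual R M\<^esub> h)"
      if "f \<in> carrier (dual R M)" "g \<in> carrier (dual R M)" "h \<in> carrier (dual R M)" for f g h
      using that by (intro restrict_ext[THEN trans[OF dual_sel(3)], THEN trans, OF _ dual_sel(3)[symmetric]])
        (simp add: M.R.a_assoc)
    show "\<zero>\<^bsub>dual R M\<^esub> \<oplus>\<^bsub>dual R M\<^esub> f = f" if f: "f \<in> carrier (dual R M)" for f
    proof (rule dual_ext[OF _ f])
      show "\<zero>\<^bsub>dual R M\<^esub> \<oplus>\<^bsub>dual R M\<^esub> f \<in> carrier (dual R M)"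
        unfolding dual_sel(2,3) by (rule cl[OF zcl f])
    qed (use f in simp)
    show "\<ominus>\<^bsub>opp R\<^esub> \<one>\<^bsub>opp R\<^esub> \<odot>\<^bsub>dual R M\<^esub> f \<oplus>\<^bsub>dual R M\<^esub> f = \<zero>\<^bsub>dual R M\<^esub>" if "f \<in> carrier (dual R M)" for f
      using that by (intro restrict_ext[THEN trans[OF dual_sel(3)], THEN trans, OF _ dual_sel(2)[symmetric]])
        (simp add: neg M.R.r_minus M.R.l_neg)
    show "\<one>\<^bsub>opp R\<^esub> \<odot>\<^bsub>dual R M\<^esub> f = f" if "f \<in> carrier (dual R M)" for f
      using that by (intro dual_ext[of _ R M]) simp_all
    show "(a \<oplus>\<^bsub>opp R\<^esub> b) \<odot>\<^bsub>dual R M\<^esub> f = a \<odot>\<^bsub>dual R M\<^esub> f \<oplus>\<^bsub>dual R M\<^esub> b \<odot>\<^bsub>dual R M\<^esub> f"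
      if "a \<in> carrier (opp R)" "b \<in> carrier (opp R)" "f \<in> carrier (dual R M)" for a b f
      using that by (simp add: M.R.r_distr cong: restrict_cong)
    show "a \<odot>\<^bsub>dual R M\<^esub> (f \<oplus>\<^bsub>dual R M\<^esub> g) = a \<odot>\<^bsub>dual R M\<^esub> f \<oplus>\<^bsub>dual R M\<^esub> a \<odot>\<^bsub>dual R M\<^esub> g"
      if "a \<in> carrier (opp R)" "f \<in> carrier (dual R M)" "g \<in> carrier (dual R M)" for a f g
      using that by (simp add: M.R.l_distr cong: restrict_cong)
    show "(a \<otimes>\<^bsub>opp R\<^esub> b) \<odot>\<^bsub>dual R M\<^esub> f = a \<odot>\<^bsub>dual R M\<^esub> (b \<odot>\<^bsub>dual R M\<^esub> f)"
      if "a \<in> carrier (opp R)" "b \<in> carrier (opp R)" "f \<in> carrier (dual R M)" for a b f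
      using that by (simp add: M.R.m_assoc cong: restrict_cong)
  qed (auto simp: ring_opp M.R.ring_axioms)
qed

lemma dual_eval_hom:
  "x \<in> carrier M \<Longrightarrow> (\<lambda>\<phi>. \<phi> x) \<in> lmod_hom (opp R) (dual R M) (regular_module (opp R))"
  by (rule lmod_homI) (auto intro: dual_value_closed simp del: dual_sel(1))

lemma dual_map_apply: "x \<in> carrier M \<Longrightarrow> dual_map M f \<phi> x = \<phi> (f x)"
  by (simp add: dual_map_def)

lemma dual_map_hom:
  assumes "left_module R M" "f \<in> lmod_hom R M N"
  shows "dual_map M f \<in> lmod_hom (opp R) (dual R N) (dual R M)"
proof (rule lmod_homI)
  fix \<phi> assume "\<phi> \<in> carrier (dual R N)"
  then show "dual_map M f \<phi> \<in> carrier (dual R M)"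
    unfolding dual_map_def using dual_memI[OF assms(1) hom_compose[OF dual_hom assms(2)]] by blast
next
  fix \<phi> \<psi> show "dual_map M f (\<phi> \<oplus>\<^bsub>dual R N\<^esub> \<psi>) = dual_map M f \<phi> \<oplus>\<^bsub>dual R M\<^esub> dual_map M f \<psi>"
    using hom_closed[OF assms(2)] by (auto simp: dual_map_def fun_eq_iff)
next
  fix r \<phi> show "dual_map M f (r \<odot>\<^bsub>dual R N\<^esub> \<phi>) = r \<odot>\<^bsub>dual R M\<^esub> dual_map M f \<phi>"
    using hom_closed[OF assms(2)] by (auto simp: dual_map_def fun_eq_iff)
qed

lemma dual_map_retract:
  assumes "f \<in> lmod_hom R M N" "\<forall>x\<in>carrier M. g (f x) = x" "\<phi> \<in> carrier (dual R M)"
  shows "dual_map M f (dual_map N g \<phi>) = \<phi>"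
proof -
  have "dual_map M f (dual_map N g \<phi>) \<in> extensional (carrier M)"
    by (simp add: dual_map_def)
  then show ?thesis
    using assms by (intro extensionalityI[of _ "carrier M"]) (auto simp: dual_map_apply hom_closed)
qed

text \<open>\<open>h\<close> sends the unit vectors to the coordinate functionals, the dual basis.
  Evaluating \<open>h v\<close> at the unit vectors of R^n recovers the entries of \<open>v\<close>,
  from which injectivity and surjectivity both follow.\<close>

lemma dual_free_iso:
  assumes "ring R"
  shows "\<exists>h. h \<in> lmod_hom (opp R) (free_module (opp R) n) (dual R (free_module R n)) \<and>
    bij_betw h (carrier (free_module (opp R) n)) (carrier (dual R (free_module R n))) \<and>
    (\<forall>i<n. h (unit_vector (opp R) i) = (\<lambda>v\<in>carrier (free_module R n). v i))"
proof -
  interpret ring R by fact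
  interpret S: ring "opp R" by (rule ring_opp[OF assms])
  let ?F = "free_module R n" and ?G = "free_module (opp R) n"
  have dF: "left_module (opp R) (dual R ?F)" by (rule left_module_dual[OF left_module_free])
  interpret dF: left_module "opp R" "dual R ?F" by (rule dF)
  have c: "(\<lambda>v\<in>carrier ?F. v i) \<in> carrier (dual R ?F)" for i
    by (rule dual_memI[OF left_module_free hom_entry])
  then obtain h where h: "h \<in> lmod_hom (opp R) ?G (dual R ?F)"
    "\<forall>i<n. h (unit_vector (opp R) i) = (\<lambda>v\<in>carrier ?F. v i)"
    using S.free_module_hom_exists[OF dF, of n "\<lambda>i. \<lambda>v\<in>carrier ?F. v i"] by blast
  have entry: "h v (unit_vector R j) = v j" if v: "v \<in> carrier ?G" and j: "j < n" for v j
  proof (rule S.free_module_hom_ext[OF left_module_regular[OF S.ring_axioms] _ S.hom_entry _ v])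
    show "(\<lambda>v. h v (unit_vector R j)) \<in> lmod_hom (opp R) ?G (regular_module (opp R))"
      by (rule hom_compose[OF dual_eval_hom[OF unit_vector_closed[OF j]] h(1)])
    show "h (unit_vector (opp R) i) (unit_vector R j) = unit_vector (opp R) i j" if "i < n" for i
      using h(2) that unit_vector_closed[OF j] by (simp add: unit_vector_def)
  qed
  have "inj_on h (carrier ?G)"
  proof (rule inj_onI)
    fix u v assume uv: "u \<in> carrier ?G" "v \<in> carrier ?G" "h u = h v"
    then have "u j = v j" for j
      using entry[of u j] entry[of v j] by (cases "j < n") (auto simp: free_module_carrier)
    then show "u = v" by blast
  qed
  moreover have "\<phi> \<in> h ` carrier ?G" if \<phi>: "\<phi> \<in> carrier (dual R ?F)" for \<phi>
  proof -
    define v where "v = (\<lambda>i. if i < n then \<phi> (unit_vector R i) else \<zero>\<^bsub>R\<^esub>)"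
    have v: "v \<in> carrier ?G"
      using dual_value_closed[OF \<phi> unit_vector_closed] by (simp add: v_def free_module_carrier)
    have hv: "h v \<in> carrier (dual R ?F)" by (rule hom_closed[OF h(1) v])
    have "h v = \<phi>"
      by (rule dual_ext[OF hv \<phi>], rule free_module_hom_ext[OF left_module_regular[OF assms] dual_hom[OF hv] dual_hom[OF \<phi>]])
        (simp_all add: entry[OF v], simp add: v_def)
    then show ?thesis using v by blast
  qed
  then have "h ` carrier ?G = carrier (dual R ?F)"
    using hom_closed[OF h(1)] by blast
  ultimately show ?thesis using h by (auto simp: bij_betw_def)
qed

lemma fg_projective_dual_free:
  assumes "ring R" shows "fg_projective (opp R) (dual R (free_module R n))"
proof -
  interpret ring R by fact
  obtain h where h: "h \<in> lmod_hom (opp R) (free_module (opp R) n) (dual R (free_module R n))"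
    "bij_betw h (carrier (free_module (opp R) n)) (carrier (dual R (free_module R n)))"
    using dual_free_iso[OF assms] by blast
  have l: "left_module (opp R) (free_module (opp R) n)"
    by (rule ring.left_module_free[OF ring_opp[OF assms]])
  have l': "left_module (opp R) (dual R (free_module R n))" by (rule left_module_dual[OF left_module_free])
  show ?thesis
    by (rule fg_projective_retract[OF fg_projective_free[OF ring_opp[OF assms]] l' hom_inv_into[OF l l' h] h(1)])
      (rule bij_betw_inv_into_right[OF h(2)])
qed

text \<open>Dualizing exchanges the two maps of a retraction, so the dual of \<open>P\<close> is a
  retract of the dual of a free module.\<close>

lemma fg_projective_dual:
  assumes "fg_projective R P" shows "fg_projective (opp R) (dual R P)"
proof -
  have P: "left_module R P" using assms by (rule fg_projective_left_module)
  interpret ring R using left_module_ring[OF P] .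
  obtain n s p where sp: "s \<in> lmod_hom R P (free_module R n)" "p \<in> lmod_hom R (free_module R n) P"
    "\<forall>x\<in>carrier P. p (s x) = x"
    by (rule fg_projective_retract_free[OF assms])
  show ?thesis
    by (rule fg_projective_retract[OF fg_projective_dual_free[OF ring_axioms] left_module_dual[OF P]
          dual_map_hom[OF left_module_free sp(2)] dual_map_hom[OF P sp(1)]])
      (rule dual_map_retract[where g = p, OF sp(1,3)])
qed

section \<open>Reflexivity of finitely generated projectives\<close>

definition evaluation :: "('r, 'z) ring_scheme \<Rightarrow> ('r, 'm) module \<Rightarrow> 'm \<Rightarrow> ('m \<Rightarrow> 'r) \<Rightarrow> 'r"
  where "evaluation R M x = (\<lambda>\<phi>\<in>carrier (dual R M). \<phi> x)"

lemma evaluation_hom: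
  assumes "left_module R M"
  shows "evaluation R M \<in> lmod_hom R M (dual (opp R) (dual R M))"
proof -
  interpret M: left_module R M by fact
  have cl: "evaluation R M x \<in> carrier (dual (opp R) (dual R M))" if "x \<in> carrier M" for x
    unfolding evaluation_def by (rule dual_memI[OF left_module_dual[OF assms] dual_eval_hom[OF that]])
  show ?thesis
  proof (rule lmod_homI[OF cl])
    show "evaluation R M (x \<oplus>\<^bsub>M\<^esub> y) = evaluation R M x \<oplus>\<^bsub>dual (opp R) (dual R M)\<^esub> evaluation R M y"
      if "x \<in> carrier M" "y \<in> carrier M" for x y
      using that by (auto simp: evaluation_def fun_eq_iff restrict_def hom_add[OF dual_hom] simp del: dual_sel(1))
    show "evaluation R M (r \<odot>\<^bsub>M\<^esub> x) = r \<odot>\<^bsub>dual (opp R) (dual R M)\<^esub> evaluation R M x"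
      if "r \<in> carrier R" "x \<in> carrier M" for r x
      using that by (auto simp: evaluation_def fun_eq_iff restrict_def hom_smult[OF dual_hom] simp del: dual_sel(1))
  qed
qed

text \<open>The values of \<Phi> on the coordinate functionals are taken as the entries of a vector
  \<open>y\<close>; since these functionals generate the dual, \<Phi> is evaluation at
  \<open>y\<close> everywhere.\<close>

lemma evaluation_free_surj:
  assumes "ring R" "\<Phi> \<in> carrier (dual (opp R) (dual R (free_module R n)))"
  shows "\<exists>y\<in>carrier (free_module R n). \<forall>\<phi>\<in>carrier (dual R (free_module R n)). \<Phi> \<phi> = \<phi> y"
proof -
  interpret ring R by fact
  interpret S: ring "opp R" by (rule ring_opp[OF assms(1)])
  let ?F = "free_module R n" and ?G = "free_module (opp R) n"
  obtain h where h: "h \<in> lmod_hom (opp R) ?G (dual R ?F)"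
    "bij_betw h (carrier ?G) (carrier (dual R ?F))"
    "\<forall>i<n. h (unit_vector (opp R) i) = (\<lambda>v\<in>carrier ?F. v i)"
    using dual_free_iso[OF assms(1)] by blast
  have c: "(\<lambda>v\<in>carrier ?F. v i) \<in> carrier (dual R ?F)" for i
    by (rule dual_memI[OF left_module_free hom_entry])
  define y where "y = (\<lambda>i. if i < n then \<Phi> (\<lambda>v\<in>carrier ?F. v i) else \<zero>\<^bsub>R\<^esub>)"
  have y: "y \<in> carrier ?F"
    using dual_value_closed[OF assms(2) c] by (simp add: y_def free_module_carrier)
  have ev: "(\<lambda>v. h v y) \<in> lmod_hom (opp R) ?G (regular_module (opp R))"
    by (rule hom_compose[OF dual_eval_hom[OF y] h(1)])
  have "\<Phi> (h v) = h v y" if "v \<in> carrier ?G" for v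
  proof (rule S.free_module_hom_ext[OF left_module_regular[OF S.ring_axioms]
        hom_compose[OF dual_hom[OF assms(2)] h(1)] ev _ that])
    show "\<Phi> (h (unit_vector (opp R) i)) = h (unit_vector (opp R) i) y" if "i < n" for i
      using h(3) that y by (simp add: y_def)
  qed
  then show ?thesis
    using y bij_betw_imp_surj_on[OF h(2), symmetric]
    by (intro bexI[of _ y]) (auto simp del: dual_sel(1))
qed

text \<open>The problem is moved to R^n by \<open>s\<close> and brought back by \<open>p\<close>.
  For injectivity, the coordinates of \<open>s x\<close> are functionals of \<open>x\<close>, so
  they vanish when evaluation at \<open>x\<close> does.\<close>

lemma evaluation_bij:
  assumes "fg_projective R P"
  shows "bij_betw (evaluation R P) (carrier P) (carrier (dual (opp R) (dual R P)))"
proof -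
  have P: "left_module R P" using assms by (rule fg_projective_left_module)
  interpret ring R using left_module_ring[OF P] .
  let ?D = "dual (opp R) (dual R P)"
  have D: "left_module R ?D" using left_module_dual[OF left_module_dual[OF P]] by simp
  obtain n s p where sp: "s \<in> lmod_hom R P (free_module R n)" "p \<in> lmod_hom R (free_module R n) P"
    "\<forall>x\<in>carrier P. p (s x) = x"
    by (rule fg_projective_retract_free[OF assms])
  let ?F = "free_module R n"
  have "inj_on (evaluation R P) (carrier P)"
  proof (rule hom_inj_onI[OF P D evaluation_hom[OF P]])
    fix x assume x: "x \<in> carrier P" "evaluation R P x = \<zero>\<^bsub>?D\<^esub>"
    have "s x i = \<zero>\<^bsub>R\<^esub>" for i
    proof -
      have "(\<lambda>y\<in>carrier P. s y i) \<in> carrier (dual R P)"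
        by (rule dual_memI[OF P hom_compose[OF hom_entry sp(1)]])
      moreover from this have "evaluation R P x (\<lambda>y\<in>carrier P. s y i) = s x i"
        using x(1) by (simp add: evaluation_def)
      ultimately show ?thesis using x(2) by (simp del: dual_sel(1))
    qed
    then have "s x = zero ?F" by auto
    then have "p (s x) = \<zero>\<^bsub>P\<^esub>" using hom_zero[OF left_module_free P sp(2)] by simp
    then show "x = \<zero>\<^bsub>P\<^esub>" using sp(3) x(1) by simp
  qed
  moreover have "\<Phi> \<in> evaluation R P ` carrier P" if \<Phi>: "\<Phi> \<in> carrier ?D" for \<Phi>
  proof -
    \<comment> \<open>\<Phi> becomes a functional on the dual of R^n by restricting along
      \<open>s\<close>. If the vector \<open>y\<close> represents it there, then \<open>p y\<close>
      represents \<Phi>.\<close>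
    let ?\<Phi> = "\<lambda>\<tau>\<in>carrier (dual R ?F). \<Phi> (dual_map P s \<tau>)"
    have "?\<Phi> \<in> carrier (dual (opp R) (dual R ?F))"
      by (rule dual_memI[OF left_module_dual[OF left_module_free]
            hom_compose[OF dual_hom[OF \<Phi>] dual_map_hom[OF P sp(1)]]])
    then obtain y where y: "y \<in> carrier ?F" "\<forall>\<tau>\<in>carrier (dual R ?F). ?\<Phi> \<tau> = \<tau> y"
      using evaluation_free_surj[OF ring_axioms] by blast
    have py: "p y \<in> carrier P" by (rule hom_closed[OF sp(2) y(1)])
    have "\<Phi> \<psi> = \<psi> (p y)" if \<psi>: "\<psi> \<in> carrier (dual R P)" for \<psi>
    proof -
      have "dual_map ?F p \<psi> \<in> carrier (dual R ?F)"
        by (rule hom_closed[OF dual_map_hom[OF left_module_free sp(2)] \<psi>])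
      then have "\<Phi> (dual_map P s (dual_map ?F p \<psi>)) = dual_map ?F p \<psi> y"
        using y(2) by simp
      then show ?thesis
        using dual_map_retract[where g = p, OF sp(1,3) \<psi>] y(1) by (simp add: dual_map_apply)
    qed
    then have "\<Phi> = evaluation R P (p y)"
      using \<Phi> py by (intro dual_ext[OF \<Phi> hom_closed[OF evaluation_hom[OF P] py]])
        (simp add: evaluation_def)
    then show ?thesis using py by blast
  qed
  then have "evaluation R P ` carrier P = carrier ?D"
    using hom_closed[OF evaluation_hom[OF P]] by blast
  ultimately show ?thesis by (simp add: bij_betw_def del: dual_sel(1))
qed

lemma dual_map_epi_inj:
  assumes fe: "f \<in> lmod_epi R X Y" shows "inj_on (dual_map X f) (carrier (dual R Y))"
proof (rule inj_onI)
  fix \<phi> \<psi> assume *: "\<phi> \<in> carrier (dual R Y)" "\<psi> \<in> carrier (dual R Y)" "dual_map X f \<phi> = dual_map X f \<psi>"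
  show "\<phi> = \<psi>"
  proof (rule dual_ext[OF *(1,2)])
    fix y assume "y \<in> carrier Y"
    then obtain x where "x \<in> carrier X" "f x = y" by (rule epi_obtain[OF fe])
    then show "\<phi> y = \<psi> y" using *(3) dual_map_apply[of x X f] by metis
  qed
qed

text \<open>A functional vanishing on the kernel descends along the epimorphism. Together with
  \<open>dual_map_epi_inj\<close> this is left exactness of the dual.\<close>

lemma dual_map_epi_image:
  assumes "left_module R X" "left_module R Y" and fe: "f \<in> lmod_epi R X Y"
    and \<phi>: "\<phi> \<in> carrier (dual R X)" "\<And>x. x \<in> a_kernel X Y f \<Longrightarrow> \<phi> x = \<zero>\<^bsub>R\<^esub>"
  shows "\<exists>\<psi>\<in>carrier (dual R Y). dual_map X f \<psi> = \<phi>"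
proof -
  have f: "f \<in> lmod_hom R X Y" using fe by (rule epi_hom)
  have "a_kernel X Y f \<subseteq> a_kernel X (regular_module R) \<phi>"
    using \<phi>(2) by (auto simp: mem_a_kernel)
  then obtain g where g: "g \<in> lmod_hom R Y (regular_module R)" "\<forall>x\<in>carrier X. g (f x) = \<phi> x"
    using factor_through_epi[OF assms(1,2) left_module_regular[OF left_module_ring[OF assms(1)]] fe dual_hom[OF \<phi>(1)]]
    by blast
  have g': "(\<lambda>y\<in>carrier Y. g y) \<in> carrier (dual R Y)" by (rule dual_memI[OF assms(2) g(1)])
  have "dual_map X f (\<lambda>y\<in>carrier Y. g y) = \<phi>"
    by (rule dual_ext[OF hom_closed[OF dual_map_hom[OF assms(1) f] g'] \<phi>(1)])
      (simp add: dual_map_apply g(2) hom_closed[OF f])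
  then show ?thesis using g' by blast
qed

text \<open>By left exactness only surjectivity onto the dual of \<open>B\<close> is at stake.
  \<open>ext\<close> expresses it as extension of functionals along \<open>j\<close>, the form in
  which the vanishing of Ext^1 will deliver it.\<close>

lemma short_exact_dual:
  assumes "left_module R B" "left_module R X" "left_module R Y" "short_exact R B j X f Y"
    and ext: "\<And>\<psi>. \<psi> \<in> lmod_hom R B (regular_module R) \<Longrightarrow>
      \<exists>\<chi>\<in>lmod_hom R X (regular_module R). \<forall>b\<in>carrier B. \<chi> (j b) = \<psi> b"
  shows "short_exact (opp R) (dual R Y) (dual_map X f) (dual R X) (dual_map B j) (dual R B)"
proof -
  interpret B: left_module R B by fact
  note reg = left_module_regular[OF B.R.ring_axioms]
  have j: "j \<in> lmod_hom R B X" and ker: "j ` carrier B = a_kernel X Y f" and fe: "f \<in> lmod_epi R X Y"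
    using assms(4) by (auto simp: short_exact_def)
  have f: "f \<in> lmod_hom R X Y" using fe by (rule epi_hom)
  have 1: "dual_map X f \<in> lmod_hom (opp R) (dual R Y) (dual R X)" by (rule dual_map_hom[OF assms(2) f])
  have 2: "dual_map B j \<in> lmod_hom (opp R) (dual R X) (dual R B)" by (rule dual_map_hom[OF assms(1) j])
  have "inj_on (dual_map X f) (carrier (dual R Y))" by (rule dual_map_epi_inj[OF fe])
  moreover have "dual_map X f ` carrier (dual R Y) = a_kernel (dual R X) (dual R B) (dual_map B j)"
  proof (intro equalityI subsetI)
    fix \<phi> assume "\<phi> \<in> dual_map X f ` carrier (dual R Y)"
    then obtain \<psi> where \<psi>: "\<psi> \<in> carrier (dual R Y)" "\<phi> = dual_map X f \<psi>" by blast
    have "f (j b) = \<zero>\<^bsub>Y\<^esub>" if "b \<in> carrier B" for b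
      using ker that by (metis imageI mem_a_kernel)
    then have "dual_map B j \<phi> = \<zero>\<^bsub>dual R B\<^esub>"
      using \<psi> hom_zero[OF assms(3) reg dual_hom[OF \<psi>(1)]] hom_closed[OF j]
      by (auto simp: dual_map_def fun_eq_iff)
    then show "\<phi> \<in> a_kernel (dual R X) (dual R B) (dual_map B j)"
      using \<psi> hom_closed[OF 1] by (simp add: mem_a_kernel del: dual_sel)
  next
    fix \<phi> assume "\<phi> \<in> a_kernel (dual R X) (dual R B) (dual_map B j)"
    then have \<phi>: "\<phi> \<in> carrier (dual R X)" "dual_map B j \<phi> = \<zero>\<^bsub>dual R B\<^esub>"
      by (simp_all add: mem_a_kernel del: dual_sel)
    have "\<phi> x = \<zero>\<^bsub>R\<^esub>" if x: "x \<in> a_kernel X Y f" for x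
    proof -
      obtain b where "b \<in> carrier B" "x = j b" using x unfolding ker[symmetric] by blast
      then show ?thesis using fun_cong[OF \<phi>(2), of b] by (simp add: dual_map_def)
    qed
    then obtain \<psi> where "\<psi> \<in> carrier (dual R Y)" "dual_map X f \<psi> = \<phi>"
      using dual_map_epi_image[OF assms(2,3) fe \<phi>(1)] by blast
    then show "\<phi> \<in> dual_map X f ` carrier (dual R Y)" by blast
  qed
  moreover have "dual_map B j \<in> lmod_epi (opp R) (dual R X) (dual R B)"
  proof (rule epiI[OF 2])
    fix \<psi> assume \<psi>: "\<psi> \<in> carrier (dual R B)"
    then obtain \<chi> where \<chi>: "\<chi> \<in> lmod_hom R X (regular_module R)" "\<forall>b\<in>carrier B. \<chi> (j b) = \<psi> b"
      using ext[OF dual_hom[OF \<psi>]] by blast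
    have \<chi>': "(\<lambda>x\<in>carrier X. \<chi> x) \<in> carrier (dual R X)" by (rule dual_memI[OF assms(2) \<chi>(1)])
    have "dual_map B j (\<lambda>x\<in>carrier X. \<chi> x) = \<psi>"
      by (rule dual_ext[OF hom_closed[OF 2 \<chi>'] \<psi>]) (simp add: dual_map_apply \<chi>(2) hom_closed[OF j])
    then show "\<exists>x\<in>carrier (dual R X). dual_map B j x = \<psi>" using \<chi>' by blast
  qed
  ultimately show ?thesis using 1 by (simp add: short_exact_def)
qed

subsection \<open>Projective resolutions\<close>

lemma out_kernel_0: "out_kernel X P \<delta> \<epsilon> 0 = a_kernel (P 0) X \<epsilon>"
  by (simp add: out_kernel_def)

lemma out_kernel_Suc: "out_kernel X P \<delta> \<epsilon> (Suc i) = a_kernel (P (Suc i)) (P i) (\<delta> i)"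
  by (simp add: out_kernel_def)

lemma projective_resolution_iff:
  "projective_resolution R X P \<delta> \<epsilon> \<longleftrightarrow> (\<forall>i. fg_projective R (P i)) \<and> \<epsilon> \<in> lmod_epi R (P 0) X \<and>
    (\<forall>i. \<delta> i \<in> lmod_hom R (P (Suc i)) (P i) \<and> \<delta> i ` carrier (P (Suc i)) = out_kernel X P \<delta> \<epsilon> i)"
  (is "?L \<longleftrightarrow> ?R")
proof
  assume L: ?L
  then have *: "partial_resolution R (Suc n) X P \<delta> \<epsilon>" for n
    by (simp add: projective_resolution_def)
  have "fg_projective R (P i)" for i using *[of i] by (simp add: partial_resolution_def)
  moreover have "\<epsilon> \<in> lmod_epi R (P 0) X" using *[of 0] by (simp add: partial_resolution_def)
  moreover have "\<delta> i \<in> lmod_hom R (P (Suc i)) (P i) \<and> \<delta> i ` carrier (P (Suc i)) = out_kernel X P \<delta> \<epsilon> i" for i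
    using *[of "Suc i"] by (simp add: partial_resolution_def)
  ultimately show ?R by blast
next
  assume ?R
  then show ?L by (simp add: projective_resolution_def partial_resolution_def)
qed

context
  fixes R :: "('r, 'z) ring_scheme" and X :: "('r, 'x) module" and P :: "nat \<Rightarrow> ('r, 'p) module"
    and \<delta> \<epsilon>
  assumes X: "left_module R X" and res: "projective_resolution R X P \<delta> \<epsilon>"
begin

lemma resolution_projective: "fg_projective R (P i)"
  and resolution_epi: "\<epsilon> \<in> lmod_epi R (P 0) X"
  and resolution_hom: "\<delta> i \<in> lmod_hom R (P (Suc i)) (P i)"
  and resolution_image: "\<delta> i ` carrier (P (Suc i)) = out_kernel X P \<delta> \<epsilon> i"
  using res by (auto simp: projective_resolution_iff)

lemma resolution_left_module: "left_module R (P i)"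
  by (rule fg_projective_left_module[OF resolution_projective])

lemma resolution_image_0: "\<delta> 0 ` carrier (P (Suc 0)) = a_kernel (P 0) X \<epsilon>"
  by (simp add: resolution_image out_kernel_0)

lemma resolution_image_Suc: "\<delta> (Suc i) ` carrier (P (Suc (Suc i))) = a_kernel (P (Suc i)) (P i) (\<delta> i)"
  by (simp add: resolution_image out_kernel_Suc)

lemma resolution_complex_0: "x \<in> carrier (P (Suc 0)) \<Longrightarrow> \<epsilon> (\<delta> 0 x) = \<zero>\<^bsub>X\<^esub>"
  using resolution_image_0 by (metis imageI mem_a_kernel)

lemma resolution_complex: "x \<in> carrier (P (Suc (Suc i))) \<Longrightarrow> \<delta> i (\<delta> (Suc i) x) = \<zero>\<^bsub>P i\<^esub>"
  using resolution_image_Suc by (metis imageI mem_a_kernel)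

end

lemma projective_resolution_exists:
  fixes X :: "('r, 'x) module"
  assumes "left_noetherian R" "fg_module R X"
  obtains P :: "nat \<Rightarrow> ('r, 'r fg_elem) module" and \<delta> \<epsilon> where "projective_resolution R X P \<delta> \<epsilon>"
proof -
  obtain P0 :: "('r, 'r fg_elem) module" and \<epsilon> where P0: "fg_projective R P0" "\<epsilon> \<in> lmod_epi R P0 X"
    using fg_projective_epi[OF assms(2)] by blast
  have X: "left_module R X" using assms(2) by (rule fg_module_left_module)
  define Z0 where "Z0 = a_kernel P0 X \<epsilon>"
  \<comment> \<open>A state is a projective together with the submodule that the next differential
    has to cover. The clause for \<open>n = 0\<close> pins the start, so that the sequence found by
    dependent choice fits the given augmentation.\<close>
  let ?ok = "\<lambda>n (s :: ('r, 'r fg_elem) module \<times> 'r fg_elem set).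
    fg_projective R (fst s) \<and> submodule (snd s) R (fst s) \<and> (n = 0 \<longrightarrow> s = (P0, Z0))"
  let ?next = "\<lambda>s t. \<exists>\<delta>. \<delta> \<in> lmod_hom R (fst t) (fst s) \<and> \<delta> ` carrier (fst t) = snd s \<and>
    snd t = a_kernel (fst t) (fst s) \<delta>"
  have "\<exists>s. \<forall>n :: nat. ?ok n (s n) \<and> ?next (s n) (s (Suc n))"
  proof (rule dependent_nat_choice[where P = ?ok and Q = "\<lambda>n. ?next"])
    have "submodule Z0 R P0"
      unfolding Z0_def
      by (rule submodule_a_kernel[OF fg_projective_left_module[OF P0(1)] X epi_hom[OF P0(2)]])
    then show "\<exists>s. ?ok 0 s" using P0(1) by (intro exI[of _ "(P0, Z0)"]) simp
  next
    fix s :: "('r, 'r fg_elem) module \<times> 'r fg_elem set" and n :: nat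
    assume s: "?ok n s"
    then have P: "left_module R (fst s)" by (intro fg_projective_left_module) blast
    obtain P' :: "('r, 'r fg_elem) module" and p where
      P': "fg_projective R P'" "p \<in> lmod_epi R P' ((fst s)\<lparr>carrier := snd s\<rparr>)"
      using fg_projective_epi[OF fg_module_submodule[OF assms(1) fg_projective_fg]] s by blast
    have p: "p \<in> lmod_hom R P' (fst s)"
      using hom_submodule_codomainD[OF epi_hom[OF P'(2)]] submoduleD(1) s by blast
    have "p ` carrier P' = snd s" using epi_image[OF P'(2)] by simp
    then show "\<exists>t. ?ok (Suc n) t \<and> ?next s t"
      using P'(1) p submodule_a_kernel[OF fg_projective_left_module[OF P'(1)] P p]
      by (intro exI[of _ "(P', a_kernel P' (fst s) p)"]) auto
  qed
  then obtain s where s: "\<forall>n. ?ok n (s n) \<and> ?next (s n) (s (Suc n))" by blast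
  define P where "P n = fst (s n)" for n
  define Z where "Z n = snd (s n)" for n
  have 1: "fg_projective R (P n)" "P 0 = P0" "Z 0 = Z0" for n
    using spec[OF s, of n] spec[OF s, of 0] by (simp_all add: P_def Z_def)
  have "\<forall>n. \<exists>\<delta>. \<delta> \<in> lmod_hom R (P (Suc n)) (P n) \<and> \<delta> ` carrier (P (Suc n)) = Z n \<and>
    Z (Suc n) = a_kernel (P (Suc n)) (P n) \<delta>"
    unfolding P_def Z_def using s by blast
  then obtain \<delta> where \<delta>: "\<forall>n. \<delta> n \<in> lmod_hom R (P (Suc n)) (P n) \<and>
      \<delta> n ` carrier (P (Suc n)) = Z n \<and> Z (Suc n) = a_kernel (P (Suc n)) (P n) (\<delta> n)"
    by (rule choice[THEN exE])
  have "Z n = out_kernel X P \<delta> \<epsilon> n" for n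
    by (cases n) (simp_all add: out_kernel_0 out_kernel_Suc 1 \<delta> Z0_def)
  then have "projective_resolution R X P \<delta> \<epsilon>"
    using 1 \<delta> P0(2) by (simp add: projective_resolution_iff)
  then show ?thesis by (rule that)
qed

section \<open>Chain maps and homotopies\<close>

lemma chain_map_exists:
  assumes X: "left_module R X" and res: "projective_resolution R X P \<delta> \<epsilon>"
    and X': "left_module R X'" and res': "projective_resolution R X' P' \<delta>' \<epsilon>'"
    and \<theta>: "\<theta> \<in> lmod_hom R X X'"
  obtains f where "\<forall>i. f i \<in> lmod_hom R (P i) (P' i)" "\<forall>x\<in>carrier (P 0). \<epsilon>' (f 0 x) = \<theta> (\<epsilon> x)"
    "\<forall>i. \<forall>x\<in>carrier (P (Suc i)). \<delta>' i (f (Suc i) x) = f i (\<delta> i x)"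
proof -
  note P = resolution_left_module[OF X res] and P' = resolution_left_module[OF X' res']
  note pr = resolution_projective[OF X res]
  note \<delta> = resolution_hom[OF X res] and \<delta>' = resolution_hom[OF X' res']
  note im = resolution_image[OF X res] and im' = resolution_image[OF X' res']
  let ?K = "out_kernel X P \<delta> \<epsilon>" and ?K' = "out_kernel X' P' \<delta>' \<epsilon>'"
  \<comment> \<open>The invariant that \<open>g\<close> maps kernel into kernel is what makes the
    next lift exist: by exactness the kernel on the other side is the image of the next
    differential.\<close>
  let ?ok = "\<lambda>n g. g \<in> lmod_hom R (P n) (P' n) \<and> g ` ?K n \<subseteq> ?K' n \<and>
    (n = 0 \<longrightarrow> (\<forall>x\<in>carrier (P 0). \<epsilon>' (g x) = \<theta> (\<epsilon> x)))"
  let ?next = "\<lambda>n g h. \<forall>x\<in>carrier (P (Suc n)). \<delta>' n (h x) = g (\<delta> n x)"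
  have "\<exists>f. \<forall>n. ?ok n (f n) \<and> ?next n (f n) (f (Suc n))"
  proof (rule dependent_nat_choice[where P = ?ok and Q = ?next])
    obtain g where g: "g \<in> lmod_hom R (P 0) (P' 0)" "\<forall>x\<in>carrier (P 0). \<epsilon>' (g x) = \<theta> (\<epsilon> x)"
      by (rule fg_projective_lift_epi[OF pr P' X' resolution_epi[OF X' res']
            hom_compose[OF \<theta> epi_hom[OF resolution_epi[OF X res]]]])
    have "g ` ?K 0 \<subseteq> ?K' 0"
      using g hom_closed[OF g(1)] hom_zero[OF X X' \<theta>] by (auto simp: out_kernel_0 mem_a_kernel)
    then show "\<exists>g. ?ok 0 g" using g by blast
  next
    fix g n assume g: "?ok n g"
    have "(\<lambda>x. g (\<delta> n x)) ` carrier (P (Suc n)) = g ` ?K n"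
      unfolding im[symmetric] by (simp add: image_image)
    then have "(\<lambda>x. g (\<delta> n x)) ` carrier (P (Suc n)) \<subseteq> \<delta>' n ` carrier (P' (Suc n))"
      using g by (simp add: im')
    then obtain h where h: "h \<in> lmod_hom R (P (Suc n)) (P' (Suc n))"
      "\<forall>x\<in>carrier (P (Suc n)). \<delta>' n (h x) = g (\<delta> n x)"
      by (rule fg_projective_lift[OF pr P' P' \<delta>' hom_compose[OF conjunct1[OF g] \<delta>]])
    moreover have "h ` ?K (Suc n) \<subseteq> ?K' (Suc n)"
      using h hom_closed[OF h(1)] hom_zero[OF P P' conjunct1[OF g]] by (auto simp: out_kernel_Suc mem_a_kernel)
    ultimately show "\<exists>h. ?ok (Suc n) h \<and> ?next n g h" by blast
  qed
  then show ?thesis using that by auto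
qed

text \<open>In the homotopy formula e - 1 = \<delta> s + s \<delta> the second summand vanishes on
  boundaries. Only this restricted identity is recorded: it is enough for comparing cocycles, and it
  has the same shape in degree 0, where the second summand is missing.\<close>

lemma chain_endomorphism_homotopy:
  assumes X: "left_module R X" and res: "projective_resolution R X P \<delta> \<epsilon>"
    and e: "\<And>i. e i \<in> lmod_hom R (P i) (P i)" "\<And>x. x \<in> carrier (P 0) \<Longrightarrow> \<epsilon> (e 0 x) = \<epsilon> x"
    "\<And>i x. x \<in> carrier (P (Suc i)) \<Longrightarrow> \<delta> i (e (Suc i) x) = e i (\<delta> i x)"
  shows "\<exists>s\<in>lmod_hom R (P i) (P (Suc i)). \<forall>x\<in>carrier (P (Suc i)).
    \<delta> i (s (\<delta> i x)) = e i (\<delta> i x) \<ominus>\<^bsub>P i\<^esub> \<delta> i x"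
proof (induction i)
  note P = resolution_left_module[OF X res] and pr = resolution_projective[OF X res]
  note \<delta> = resolution_hom[OF X res] and \<epsilon> = epi_hom[OF resolution_epi[OF X res]]
  case 0
  interpret P0: left_module R "P 0" by (rule P)
  interpret X: left_module R X by (rule X)
  have "(\<lambda>x. e 0 x \<ominus>\<^bsub>P 0\<^esub> x) ` carrier (P 0) \<subseteq> a_kernel (P 0) X \<epsilon>"
    using hom_closed[OF e(1)] hom_closed[OF \<epsilon>]
    by (auto simp: mem_a_kernel hom_minus[OF P X \<epsilon>] e(2) X.minus_eq_zero_iff)
  then obtain s where s: "s \<in> lmod_hom R (P 0) (P (Suc 0))" "\<forall>x\<in>carrier (P 0). \<delta> 0 (s x) = e 0 x \<ominus>\<^bsub>P 0\<^esub> x"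
    unfolding resolution_image_0[OF X res, symmetric]
    by (rule fg_projective_lift[OF pr P P \<delta> hom_minus_maps[OF P e(1) hom_id]])
  then show ?case using hom_closed[OF \<delta>] by blast
next
  note P = resolution_left_module[OF X res] and pr = resolution_projective[OF X res]
  note \<delta> = resolution_hom[OF X res]
  case (Suc i)
  then obtain s where s: "s \<in> lmod_hom R (P i) (P (Suc i))"
    "\<forall>x\<in>carrier (P (Suc i)). \<delta> i (s (\<delta> i x)) = e i (\<delta> i x) \<ominus>\<^bsub>P i\<^esub> \<delta> i x" by blast
  interpret Pi: left_module R "P i" by (rule P)
  interpret PS: left_module R "P (Suc i)" by (rule P)
  \<comment> \<open>This is the part of e - 1 that the previous \<open>s\<close> does not account
    for. By the induction hypothesis \<open>\<delta> i\<close> kills it, so it lifts through the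
    next differential.\<close>
  let ?g = "\<lambda>x. (e (Suc i) x \<ominus>\<^bsub>P (Suc i)\<^esub> x) \<ominus>\<^bsub>P (Suc i)\<^esub> s (\<delta> i x)"
  have g: "?g \<in> lmod_hom R (P (Suc i)) (P (Suc i))"
    by (rule hom_minus_maps[OF P hom_minus_maps[OF P e(1) hom_id] hom_compose[OF s(1) \<delta>]])
  have "\<delta> i (?g x) = \<zero>\<^bsub>P i\<^esub>" if x: "x \<in> carrier (P (Suc i))" for x
    using x s(2) hom_closed[OF e(1) x] hom_closed[OF \<delta> x] hom_closed[OF s(1) hom_closed[OF \<delta> x]]
      hom_closed[OF e(1) hom_closed[OF \<delta> x]]
    by (simp add: hom_minus[OF P P \<delta>] e(3) Pi.minus_eq_zero_iff)
  then have "?g ` carrier (P (Suc i)) \<subseteq> a_kernel (P (Suc i)) (P i) (\<delta> i)"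
    using hom_closed[OF g] by (auto simp: mem_a_kernel)
  then obtain s' where s': "s' \<in> lmod_hom R (P (Suc i)) (P (Suc (Suc i)))"
    "\<forall>x\<in>carrier (P (Suc i)). \<delta> (Suc i) (s' x) = ?g x"
    unfolding resolution_image_Suc[OF X res, symmetric]
    by (rule fg_projective_lift[OF pr P P \<delta> g])
  have "?g (\<delta> (Suc i) y) = e (Suc i) (\<delta> (Suc i) y) \<ominus>\<^bsub>P (Suc i)\<^esub> \<delta> (Suc i) y"
    if y: "y \<in> carrier (P (Suc (Suc i)))" for y
    using hom_closed[OF \<delta> y] hom_closed[OF e(1) hom_closed[OF \<delta> y]] PS.minus_add_cancel[of _ "\<zero>\<^bsub>P (Suc i)\<^esub>"]
    by (simp add: resolution_complex[OF X res y] hom_zero[OF P P s(1)])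
  then show ?case using s' hom_closed[OF \<delta>] by (intro bexI[OF _ s'(1)]) auto
qed

lemma cocycle_chain_endomorphism_0:
  assumes X: "left_module R X" and res: "projective_resolution R X P \<delta> \<epsilon>"
    and e: "e \<in> lmod_hom R (P 0) (P 0)" "\<And>x. x \<in> carrier (P 0) \<Longrightarrow> \<epsilon> (e x) = \<epsilon> x"
    and N: "left_module R N" and \<phi>: "\<phi> \<in> lmod_hom R (P 0) N" "\<And>x. x \<in> carrier (P (Suc 0)) \<Longrightarrow> \<phi> (\<delta> 0 x) = \<zero>\<^bsub>N\<^esub>"
    and x: "x \<in> carrier (P 0)"
  shows "\<phi> (e x) = \<phi> x"
proof -
  note P = resolution_left_module[OF X res] and \<epsilon> = epi_hom[OF resolution_epi[OF X res]]
  interpret P0: left_module R "P 0" by (rule P)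
  interpret X: left_module R X by (rule X)
  interpret N: left_module R N by (rule N)
  have ex: "e x \<in> carrier (P 0)" by (rule hom_closed[OF e(1) x])
  have "e x \<ominus>\<^bsub>P 0\<^esub> x \<in> a_kernel (P 0) X \<epsilon>"
    using x ex hom_closed[OF \<epsilon>] by (simp add: mem_a_kernel hom_minus[OF P X \<epsilon>] e(2) X.minus_eq_zero_iff)
  then obtain y where "y \<in> carrier (P (Suc 0))" "\<delta> 0 y = e x \<ominus>\<^bsub>P 0\<^esub> x"
    using resolution_image_0[OF X res] by (metis imageE)
  then have "\<phi> (e x \<ominus>\<^bsub>P 0\<^esub> x) = \<zero>\<^bsub>N\<^esub>" using \<phi>(2) by metis
  then show ?thesis
    using x ex hom_closed[OF \<phi>(1)] by (simp add: hom_minus[OF P N \<phi>(1)] N.minus_eq_zero_iff)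
qed

text \<open>The values of e - 1 - s \<delta> lie in the image of the next differential, where the
  cocycle \<phi> vanishes. Hence \<phi> changes only by the coboundary of \<chi>, which is \<phi>
  composed with \<open>s\<close>.\<close>

lemma cocycle_chain_endomorphism_Suc:
  assumes X: "left_module R X" and res: "projective_resolution R X P \<delta> \<epsilon>"
    and e: "\<And>i. e i \<in> lmod_hom R (P i) (P i)" "\<And>x. x \<in> carrier (P 0) \<Longrightarrow> \<epsilon> (e 0 x) = \<epsilon> x"
    "\<And>i x. x \<in> carrier (P (Suc i)) \<Longrightarrow> \<delta> i (e (Suc i) x) = e i (\<delta> i x)"
    and N: "left_module R N" and \<phi>: "\<phi> \<in> lmod_hom R (P (Suc i)) N"
      "\<And>x. x \<in> carrier (P (Suc (Suc i))) \<Longrightarrow> \<phi> (\<delta> (Suc i) x) = \<zero>\<^bsub>N\<^esub>"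
  shows "\<exists>\<chi>\<in>lmod_hom R (P i) N. \<forall>x\<in>carrier (P (Suc i)). \<phi> (e (Suc i) x) = \<phi> x \<oplus>\<^bsub>N\<^esub> \<chi> (\<delta> i x)"
proof -
  note P = resolution_left_module[OF X res] and \<delta> = resolution_hom[OF X res]
  interpret Pi: left_module R "P i" by (rule P)
  interpret PS: left_module R "P (Suc i)" by (rule P)
  interpret N: left_module R N by (rule N)
  obtain s where s: "s \<in> lmod_hom R (P i) (P (Suc i))"
    "\<forall>x\<in>carrier (P (Suc i)). \<delta> i (s (\<delta> i x)) = e i (\<delta> i x) \<ominus>\<^bsub>P i\<^esub> \<delta> i x"
    using chain_endomorphism_homotopy[OF X res e] by blast
  have "\<phi> (e (Suc i) x) = \<phi> x \<oplus>\<^bsub>N\<^esub> \<phi> (s (\<delta> i x))" if x: "x \<in> carrier (P (Suc i))" for x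
  proof -
    let ?y = "(e (Suc i) x \<ominus>\<^bsub>P (Suc i)\<^esub> x) \<ominus>\<^bsub>P (Suc i)\<^esub> s (\<delta> i x)"
    note [simp] = x hom_closed[OF e(1) x] hom_closed[OF \<delta> x] hom_closed[OF s(1) hom_closed[OF \<delta> x]]
      hom_closed[OF e(1) hom_closed[OF \<delta> x]]
    have "?y \<in> a_kernel (P (Suc i)) (P i) (\<delta> i)"
      using s(2) by (simp add: mem_a_kernel hom_minus[OF P P \<delta>] e(3) Pi.minus_eq_zero_iff)
    then obtain z where "z \<in> carrier (P (Suc (Suc i)))" "\<delta> (Suc i) z = ?y"
      using resolution_image_Suc[OF X res] by (metis imageE)
    then have "\<phi> ?y = \<zero>\<^bsub>N\<^esub>" using \<phi>(2) by metis
    then have "\<phi> (e (Suc i) x) \<ominus>\<^bsub>N\<^esub> \<phi> x = \<phi> (s (\<delta> i x))"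
      using hom_closed[OF \<phi>(1)] by (simp add: hom_minus[OF P N \<phi>(1)] N.minus_eq_zero_iff)
    then show ?thesis
      using hom_closed[OF \<phi>(1)] N.minus_add_cancel[of "\<phi> (e (Suc i) x)" "\<phi> x"]
        N.M.a_comm[of "\<phi> x" "\<phi> (s (\<delta> i x))"] by simp
  qed
  then show ?thesis by (intro bexI[OF _ hom_compose[OF \<phi>(1) s(1)]] ballI)
qed

subsection \<open>Independence of the resolution\<close>

definition cocycles ::
    "('r, 'z) ring_scheme \<Rightarrow> (nat \<Rightarrow> ('r, 'p) module) \<Rightarrow> (nat \<Rightarrow> 'p \<Rightarrow> 'p) \<Rightarrow> nat \<Rightarrow> ('r, 'p \<Rightarrow> 'r) module"
  where "cocycles R P \<delta> i =
    kernel_module (dual R (P i)) (dual R (P (Suc i))) (dual_map (P (Suc i)) (\<delta> i))"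

definition coboundaries ::
    "('r, 'z) ring_scheme \<Rightarrow> (nat \<Rightarrow> ('r, 'p) module) \<Rightarrow> (nat \<Rightarrow> 'p \<Rightarrow> 'p) \<Rightarrow> nat \<Rightarrow> ('p \<Rightarrow> 'r) set"
  where "coboundaries R P \<delta> i = (case i of 0 \<Rightarrow> {\<zero>\<^bsub>dual R (P 0)\<^esub>}
       | Suc j \<Rightarrow> dual_map (P (Suc j)) (\<delta> j) ` carrier (dual R (P j)))"

lemma dual_cohomology_eq:
  "dual_cohomology R P \<delta> i = quotient_module (cocycles R P \<delta> i) (coboundaries R P \<delta> i)"
  by (simp add: dual_cohomology_def cocycles_def coboundaries_def)

lemma mem_cocycles:
  "\<phi> \<in> carrier (cocycles R P \<delta> i) \<longleftrightarrow>
    \<phi> \<in> carrier (dual R (P i)) \<and> (\<forall>x\<in>carrier (P (Suc i)). \<phi> (\<delta> i x) = \<zero>\<^bsub>R\<^esub>)"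
  by (auto simp: cocycles_def mem_a_kernel dual_map_def fun_eq_iff restrict_def)

lemma cocycles_sel [simp]:
  "zero (cocycles R P \<delta> i) = zero (dual R (P i))" "add (cocycles R P \<delta> i) = add (dual R (P i))"
  "smult (cocycles R P \<delta> i) = smult (dual R (P i))"
  by (simp_all add: cocycles_def del: dual_sel)

context
  fixes R :: "('r, 'z) ring_scheme" and X :: "('r, 'x) module" and P :: "nat \<Rightarrow> ('r, 'p) module"
    and \<delta> \<epsilon>
  assumes X: "left_module R X" and res: "projective_resolution R X P \<delta> \<epsilon>"
begin

private lemmas P = resolution_left_module[OF X res]
private lemmas \<delta> = resolution_hom[OF X res]

lemma submodule_cocycles:
  "submodule (carrier (cocycles R P \<delta> i)) (opp R) (dual R (P i))"
  unfolding cocycles_def kernel_module_sel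
  by (rule submodule_a_kernel[OF left_module_dual[OF P] left_module_dual[OF P] dual_map_hom[OF P \<delta>]])

lemma left_module_cocycles: "left_module (opp R) (cocycles R P \<delta> i)"
  unfolding cocycles_def
  by (rule left_module_kernel[OF left_module_dual[OF P] left_module_dual[OF P] dual_map_hom[OF P \<delta>]])

lemma submodule_coboundaries_dual: "submodule (coboundaries R P \<delta> i) (opp R) (dual R (P i))"
proof (cases i)
  case 0
  then show ?thesis
    using submodule_zero[OF left_module_dual[OF P, of 0]] by (simp add: coboundaries_def del: dual_sel)
next
  case (Suc j)
  then show ?thesis
    using submodule_image[OF left_module_dual[OF P] left_module_dual[OF P] dual_map_hom[OF P \<delta>, of j]
        submodule_carrier[OF left_module_dual[OF P]]]
    by (simp add: coboundaries_def del: dual_sel)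
qed

lemma coboundaries_subset_cocycles: "coboundaries R P \<delta> i \<subseteq> carrier (cocycles R P \<delta> i)"
proof
  fix \<phi> assume \<phi>: "\<phi> \<in> coboundaries R P \<delta> i"
  have "\<phi> (\<delta> i x) = \<zero>\<^bsub>R\<^esub>" if x: "x \<in> carrier (P (Suc i))" for x
  proof (cases i)
    case 0
    then show ?thesis using \<phi> hom_closed[OF \<delta>] x by (simp add: coboundaries_def)
  next
    case (Suc j)
    then obtain \<psi> where "\<psi> \<in> carrier (dual R (P j))" "\<phi> = dual_map (P (Suc j)) (\<delta> j) \<psi>"
      using \<phi> by (auto simp: coboundaries_def simp del: dual_sel)
    then show ?thesis
      using Suc x hom_closed[OF \<delta>] resolution_complex[OF X res, of x j]
        hom_zero[OF P left_module_regular[OF left_module_ring[OF X]], of \<psi> j]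
      by (simp add: dual_map_apply)
  qed
  then show "\<phi> \<in> carrier (cocycles R P \<delta> i)"
    using \<phi> submoduleD(1)[OF submodule_coboundaries_dual] by (auto simp: mem_cocycles simp del: dual_sel)
qed

lemma submodule_coboundaries: "submodule (coboundaries R P \<delta> i) (opp R) (cocycles R P \<delta> i)"
  using submodule_submodule_iff[OF left_module_dual[OF P] submodule_cocycles, of "coboundaries R P \<delta> i" i]
    submodule_coboundaries_dual coboundaries_subset_cocycles
  by (simp add: cocycles_def kernel_module_def)

lemmas cohomology_quotient =
  quotient_module_props[OF left_module_cocycles submodule_coboundaries, folded dual_cohomology_eq]

lemma left_module_cohomology: "left_module (opp R) (dual_cohomology R P \<delta> i)"
  by (rule cohomology_quotient)

lemma cohomology_trivialD:
  assumes "carrier (dual_cohomology R P \<delta> i) = {\<zero>\<^bsub>dual_cohomology R P \<delta> i\<^esub>}"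
  shows "carrier (cocycles R P \<delta> i) = coboundaries R P \<delta> i"
proof
  show "carrier (cocycles R P \<delta> i) \<subseteq> coboundaries R P \<delta> i"
    using hom_closed[OF epi_hom[OF cohomology_quotient(2)]] assms
    by (subst cohomology_quotient(3)[symmetric]) (auto simp: mem_a_kernel)
qed (rule coboundaries_subset_cocycles)

lemma cocycle_chain_endomorphism:
  assumes e: "\<And>i. e i \<in> lmod_hom R (P i) (P i)" "\<And>x. x \<in> carrier (P 0) \<Longrightarrow> \<epsilon> (e 0 x) = \<epsilon> x"
    "\<And>i x. x \<in> carrier (P (Suc i)) \<Longrightarrow> \<delta> i (e (Suc i) x) = e i (\<delta> i x)"
    and \<phi>: "\<phi> \<in> carrier (cocycles R P \<delta> i)"
  shows "\<exists>b\<in>coboundaries R P \<delta> i. dual_map (P i) (e i) \<phi> = \<phi> \<oplus>\<^bsub>dual R (P i)\<^esub> b"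
proof -
  interpret ring R using left_module_ring[OF X] .
  note reg = left_module_regular[OF ring_axioms]
  have \<phi>D: "\<phi> \<in> carrier (dual R (P i))" "\<And>x. x \<in> carrier (P (Suc i)) \<Longrightarrow> \<phi> (\<delta> i x) = \<zero>\<^bsub>regular_module R\<^esub>"
    using \<phi> by (auto simp: mem_cocycles simp del: dual_sel)
  note \<phi>h = dual_hom[OF \<phi>D(1)]
  show ?thesis
  proof (cases i)
    case 0
    have *: "\<phi> (e 0 x) = \<phi> x" if "x \<in> carrier (P 0)" for x
      by (rule cocycle_chain_endomorphism_0[OF X res e(1,2) reg _ _ that])
        (use \<phi>h \<phi>D(2) 0 in auto)
    have "dual_map (P i) (e i) \<phi> = \<phi> \<oplus>\<^bsub>dual R (P i)\<^esub> \<zero>\<^bsub>dual R (P i)\<^esub>"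
      using dual_value_closed[OF \<phi>D(1)] 0 * by (auto simp: dual_map_def fun_eq_iff restrict_def)
    then show ?thesis using 0 by (auto simp: coboundaries_def simp del: dual_sel)
  next
    case (Suc j)
    obtain \<chi> where \<chi>: "\<chi> \<in> lmod_hom R (P j) (regular_module R)"
      "\<forall>x\<in>carrier (P (Suc j)). \<phi> (e (Suc j) x) = \<phi> x \<oplus>\<^bsub>regular_module R\<^esub> \<chi> (\<delta> j x)"
      using cocycle_chain_endomorphism_Suc[OF X res e reg, of \<phi> j] \<phi>h \<phi>D(2) Suc by blast
    let ?\<chi> = "\<lambda>x\<in>carrier (P j). \<chi> x"
    have "?\<chi> \<in> carrier (dual R (P j))" by (rule dual_memI[OF P \<chi>(1)])
    moreover have "dual_map (P i) (e i) \<phi> = \<phi> \<oplus>\<^bsub>dual R (P i)\<^esub> dual_map (P (Suc j)) (\<delta> j) ?\<chi>"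
      using \<chi>(2) Suc hom_closed[OF \<delta>] by (auto simp: dual_map_def fun_eq_iff)
    ultimately show ?thesis using Suc by (auto simp: coboundaries_def simp del: dual_sel)
  qed
qed

end

lemma chain_map_coboundaries:
  assumes "\<And>i. left_module R (P i)" "\<And>i. \<delta> i \<in> lmod_hom R (P (Suc i)) (P i)"
    and f: "\<forall>i. f i \<in> lmod_hom R (P i) (P' i)"
    "\<forall>i. \<forall>x\<in>carrier (P (Suc i)). \<delta>' i (f (Suc i) x) = f i (\<delta> i x)"
    and b: "b \<in> coboundaries R P' \<delta>' i"
  shows "dual_map (P i) (f i) b \<in> coboundaries R P \<delta> i"
proof (cases i)
  case 0
  then show ?thesis
    using b hom_closed[OF f(1)[rule_format]] by (auto simp: coboundaries_def dual_map_def fun_eq_iff)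
next
  case (Suc j)
  then obtain \<psi> where \<psi>: "\<psi> \<in> carrier (dual R (P' j))" "b = dual_map (P' (Suc j)) (\<delta>' j) \<psi>"
    using b by (auto simp: coboundaries_def simp del: dual_sel)
  have "dual_map (P i) (f i) b = dual_map (P (Suc j)) (\<delta> j) (dual_map (P j) (f j) \<psi>)"
    using Suc \<psi>(2) f hom_closed[OF assms(2)] hom_closed[OF f(1)[rule_format]]
    by (auto simp: dual_map_def fun_eq_iff)
  then show ?thesis
    using hom_closed[OF dual_map_hom[OF assms(1) f(1)[rule_format]] \<psi>(1)] Suc
    by (simp add: coboundaries_def del: dual_sel)
qed

lemma chain_map_cocycles:
  assumes "\<And>i. left_module R (P i)" "\<And>i. \<delta> i \<in> lmod_hom R (P (Suc i)) (P i)"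
    and f: "\<forall>i. f i \<in> lmod_hom R (P i) (P' i)"
    "\<forall>i. \<forall>x\<in>carrier (P (Suc i)). \<delta>' i (f (Suc i) x) = f i (\<delta> i x)"
    and \<phi>: "\<phi> \<in> carrier (cocycles R P' \<delta>' i)"
  shows "dual_map (P i) (f i) \<phi> \<in> carrier (cocycles R P \<delta> i)"
proof -
  have "dual_map (P i) (f i) \<phi> \<in> carrier (dual R (P i))"
    using hom_closed[OF dual_map_hom[OF assms(1) f(1)[rule_format]]] \<phi> by (simp add: mem_cocycles del: dual_sel)
  moreover have "\<phi> (f i (\<delta> i x)) = \<zero>\<^bsub>R\<^esub>" if "x \<in> carrier (P (Suc i))" for x
    using \<phi> that f hom_closed[OF f(1)[rule_format] that] by (metis mem_cocycles)
  ultimately show ?thesis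
    using hom_closed[OF assms(2)] by (simp add: mem_cocycles dual_map_apply del: dual_sel)
qed

text \<open>The isomorphism and its inverse lift to chain maps whose composites act on cocycles as
  the identity up to coboundaries. So pulling back along \<open>f\<close> maps the cocycles of
  \<open>P'\<close> onto the cohomology of \<open>P\<close>, and the kernel is exactly the
  coboundaries of \<open>P'\<close>.\<close>

lemma dual_cohomology_iso:
  assumes X: "left_module R X" and res: "projective_resolution R X P \<delta> \<epsilon>"
    and X': "left_module R X'" and res': "projective_resolution R X' P' \<delta>' \<epsilon>'"
    and iso: "lmod_iso R X X'"
  shows "lmod_iso (opp R) (dual_cohomology R P' \<delta>' i) (dual_cohomology R P \<delta> i)"
proof -
  note P = resolution_left_module[OF X res] and P' = resolution_left_module[OF X' res']
  note \<delta> = resolution_hom[OF X res] and \<delta>' = resolution_hom[OF X' res']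
  obtain \<theta> \<eta> where \<theta>: "\<theta> \<in> lmod_hom R X X'" "\<eta> \<in> lmod_hom R X' X"
    "\<forall>x\<in>carrier X. \<eta> (\<theta> x) = x" "\<forall>y\<in>carrier X'. \<theta> (\<eta> y) = y"
    by (rule lmod_iso_obtain[OF X X' iso])
  obtain f where f: "\<forall>i. f i \<in> lmod_hom R (P i) (P' i)" "\<forall>x\<in>carrier (P 0). \<epsilon>' (f 0 x) = \<theta> (\<epsilon> x)"
    "\<forall>i. \<forall>x\<in>carrier (P (Suc i)). \<delta>' i (f (Suc i) x) = f i (\<delta> i x)"
    by (rule chain_map_exists[OF X res X' res' \<theta>(1)])
  obtain g where g: "\<forall>i. g i \<in> lmod_hom R (P' i) (P i)" "\<forall>x\<in>carrier (P' 0). \<epsilon> (g 0 x) = \<eta> (\<epsilon>' x)"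
    "\<forall>i. \<forall>x\<in>carrier (P' (Suc i)). \<delta> i (g (Suc i) x) = g i (\<delta>' i x)"
    by (rule chain_map_exists[OF X' res' X res \<theta>(2)])
  note fh = f(1)[rule_format] and gh = g(1)[rule_format]
  note fc = hom_closed[OF fh] and gc = hom_closed[OF gh]
  note \<epsilon>c = hom_closed[OF epi_hom[OF resolution_epi[OF X res]]]
    and \<epsilon>'c = hom_closed[OF epi_hom[OF resolution_epi[OF X' res']]]
  have gf: "dual_map (P i) (f i) (dual_map (P' i) (g i) \<phi>) = dual_map (P i) (\<lambda>x. g i (f i x)) \<phi>" for \<phi>
    by (auto simp: dual_map_def fun_eq_iff fc)
  have fg: "dual_map (P' i) (g i) (dual_map (P i) (f i) \<phi>) = dual_map (P' i) (\<lambda>x. f i (g i x)) \<phi>" for \<phi>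
    by (auto simp: dual_map_def fun_eq_iff gc)
  let ?Z = "cocycles R P \<delta> i" and ?Z' = "cocycles R P' \<delta>' i"
  let ?B = "coboundaries R P \<delta> i" and ?B' = "coboundaries R P' \<delta>' i"
  let ?H = "dual_cohomology R P \<delta> i" and ?H' = "dual_cohomology R P' \<delta>' i"
  let ?F = "dual_map (P i) (f i)" and ?G = "dual_map (P' i) (g i)"
  let ?\<pi> = "\<lambda>\<phi>. ?B +>\<^bsub>?Z\<^esub> \<phi>"
  note Q = cohomology_quotient[OF X res, of i] and Q' = cohomology_quotient[OF X' res', of i]
  note Z = left_module_cocycles[OF X res, of i] and Z' = left_module_cocycles[OF X' res', of i]
  interpret Z: left_module "opp R" ?Z by (rule Z)
  interpret Z': left_module "opp R" ?Z' by (rule Z')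
  interpret H: left_module "opp R" ?H by (rule Q(1))
  have gf_cob: "\<exists>b\<in>?B. ?F (?G \<phi>) = \<phi> \<oplus>\<^bsub>?Z\<^esub> b" if "\<phi> \<in> carrier ?Z" for \<phi>
    unfolding gf cocycles_sel
    by (rule cocycle_chain_endomorphism[OF X res, of "\<lambda>i x. g i (f i x)"])
      (use that f g fc gc \<theta>(3) \<epsilon>c hom_compose[OF gh fh] hom_closed[OF \<delta>] in auto)
  have fg_cob: "\<exists>b\<in>?B'. ?G (?F \<phi>) = \<phi> \<oplus>\<^bsub>?Z'\<^esub> b" if "\<phi> \<in> carrier ?Z'" for \<phi>
    unfolding fg cocycles_sel
    by (rule cocycle_chain_endomorphism[OF X' res', of "\<lambda>i x. f i (g i x)"])
      (use that f g fc gc \<theta>(4) \<epsilon>'c hom_compose[OF fh gh] hom_closed[OF \<delta>'] in auto)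
  have Fcl: "?F \<phi> \<in> carrier ?Z" if "\<phi> \<in> carrier ?Z'" for \<phi>
    by (rule chain_map_cocycles[OF P \<delta> f(1,3) that])
  have Gcl: "?G \<phi> \<in> carrier ?Z'" if "\<phi> \<in> carrier ?Z" for \<phi>
    by (rule chain_map_cocycles[OF P' \<delta>' g(1,3) that])
  have F: "?F \<in> lmod_hom (opp R) ?Z' ?Z"
    by (rule lmod_homI[OF Fcl])
      (auto simp: hom_add[OF dual_map_hom[OF P fh]] hom_smult[OF dual_map_hom[OF P fh]] mem_cocycles simp del: dual_sel)
  have \<pi>B: "?\<pi> b = \<zero>\<^bsub>?H\<^esub>" if "b \<in> ?B" for b
    using that Q(3) by (metis mem_a_kernel)
  have q: "(\<lambda>\<phi>. ?\<pi> (?F \<phi>)) \<in> lmod_epi (opp R) ?Z' ?H"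
  proof (rule epiI[OF hom_compose[OF epi_hom[OF Q(2)] F]])
    fix y assume "y \<in> carrier ?H"
    then obtain \<phi> where \<phi>: "\<phi> \<in> carrier ?Z" "?\<pi> \<phi> = y" using epi_obtain[OF Q(2)] by blast
    obtain b where b: "b \<in> ?B" "?F (?G \<phi>) = \<phi> \<oplus>\<^bsub>?Z\<^esub> b" using gf_cob[OF \<phi>(1)] by blast
    have "b \<in> carrier ?Z" using b(1) coboundaries_subset_cocycles[OF X res] by blast
    then have "?\<pi> (?F (?G \<phi>)) = y"
      unfolding b(2) using hom_add[OF epi_hom[OF Q(2)] \<phi>(1)] \<pi>B[OF b(1)] \<phi>(2) \<open>y \<in> carrier ?H\<close> by simp
    then show "\<exists>\<phi>\<in>carrier ?Z'. ?\<pi> (?F \<phi>) = y" using Gcl[OF \<phi>(1)] by blast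
  qed
  have "a_kernel ?Z' ?H (\<lambda>\<phi>. ?\<pi> (?F \<phi>)) = ?B'"
  proof (intro equalityI subsetI)
    fix \<phi> assume "\<phi> \<in> a_kernel ?Z' ?H (\<lambda>\<phi>. ?\<pi> (?F \<phi>))"
    then have \<phi>: "\<phi> \<in> carrier ?Z'" "?F \<phi> \<in> ?B"
      using Fcl Q(3) by (auto simp: mem_a_kernel)
    obtain b where b: "b \<in> ?B'" "?G (?F \<phi>) = \<phi> \<oplus>\<^bsub>?Z'\<^esub> b" using fg_cob[OF \<phi>(1)] by blast
    have "b \<in> carrier ?Z'" using b(1) coboundaries_subset_cocycles[OF X' res'] by blast
    \<comment> \<open>Pulling back the coboundary \<open>?F \<phi>\<close> gives a coboundary again,
      and \<phi> differs from that one by the coboundary \<open>b\<close>.\<close>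
    then have "\<phi> = ?G (?F \<phi>) \<ominus>\<^bsub>?Z'\<^esub> b"
      unfolding b(2) using Z'.add_minus_cancel[OF \<phi>(1)] by metis
    moreover have "?G (?F \<phi>) \<in> ?B'" by (rule chain_map_coboundaries[OF P' \<delta>' g(1,3) \<phi>(2)])
    ultimately show "\<phi> \<in> ?B'"
      using submoduleD(6)[OF submodule_coboundaries[OF X' res']] b(1) by metis
  next
    fix \<phi> assume \<phi>: "\<phi> \<in> ?B'"
    then have "\<phi> \<in> carrier ?Z'" using coboundaries_subset_cocycles[OF X' res'] by blast
    then show "\<phi> \<in> a_kernel ?Z' ?H (\<lambda>\<phi>. ?\<pi> (?F \<phi>))"
      using \<pi>B[OF chain_map_coboundaries[OF P \<delta> f(1,3) \<phi>]] by (simp add: mem_a_kernel)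
  qed
  then show ?thesis
    by (intro iso_of_epis[OF Z' Q'(1) Q(1) Q'(2) q]) (simp add: Q'(3))
qed

section \<open>Ext and grade do not depend on the chosen resolution\<close>

lemma Ext_ring_resolution:
  assumes "left_noetherian R" "fg_module R X"
  obtains P \<delta> \<epsilon> where "projective_resolution R X P \<delta> \<epsilon>" "\<And>i. Ext_ring R i X = dual_cohomology R P \<delta> i"
proof -
  let ?t = "SOME (P :: nat \<Rightarrow> ('a, 'a fg_elem) module, \<delta>, \<epsilon>). projective_resolution R X P \<delta> \<epsilon>"
  obtain P0 :: "nat \<Rightarrow> ('a, 'a fg_elem) module" and \<delta>0 \<epsilon>0 where "projective_resolution R X P0 \<delta>0 \<epsilon>0"
    by (rule projective_resolution_exists[OF assms])
  then have "\<exists>t. (\<lambda>(P :: nat \<Rightarrow> ('a, 'a fg_elem) module, \<delta>, \<epsilon>). projective_resolution R X P \<delta> \<epsilon>) t" by auto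
  then have t: "(\<lambda>(P, \<delta>, \<epsilon>). projective_resolution R X P \<delta> \<epsilon>) ?t" by (rule someI_ex)
  obtain P \<delta> \<epsilon> where eq: "?t = (P, \<delta>, \<epsilon>)" by (cases ?t) auto
  have "projective_resolution R X P \<delta> \<epsilon>" using t unfolding eq by simp
  moreover have "Ext_ring R i X = dual_cohomology R P \<delta> i" for i
    unfolding Ext_ring_def eq by simp
  ultimately show ?thesis by (rule that)
qed

text \<open>The resolution inside \<open>Ext_ring\<close> is an arbitrary choice. Here it is
  exchanged for any resolution of any isomorphic module, which may also have a different carrier
  type.\<close>

lemma Ext_ring_iso:
  assumes "left_noetherian R" "fg_module R X" "left_module R X'" "lmod_iso R X X'"
    "projective_resolution R X' P' \<delta>' \<epsilon>'"
  shows "lmod_iso (opp R) (Ext_ring R i X) (dual_cohomology R P' \<delta>' i)"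
proof -
  have X: "left_module R X" using assms(2) by (rule fg_module_left_module)
  obtain P \<delta> \<epsilon> where P: "projective_resolution R X P \<delta> \<epsilon>" "\<And>i. Ext_ring R i X = dual_cohomology R P \<delta> i"
    using Ext_ring_resolution[OF assms(1,2)] by metis
  show ?thesis
    unfolding P(2)
    by (rule dual_cohomology_iso[OF assms(3,5) X P(1) lmod_iso_sym[OF X assms(3,4)]])
qed

lemma left_module_Ext_ring:
  "\<lbrakk>left_noetherian R; fg_module R X\<rbrakk> \<Longrightarrow> left_module (opp R) (Ext_ring R i X)"
  using Ext_ring_resolution left_module_cohomology fg_module_left_module by metis

lemma iso_trivial:
  assumes "left_module R M" "left_module R N" "lmod_iso R M N" "carrier M = {\<zero>\<^bsub>M\<^esub>}"
  shows "carrier N = {\<zero>\<^bsub>N\<^esub>}"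
proof -
  obtain f where f: "f \<in> lmod_hom R M N" "bij_betw f (carrier M) (carrier N)"
    using assms(3) by (auto simp: lmod_iso_def)
  then show ?thesis using assms(4) hom_zero[OF assms(1,2) f(1)] by (auto simp: bij_betw_def)
qed

lemma Ext_ring_cong:
  assumes "left_noetherian R" "fg_module R X" "left_module R X'" "lmod_iso R X X'"
  shows "lmod_iso (opp R) (Ext_ring R i X) (Ext_ring R i X')"
proof -
  have X': "fg_module R X'" by (rule fg_module_iso[OF assms(2-4)])
  show ?thesis
    using Ext_ring_resolution[OF assms(1) X'] Ext_ring_iso[OF assms] by metis
qed

text \<open>\<open>quasi_gorenstein\<close> bounds the grade of the record \<open>Ext_ring\<close>,
  whereas the chain is built from kernels that are merely isomorphic to it.\<close>

lemma grade_ge_cong: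
  assumes "left_noetherian R" "fg_module R X" "left_module R X'" "lmod_iso R X X'" "grade_ge R X i"
  shows "grade_ge R X' i"
  unfolding grade_ge_def
proof (intro allI impI)
  fix j assume "j < i"
  then have *: "carrier (Ext_ring R j X) = {\<zero>\<^bsub>Ext_ring R j X\<^esub>}" using assms(5) by (simp add: grade_ge_def)
  show "carrier (Ext_ring R j X') = {\<zero>\<^bsub>Ext_ring R j X'\<^esub>}"
    by (rule iso_trivial[OF left_module_Ext_ring[OF assms(1,2)]
          left_module_Ext_ring[OF assms(1) fg_module_iso[OF assms(2-4)]] Ext_ring_cong[OF assms(1-4)] *])
qed

subsection \<open>Short exact sequences\<close>

lemma short_exactD:
  assumes "short_exact R A f B g C"
  shows "f \<in> lmod_hom R A B" "inj_on f (carrier A)" "f ` carrier A = a_kernel B C g" "g \<in> lmod_epi R B C"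
  using assms by (simp_all add: short_exact_def)

lemma short_exact_comp_zero:
  assumes "short_exact R A f B g C" "a \<in> carrier A" shows "g (f a) = \<zero>\<^bsub>C\<^esub>"
proof -
  have "f a \<in> a_kernel B C g" unfolding short_exactD(3)[OF assms(1), symmetric] using assms(2) by simp
  then show ?thesis by (simp add: mem_a_kernel)
qed

lemma short_exact_lift:
  assumes "short_exact R A f B g C" "b \<in> carrier B" "g b = \<zero>\<^bsub>C\<^esub>"
  obtains a where "a \<in> carrier A" "f a = b"
proof -
  have "b \<in> f ` carrier A"
    unfolding short_exactD(3)[OF assms(1)] using assms(2,3) by (simp add: mem_a_kernel)
  then show ?thesis using that by blast
qed

lemma short_exactI:
  assumes "f \<in> lmod_hom R A B" "inj_on f (carrier A)" "g \<in> lmod_epi R B C"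
    and "\<And>a. a \<in> carrier A \<Longrightarrow> g (f a) = \<zero>\<^bsub>C\<^esub>"
    and "\<And>b. \<lbrakk>b \<in> carrier B; g b = \<zero>\<^bsub>C\<^esub>\<rbrakk> \<Longrightarrow> \<exists>a\<in>carrier A. f a = b"
  shows "short_exact R A f B g C"
proof -
  have "f ` carrier A = a_kernel B C g"
    using assms(4,5) hom_closed[OF assms(1)] by (fastforce simp: mem_a_kernel)
  then show ?thesis using assms(1-3) by (simp add: short_exact_def)
qed

lemma short_exact_kernel:
  "f \<in> lmod_epi R M N \<Longrightarrow> short_exact R (kernel_module M N f) (\<lambda>x. x) M f N"
  unfolding kernel_module_def by (rule short_exactI) (auto simp: mem_a_kernel intro: hom_inclusion)

text \<open>All three carrier types may change; this is how sequences involving sums, kernels or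
  duals are moved to copies with elements in \<open>fg_elem\<close>.\<close>

lemma short_exact_transport:
  assumes se: "short_exact R A f B g C"
    and mods: "left_module R A" "left_module R B" "left_module R C"
    and a: "a \<in> lmod_hom R A A'" "a' \<in> lmod_hom R A' A" "\<forall>x\<in>carrier A. a' (a x) = x" "\<forall>x\<in>carrier A'. a (a' x) = x"
    and b: "b \<in> lmod_hom R B B'" "b' \<in> lmod_hom R B' B" "\<forall>x\<in>carrier B. b' (b x) = x" "\<forall>x\<in>carrier B'. b (b' x) = x"
    and c: "c \<in> lmod_hom R C C'" "c' \<in> lmod_hom R C' C" "\<forall>x\<in>carrier C. c' (c x) = x" "\<forall>x\<in>carrier C'. c (c' x) = x"
    and C': "left_module R C'"
  shows "short_exact R A' (\<lambda>x. b (f (a' x))) B' (\<lambda>x. c (g (b' x))) C'"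
proof -
  note D = short_exactD[OF se]
  note g = epi_hom[OF D(4)]
  have [simp]: "c \<zero>\<^bsub>C\<^esub> = \<zero>\<^bsub>C'\<^esub>" by (rule hom_zero[OF mods(3) C' c(1)])
  note cl = hom_closed[OF D(1)] hom_closed[OF g] hom_closed[OF a(1)] hom_closed[OF a(2)]
    hom_closed[OF b(1)] hom_closed[OF b(2)] hom_closed[OF c(1)] hom_closed[OF c(2)]
  show ?thesis
  proof (rule short_exactI)
    show "(\<lambda>x. b (f (a' x))) \<in> lmod_hom R A' B'" by (rule hom_compose[OF b(1) hom_compose[OF D(1) a(2)]])
    show "inj_on (\<lambda>x. b (f (a' x))) (carrier A')"
    proof (rule inj_onI)
      fix x y assume xy: "x \<in> carrier A'" "y \<in> carrier A'" "b (f (a' x)) = b (f (a' y))"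
      then have "f (a' x) = f (a' y)" using b(3) cl by metis
      then have "a' x = a' y" using inj_onD[OF D(2)] xy cl by blast
      then show "x = y" using a(4) xy by metis
    qed
    show "(\<lambda>x. c (g (b' x))) \<in> lmod_epi R B' C'"
    proof (rule epiI[OF hom_compose[OF c(1) hom_compose[OF g b(2)]]])
      fix y assume y: "y \<in> carrier C'"
      obtain x where "x \<in> carrier B" "g x = c' y" using epi_obtain[OF D(4) cl(8)[OF y]] .
      then show "\<exists>x\<in>carrier B'. c (g (b' x)) = y" using y b(3) c(4) cl by (intro bexI[of _ "b x"]) auto
    qed
    show "c (g (b' (b (f (a' x))))) = \<zero>\<^bsub>C'\<^esub>" if "x \<in> carrier A'" for x
      using that cl b(3) short_exact_comp_zero[OF se] by simp
    show "\<exists>x\<in>carrier A'. b (f (a' x)) = y" if y: "y \<in> carrier B'" "c (g (b' y)) = \<zero>\<^bsub>C'\<^esub>" for y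
    proof -
      have "g (b' y) = c' (c (g (b' y)))" using y(1) c(3) cl by simp
      then have "g (b' y) = \<zero>\<^bsub>C\<^esub>" using y(2) hom_zero[OF C' mods(3) c(2)] by simp
      then obtain x where "x \<in> carrier A" "f x = b' y" using short_exact_lift[OF se cl(6)[OF y(1)]] by blast
      then show ?thesis using y(1) a(3) b(4) cl by (intro bexI[of _ "a x"]) auto
    qed
  qed
qed

lemma short_exact_fg:
  assumes "left_noetherian R" "fg_module R B" "left_module R A" "left_module R C" "short_exact R A f B g C"
  shows "fg_module R A"
proof -
  note D = short_exactD[OF assms(5)]
  have B: "left_module R B" using assms(2) by (rule fg_module_left_module)
  have K: "fg_module R (kernel_module B C g)"
    by (rule fg_module_kernel[OF assms(1,2,4) epi_hom[OF D(4)]])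
  have "f \<in> lmod_hom R A (kernel_module B C g)"
    unfolding kernel_module_def by (rule hom_restrict_codomain[OF D(1)]) (simp add: D(3))
  moreover have "bij_betw f (carrier A) (carrier (kernel_module B C g))"
    using D(2,3) by (simp add: bij_betw_def)
  ultimately have "lmod_iso R A (kernel_module B C g)" by (auto simp: lmod_iso_def)
  then show ?thesis
    using fg_module_iso[OF K assms(3)] lmod_iso_sym[OF assms(3) fg_module_left_module[OF K]] by blast
qed

subsection \<open>Syzygies\<close>

text \<open>The reason why exactness survives splicing: following a map into \<open>X\<close> by an
  embedding of \<open>X\<close> leaves its kernel unchanged.\<close>

lemma a_kernel_compose_inj:
  assumes "left_module R X" "left_module R Y" "\<theta> \<in> lmod_hom R X Y" "inj_on \<theta> (carrier X)"
    "f \<in> lmod_hom R A X"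
  shows "a_kernel A Y (\<lambda>x. \<theta> (f x)) = a_kernel A X f"
proof -
  have "\<theta> (f x) = \<zero>\<^bsub>Y\<^esub> \<longleftrightarrow> f x = \<zero>\<^bsub>X\<^esub>" if "x \<in> carrier A" for x
    by (rule hom_eq_zero_iff[OF assms(1-4) hom_closed[OF assms(5) that]])
  then show ?thesis unfolding a_kernel_def' by blast
qed

lemma projective_resolution_target_iso:
  assumes "left_module R X" "left_module R Y" "projective_resolution R X P \<delta> \<epsilon>"
    "\<theta> \<in> lmod_hom R X Y" "bij_betw \<theta> (carrier X) (carrier Y)"
  shows "projective_resolution R Y P \<delta> (\<lambda>x. \<theta> (\<epsilon> x))"
proof -
  note e = resolution_epi[OF assms(1,3)]
  have "a_kernel (P 0) Y (\<lambda>x. \<theta> (\<epsilon> x)) = a_kernel (P 0) X \<epsilon>"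
    by (rule a_kernel_compose_inj[OF assms(1,2,4) bij_betw_imp_inj_on[OF assms(5)] epi_hom[OF e]])
  then have "out_kernel Y P \<delta> (\<lambda>x. \<theta> (\<epsilon> x)) i = out_kernel X P \<delta> \<epsilon> i" for i
    by (simp add: out_kernel_def split: nat.splits)
  then show ?thesis
    using assms(3) epi_compose[OF iso_epi[OF assms(4,5)] e] by (simp add: projective_resolution_iff)
qed

text \<open>The new differential is the augmentation of the old resolution followed by
  \<open>j\<close>. Its image is the kernel of \<open>p\<close>, and its kernel is still that of
  \<epsilon> because \<open>j\<close> is injective.\<close>

lemma projective_resolution_prepend:
  assumes X': "left_module R X'" and res: "projective_resolution R X' P \<delta> \<epsilon>"
    and F: "fg_projective R F" and X: "left_module R X" and se: "short_exact R X' j F p X"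
  shows "projective_resolution R X (case_nat F P) (case_nat (\<lambda>x. j (\<epsilon> x)) \<delta>) p"
proof -
  note D = short_exactD[OF se] and e = resolution_epi[OF X' res]
  note j\<epsilon> = hom_compose[OF D(1) epi_hom[OF e]]
  let ?P = "case_nat F P" and ?\<delta> = "case_nat (\<lambda>x. j (\<epsilon> x)) \<delta>"
  have "(\<lambda>x. j (\<epsilon> x)) ` carrier (P 0) = j ` \<epsilon> ` carrier (P 0)" by (simp add: image_image)
  then have base: "(\<lambda>x. j (\<epsilon> x)) ` carrier (P 0) = a_kernel F X p"
    by (simp add: epi_image[OF e] D(3))
  have 1: "a_kernel (P 0) F (\<lambda>x. j (\<epsilon> x)) = a_kernel (P 0) X' \<epsilon>"
    by (rule a_kernel_compose_inj[OF X' fg_projective_left_module[OF F] D(1,2) epi_hom[OF e]])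
  have "?\<delta> i \<in> lmod_hom R (?P (Suc i)) (?P i) \<and> ?\<delta> i ` carrier (?P (Suc i)) = out_kernel X ?P ?\<delta> p i" for i
  proof (cases i)
    case 0
    then show ?thesis using j\<epsilon> base by (simp add: out_kernel_0)
  next
    case (Suc k)
    then show ?thesis
      using resolution_hom[OF X' res, of k] resolution_image[OF X' res, of k] 1
      by (cases k) (simp_all add: out_kernel_def)
  qed
  moreover have "fg_projective R (?P i)" for i
    using F resolution_projective[OF X' res] by (cases i) simp_all
  ultimately show ?thesis using D(4) by (simp add: projective_resolution_iff)
qed

lemma is_syzygy_left_module: "is_syzygy R d X B \<Longrightarrow> left_module R B"
  by (simp add: is_syzygy_def)

text \<open>With \<open>d = Suc c\<close> the place \<open>d - 1\<close> becomes \<open>c\<close>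
  and the case distinction in \<open>is_syzygy\<close> disappears.\<close>

lemma is_syzygy_SucI:
  fixes P :: "nat \<Rightarrow> ('r, 'r fg_elem) module"
  assumes "left_module R B" "partial_resolution R (Suc c) X P \<delta> \<epsilon>" "\<iota> \<in> lmod_hom R B (P c)"
    "inj_on \<iota> (carrier B)" "\<iota> ` carrier B = out_kernel X P \<delta> \<epsilon> c"
  shows "is_syzygy R (Suc c) X B"
  unfolding is_syzygy_def
  using assms by (simp del: ex_simps) (intro exI conjI; assumption)

lemma is_syzygy_SucE:
  fixes R :: "('r, 'z) ring_scheme"
  assumes "is_syzygy R (Suc c) X B"
  obtains P :: "nat \<Rightarrow> ('r, 'r fg_elem) module" and \<delta> \<epsilon> \<iota> where
    "partial_resolution R (Suc c) X P \<delta> \<epsilon>" "\<iota> \<in> lmod_hom R B (P c)" "inj_on \<iota> (carrier B)"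
    "\<iota> ` carrier B = out_kernel X P \<delta> \<epsilon> c"
proof -
  have "\<exists>(P :: nat \<Rightarrow> ('r, 'r fg_elem) module) \<delta> \<epsilon> \<iota>. partial_resolution R (Suc c) X P \<delta> \<epsilon> \<and>
    \<iota> \<in> lmod_hom R B (P c) \<and> inj_on \<iota> (carrier B) \<and> \<iota> ` carrier B = out_kernel X P \<delta> \<epsilon> c"
    using assms by (simp add: is_syzygy_def)
  then show ?thesis using that by (elim exE conjE)
qed

text \<open>The form of dimension shifting used below: from place \<open>d\<close> on, a resolution
  of \<open>X\<close> can be made to coincide with a given resolution of \<open>B\<close>, so that
  Ext^(d+i)(X, R) = Ext^i(B, R) for i \<ge> 1.\<close>

lemma is_syzygy_splice:
  fixes P' :: "nat \<Rightarrow> ('r, 'r fg_elem) module"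
  assumes X: "left_module R X" and syz: "is_syzygy R d X B" and res: "projective_resolution R B P' \<delta>' \<epsilon>'"
  obtains P \<delta> \<epsilon> where "projective_resolution R X P \<delta> \<epsilon>" "\<forall>i. P (d + i) = P' i" "\<forall>i. \<delta> (d + i) = \<delta>' i"
proof (cases d)
  case 0
  then obtain \<theta> where "\<theta> \<in> lmod_hom R B X" "bij_betw \<theta> (carrier B) (carrier X)"
    using syz by (auto simp: is_syzygy_def lmod_iso_def)
  from projective_resolution_target_iso[OF is_syzygy_left_module[OF syz] X res this]
  show ?thesis using that 0 by simp
next
  case (Suc c)
  have B: "left_module R B" by (rule is_syzygy_left_module[OF syz])
  obtain P0 :: "nat \<Rightarrow> ('r, 'r fg_elem) module" and \<delta>0 \<epsilon>0 \<iota> where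
    part: "partial_resolution R (Suc c) X P0 \<delta>0 \<epsilon>0" and
    \<iota>: "\<iota> \<in> lmod_hom R B (P0 c)" "inj_on \<iota> (carrier B)" "\<iota> ` carrier B = out_kernel X P0 \<delta>0 \<epsilon>0 c"
    by (rule is_syzygy_SucE[OF syz[unfolded Suc]])
  note e = resolution_epi[OF B res]
  define P where "P i = (if i \<le> c then P0 i else P' (i - Suc c))" for i
  \<comment> \<open>Place \<open>c\<close> carries the splice: the augmentation onto
    \<open>B\<close> followed by the embedding of \<open>B\<close> into the last of the given
    projectives.\<close>
  define \<delta> where "\<delta> i = (if i < c then \<delta>0 i else if i = c then (\<lambda>x. \<iota> (\<epsilon>' x)) else \<delta>' (i - Suc c))" for i
  have P0c: "fg_projective R (P0 i)" if "i \<le> c" for i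
    using part that by (simp add: partial_resolution_def)
  have lo: "out_kernel X P \<delta> \<epsilon>0 i = out_kernel X P0 \<delta>0 \<epsilon>0 i" if "i \<le> c" for i
    using that by (cases i) (simp_all add: out_kernel_def P_def \<delta>_def)
  have "(\<lambda>x. \<iota> (\<epsilon>' x)) ` carrier (P' 0) = \<iota> ` \<epsilon>' ` carrier (P' 0)" by (simp add: image_image)
  then have mid: "(\<lambda>x. \<iota> (\<epsilon>' x)) ` carrier (P' 0) = out_kernel X P0 \<delta>0 \<epsilon>0 c"
    by (simp add: epi_image[OF e] \<iota>(3))
  have ker: "a_kernel (P' 0) (P0 c) (\<lambda>x. \<iota> (\<epsilon>' x)) = a_kernel (P' 0) B \<epsilon>'"
    by (rule a_kernel_compose_inj[OF B fg_projective_left_module[OF P0c[OF order_refl]] \<iota>(1,2) epi_hom[OF e]])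
  have hi: "out_kernel X P \<delta> \<epsilon>0 (Suc c + k) = out_kernel B P' \<delta>' \<epsilon>' k" for k
    by (cases k) (simp_all add: out_kernel_def P_def \<delta>_def ker)
  have "\<delta> i \<in> lmod_hom R (P (Suc i)) (P i) \<and> \<delta> i ` carrier (P (Suc i)) = out_kernel X P \<delta> \<epsilon>0 i" for i
  proof -
    consider "i < c" | "i = c" | k where "i = Suc c + k"
      by (metis add_Suc less_iff_Suc_add linorder_neqE_nat)
    then show ?thesis
    proof cases
      case 1
      then show ?thesis
        using part lo[of i] by (simp add: partial_resolution_def P_def \<delta>_def)
    next
      case 2
      then show ?thesis
        using lo[of c] mid hom_compose[OF \<iota>(1) epi_hom[OF e]] by (simp add: P_def \<delta>_def)
    next
      case (3 k)
      then show ?thesis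
        using hi[of k] resolution_hom[OF B res, of k] resolution_image[OF B res, of k]
        by (simp add: P_def \<delta>_def)
    qed
  qed
  moreover have "fg_projective R (P i)" for i
    using P0c resolution_projective[OF B res] by (simp add: P_def)
  moreover have "\<epsilon>0 \<in> lmod_epi R (P 0) X"
    using part by (simp add: partial_resolution_def P_def)
  ultimately have "projective_resolution R X P \<delta> \<epsilon>0" by (simp add: projective_resolution_iff)
  moreover have "\<forall>i. P (d + i) = P' i" "\<forall>i. \<delta> (d + i) = \<delta>' i"
    by (simp_all add: P_def \<delta>_def Suc)
  ultimately show ?thesis by (rule that)
qed

text \<open>\<open>F\<close> is attached at place \<open>d\<close> by the map through
  \<open>B\<close>, whose kernel is that of \<open>p\<close>. For \<open>d = 0\<close>, where
  \<open>B\<close> is a copy of \<open>X\<close>, it becomes the first projective.\<close>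

lemma is_syzygy_Suc:
  fixes F :: "('r, 'r fg_elem) module"
  assumes X: "left_module R X" and syz: "is_syzygy R d X B" and F: "fg_projective R F"
    and B': "left_module R B'" and se: "short_exact R B' j F p B"
  shows "is_syzygy R (Suc d) X B'"
proof (cases d)
  case 0
  have B: "left_module R B" by (rule is_syzygy_left_module[OF syz])
  note D = short_exactD[OF se]
  obtain \<theta> where \<theta>: "\<theta> \<in> lmod_hom R B X" "bij_betw \<theta> (carrier B) (carrier X)"
    using syz 0 by (auto simp: is_syzygy_def lmod_iso_def)
  have ker: "a_kernel F X (\<lambda>x. \<theta> (p x)) = a_kernel F B p"
    by (rule a_kernel_compose_inj[OF B X \<theta>(1) bij_betw_imp_inj_on[OF \<theta>(2)] epi_hom[OF D(4)]])
  \<comment> \<open>With a single projective no differential is constrained, and the identity merely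
    fills the slot of \<delta>.\<close>
  have "partial_resolution R (Suc 0) X (\<lambda>_. F) (\<lambda>_ x. x) (\<lambda>x. \<theta> (p x))"
    using F epi_compose[OF iso_epi[OF \<theta>] D(4)] by (simp add: partial_resolution_def)
  moreover have "j ` carrier B' = out_kernel X (\<lambda>_. F) (\<lambda>_ x. x) (\<lambda>x. \<theta> (p x)) 0"
    by (simp add: out_kernel_0 ker D(3))
  ultimately show ?thesis
    unfolding 0 using D(1,2) by (intro is_syzygy_SucI[OF B']) auto
next
  case (Suc c)
  have B: "left_module R B" by (rule is_syzygy_left_module[OF syz])
  note D = short_exactD[OF se]
  obtain P0 :: "nat \<Rightarrow> ('r, 'r fg_elem) module" and \<delta>0 \<epsilon>0 \<iota> where
    part: "partial_resolution R (Suc c) X P0 \<delta>0 \<epsilon>0" and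
    \<iota>: "\<iota> \<in> lmod_hom R B (P0 c)" "inj_on \<iota> (carrier B)" "\<iota> ` carrier B = out_kernel X P0 \<delta>0 \<epsilon>0 c"
    by (rule is_syzygy_SucE[OF syz[unfolded Suc]])
  define P where "P = P0(Suc c := F)"
  define \<delta> where "\<delta> = \<delta>0(c := (\<lambda>x. \<iota> (p x)))"
  have P0c: "fg_projective R (P0 i)" if "i \<le> c" for i
    using part that by (simp add: partial_resolution_def)
  have lo: "out_kernel X P \<delta> \<epsilon>0 i = out_kernel X P0 \<delta>0 \<epsilon>0 i" if "i \<le> c" for i
    using that by (cases i) (simp_all add: out_kernel_def P_def \<delta>_def)
  have "(\<lambda>x. \<iota> (p x)) ` carrier F = \<iota> ` p ` carrier F" by (simp add: image_image)
  then have mid: "(\<lambda>x. \<iota> (p x)) ` carrier F = out_kernel X P0 \<delta>0 \<epsilon>0 c"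
    by (simp add: epi_image[OF D(4)] \<iota>(3))
  have ker: "a_kernel F (P0 c) (\<lambda>x. \<iota> (p x)) = a_kernel F B p"
    by (rule a_kernel_compose_inj[OF B fg_projective_left_module[OF P0c[OF order_refl]] \<iota>(1,2) epi_hom[OF D(4)]])
  have "\<delta> i \<in> lmod_hom R (P (Suc i)) (P i) \<and> \<delta> i ` carrier (P (Suc i)) = out_kernel X P \<delta> \<epsilon>0 i" if "i \<le> c" for i
    using that part lo[of i] mid hom_compose[OF \<iota>(1) epi_hom[OF D(4)]]
    by (cases "i = c") (simp_all add: partial_resolution_def P_def \<delta>_def)
  moreover have "fg_projective R (P i)" if "i \<le> Suc c" for i
    using F P0c that by (simp add: P_def)
  moreover have "\<epsilon>0 \<in> lmod_epi R (P 0) X"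
    using part by (simp add: partial_resolution_def P_def)
  ultimately have "partial_resolution R (Suc (Suc c)) X P \<delta> \<epsilon>0"
    unfolding partial_resolution_def by simp
  moreover have "j \<in> lmod_hom R B' (P (Suc c))" using D(1) by (simp add: P_def)
  moreover have "j ` carrier B' = out_kernel X P \<delta> \<epsilon>0 (Suc c)"
    by (simp add: D(3) out_kernel_Suc P_def \<delta>_def ker)
  ultimately show ?thesis
    unfolding Suc using D(2) by (intro is_syzygy_SucI[OF B'])
qed

lemma is_syzygy_target_iso:
  assumes "left_module R X" "left_module R Y" "lmod_iso R X Y" "is_syzygy R d X B"
  shows "is_syzygy R d Y B"
proof (cases d)
  case 0
  then show ?thesis using assms(3,4) lmod_iso_trans by (auto simp: is_syzygy_def)
next
  case (Suc c)
  obtain \<theta> where \<theta>: "\<theta> \<in> lmod_hom R X Y" "bij_betw \<theta> (carrier X) (carrier Y)"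
    using assms(3) by (auto simp: lmod_iso_def)
  obtain P :: "nat \<Rightarrow> ('a, 'a fg_elem) module" and \<delta> \<epsilon> \<iota> where
    part: "partial_resolution R (Suc c) X P \<delta> \<epsilon>" and
    \<iota>: "\<iota> \<in> lmod_hom R B (P c)" "inj_on \<iota> (carrier B)" "\<iota> ` carrier B = out_kernel X P \<delta> \<epsilon> c"
    by (rule is_syzygy_SucE[OF assms(4)[unfolded Suc]])
  have e: "\<epsilon> \<in> lmod_epi R (P 0) X" using part by (simp add: partial_resolution_def)
  have "a_kernel (P 0) Y (\<lambda>x. \<theta> (\<epsilon> x)) = a_kernel (P 0) X \<epsilon>"
    by (rule a_kernel_compose_inj[OF assms(1,2) \<theta>(1) bij_betw_imp_inj_on[OF \<theta>(2)] epi_hom[OF e]])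
  then have ok: "out_kernel Y P \<delta> (\<lambda>x. \<theta> (\<epsilon> x)) i = out_kernel X P \<delta> \<epsilon> i" for i
    by (simp add: out_kernel_def split: nat.splits)
  then have "partial_resolution R (Suc c) Y P \<delta> (\<lambda>x. \<theta> (\<epsilon> x))"
    using part epi_compose[OF iso_epi[OF \<theta>] e] by (simp add: partial_resolution_def)
  moreover have "\<iota> ` carrier B = out_kernel Y P \<delta> (\<lambda>x. \<theta> (\<epsilon> x)) c" unfolding ok by (rule \<iota>(3))
  ultimately show ?thesis
    unfolding Suc using \<iota>(1,2) by (intro is_syzygy_SucI[OF is_syzygy_left_module[OF assms(4)]])
qed

lemma is_syzygy_source_iso:
  assumes "left_module R B'" "b \<in> lmod_hom R B' B" "bij_betw b (carrier B') (carrier B)" "is_syzygy R d X B"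
  shows "is_syzygy R d X B'"
proof (cases d)
  case 0
  have "lmod_iso R B' B" using assms(2,3) by (auto simp: lmod_iso_def)
  then show ?thesis using 0 assms(1,4) lmod_iso_trans by (auto simp: is_syzygy_def)
next
  case (Suc c)
  obtain P :: "nat \<Rightarrow> ('a, 'a fg_elem) module" and \<delta> \<epsilon> \<iota> where
    part: "partial_resolution R (Suc c) X P \<delta> \<epsilon>" and
    \<iota>: "\<iota> \<in> lmod_hom R B (P c)" "inj_on \<iota> (carrier B)" "\<iota> ` carrier B = out_kernel X P \<delta> \<epsilon> c"
    by (rule is_syzygy_SucE[OF assms(4)[unfolded Suc]])
  have im: "b ` carrier B' = carrier B" by (rule bij_betw_imp_surj_on[OF assms(3)])
  have "inj_on (\<lambda>x. \<iota> (b x)) (carrier B')"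
    using comp_inj_on[OF bij_betw_imp_inj_on[OF assms(3)]] \<iota>(2) im by (simp add: comp_def)
  moreover have "(\<lambda>x. \<iota> (b x)) ` carrier B' = \<iota> ` b ` carrier B'" by (simp add: image_image)
  then have "(\<lambda>x. \<iota> (b x)) ` carrier B' = out_kernel X P \<delta> \<epsilon> c" by (simp add: im \<iota>(3))
  ultimately show ?thesis
    unfolding Suc using hom_compose[OF \<iota>(1) assms(2)] by (intro is_syzygy_SucI[OF assms(1) part])
qed

lemma syzygy_module_fg: "syzygy_module R d M \<Longrightarrow> fg_module R M"
  by (simp add: syzygy_module_def)

text \<open>\<open>F\<close> may have any carrier type, so the sequence is first moved to a copy of
  it. The copy is then attached to the projectives around \<open>X\<close> by the map F -> X
  followed by the embedding of \<open>X\<close>.\<close>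

lemma syzygy_module_Suc:
  assumes syz: "syzygy_module R d X" and F: "fg_projective R F" and Y: "fg_module R Y"
    and se: "short_exact R Y j F p X"
  shows "syzygy_module R (Suc d) Y"
proof -
  have X: "left_module R X" by (rule fg_module_left_module[OF syzygy_module_fg[OF syz]])
  obtain F' :: "('a, 'a fg_elem) module" and a b where F': "fg_projective R F'"
    "a \<in> lmod_hom R F F'" "b \<in> lmod_hom R F' F"
    "\<forall>x\<in>carrier F. b (a x) = x" "\<forall>y\<in>carrier F'. a (b y) = y"
    by (rule fg_projective_copy[OF F])
  note D = short_exactD[OF short_exact_transport[OF se fg_module_left_module[OF Y] fg_projective_left_module[OF F] X
        hom_id hom_id _ _ F'(2-5) hom_id hom_id _ _ X], simplified]
  let ?j = "\<lambda>x. a (j x)" and ?p = "\<lambda>x. p (b x)"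
  show ?thesis
  proof (cases d)
    case 0
    then show ?thesis
      unfolding syzygy_module_def using Y F'(1) D(1,2)
      by (auto intro!: exI[of _ "\<lambda>_. F'"] exI[of _ ?j])
  next
    case (Suc c)
    obtain P0 :: "nat \<Rightarrow> ('a, 'a fg_elem) module" and \<delta>0 \<iota> where
      P0: "\<forall>i<Suc c. fg_projective R (P0 i)"
        "\<forall>i. Suc i < Suc c \<longrightarrow> \<delta>0 i \<in> lmod_hom R (P0 (Suc i)) (P0 i)"
        "\<forall>i. Suc (Suc i) < Suc c \<longrightarrow> \<delta>0 (Suc i) ` carrier (P0 (Suc (Suc i))) = a_kernel (P0 (Suc i)) (P0 i) (\<delta>0 i)"
      and \<iota>: "\<iota> \<in> lmod_hom R X (P0 c)" "inj_on \<iota> (carrier X)"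
        "Suc c \<ge> 2 \<longrightarrow> \<iota> ` carrier X = a_kernel (P0 c) (P0 (Suc c - 2)) (\<delta>0 (Suc c - 2))"
      using syz Suc unfolding syzygy_module_def by auto
    define P where "P = P0(Suc c := F')"
    define \<delta> where "\<delta> = \<delta>0(c := (\<lambda>x. \<iota> (?p x)))"
    have "(\<lambda>x. \<iota> (?p x)) ` carrier F' = \<iota> ` ?p ` carrier F'" by (simp add: image_image)
    then have mid: "(\<lambda>x. \<iota> (?p x)) ` carrier F' = \<iota> ` carrier X" by (simp add: epi_image[OF D(4)])
    have ker: "a_kernel F' (P0 c) (\<lambda>x. \<iota> (?p x)) = a_kernel F' X ?p"
      by (rule a_kernel_compose_inj[OF X _ \<iota>(1,2) epi_hom[OF D(4)]]) (simp add: P0(1) fg_projective_left_module)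
    have "\<forall>i<Suc (Suc c). fg_projective R (P i)" using P0(1) F'(1) by (simp add: P_def)
    moreover have "\<forall>i. Suc i < Suc (Suc c) \<longrightarrow> \<delta> i \<in> lmod_hom R (P (Suc i)) (P i)"
      using P0(2) hom_compose[OF \<iota>(1) epi_hom[OF D(4)]] by (auto simp: P_def \<delta>_def less_Suc_eq)
    moreover have "\<delta> (Suc i) ` carrier (P (Suc (Suc i))) = a_kernel (P (Suc i)) (P i) (\<delta> i)"
      if "Suc (Suc i) < Suc (Suc c)" for i
    proof (cases "Suc i = c")
      \<comment> \<open>This is exactness at the projective into which \<open>X\<close> embeds. It
        is asked for only when \<open>c > 0\<close>, and exactly then the image of \<iota> is known
        to be a kernel.\<close>
      case True
      then show ?thesis using mid \<iota>(3) by (auto simp: P_def \<delta>_def)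
    next
      case False
      then show ?thesis using that P0(3) by (simp add: P_def \<delta>_def)
    qed
    moreover have "?j \<in> lmod_hom R Y (P (Suc c))" using D(1) by (simp add: P_def)
    moreover have "?j ` carrier Y = a_kernel (P (Suc c)) (P c) (\<delta> c)"
      by (simp add: D(3) P_def \<delta>_def ker)
    ultimately have "(\<forall>i<Suc (Suc c). fg_projective R (P i)) \<and>
        (\<forall>i. Suc i < Suc (Suc c) \<longrightarrow> \<delta> i \<in> lmod_hom R (P (Suc i)) (P i)) \<and>
        (\<forall>i. Suc (Suc i) < Suc (Suc c) \<longrightarrow>
          \<delta> (Suc i) ` carrier (P (Suc (Suc i))) = a_kernel (P (Suc i)) (P i) (\<delta> i)) \<and>
        ?j \<in> lmod_hom R Y (P (Suc (Suc c) - 1)) \<and> inj_on ?j (carrier Y) \<and>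
        (Suc (Suc c) \<ge> 2 \<longrightarrow> ?j ` carrier Y =
          a_kernel (P (Suc (Suc c) - 1)) (P (Suc (Suc c) - 2)) (\<delta> (Suc (Suc c) - 2)))"
      using D(2) by simp
    then show ?thesis
      unfolding syzygy_module_def Suc
      by (intro conjI[OF Y] impI) (rule exI[of _ P], rule exI[of _ \<delta>], rule exI[of _ ?j], assumption)
  qed
qed

lemma syzygy_module_iso:
  assumes "syzygy_module R d X" "left_module R Y" "b \<in> lmod_hom R Y X" "bij_betw b (carrier Y) (carrier X)"
  shows "syzygy_module R d Y"
proof -
  have X: "left_module R X" by (rule fg_module_left_module[OF syzygy_module_fg[OF assms(1)]])
  have "lmod_iso R Y X" using assms(3,4) by (auto simp: lmod_iso_def)
  then have Y: "fg_module R Y"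
    using fg_module_iso[OF syzygy_module_fg[OF assms(1)] assms(2)] lmod_iso_sym[OF assms(2) X] by blast
  have im: "b ` carrier Y = carrier X" by (rule bij_betw_imp_surj_on[OF assms(4)])
  have "\<exists>(P :: nat \<Rightarrow> ('a, 'a fg_elem) module) \<delta> \<iota>.
        (\<forall>i<d. fg_projective R (P i)) \<and>
        (\<forall>i. Suc i < d \<longrightarrow> \<delta> i \<in> lmod_hom R (P (Suc i)) (P i)) \<and>
        (\<forall>i. Suc (Suc i) < d \<longrightarrow>
          \<delta> (Suc i) ` carrier (P (Suc (Suc i))) = a_kernel (P (Suc i)) (P i) (\<delta> i)) \<and>
        \<iota> \<in> lmod_hom R Y (P (d - 1)) \<and> inj_on \<iota> (carrier Y) \<and>
        (d \<ge> 2 \<longrightarrow> \<iota> ` carrier Y = a_kernel (P (d - 1)) (P (d - 2)) (\<delta> (d - 2)))" if d: "d > 0"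
  proof -
    obtain P :: "nat \<Rightarrow> ('a, 'a fg_elem) module" and \<delta> \<iota> where
      P: "\<forall>i<d. fg_projective R (P i)" "\<forall>i. Suc i < d \<longrightarrow> \<delta> i \<in> lmod_hom R (P (Suc i)) (P i)"
        "\<forall>i. Suc (Suc i) < d \<longrightarrow> \<delta> (Suc i) ` carrier (P (Suc (Suc i))) = a_kernel (P (Suc i)) (P i) (\<delta> i)"
      and \<iota>: "\<iota> \<in> lmod_hom R X (P (d - 1))" "inj_on \<iota> (carrier X)"
        "d \<ge> 2 \<longrightarrow> \<iota> ` carrier X = a_kernel (P (d - 1)) (P (d - 2)) (\<delta> (d - 2))"
      using that mp[OF conjunct2[OF assms(1)[unfolded syzygy_module_def]] d] by (elim exE conjE)
    have "inj_on (\<lambda>x. \<iota> (b x)) (carrier Y)"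
      using comp_inj_on[OF bij_betw_imp_inj_on[OF assms(4)]] \<iota>(2) im by (simp add: comp_def)
    moreover have "(\<lambda>x. \<iota> (b x)) ` carrier Y = \<iota> ` b ` carrier Y" by (simp add: image_image)
    then have "d \<ge> 2 \<longrightarrow> (\<lambda>x. \<iota> (b x)) ` carrier Y = a_kernel (P (d - 1)) (P (d - 2)) (\<delta> (d - 2))"
      by (simp add: im \<iota>(3))
    ultimately show ?thesis
      using hom_compose[OF \<iota>(1) assms(3)]
      by (intro exI[of _ P] exI[of _ \<delta>] exI[of _ "\<lambda>x. \<iota> (b x)"] conjI P)
  qed
  then show ?thesis using Y by (simp add: syzygy_module_def)
qed

subsection \<open>Consequences of the vanishing of Ext\<close>

text \<open>Dimension shifting gives Ext^1(B, R) = Ext^(d+1)(X, R) = 0, and Ext^1(B, R) is the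
  obstruction to extending maps from \<open>B'\<close> to \<open>F\<close>. The resolution of
  \<open>X\<close> is chosen with \<open>F\<close> at place \<open>d\<close> and a resolution of
  \<open>B'\<close> behind it, so that an extension can be read off from the cochains.\<close>

lemma Ext_trivial_extends:
  fixes F :: "('r, 'r fg_elem) module"
  assumes noeth: "left_noetherian R" and X: "fg_module R X"
    and triv: "carrier (Ext_ring R (Suc d) X) = {\<zero>\<^bsub>Ext_ring R (Suc d) X\<^esub>}"
    and syz: "is_syzygy R d X B" and F: "fg_projective R F" and B': "left_module R B'"
    and se: "short_exact R B' j F p B" and \<psi>: "\<psi> \<in> lmod_hom R B' (regular_module R)"
  shows "\<exists>\<chi>\<in>lmod_hom R F (regular_module R). \<forall>b\<in>carrier B'. \<chi> (j b) = \<psi> b"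
proof -
  have B: "left_module R B" by (rule is_syzygy_left_module[OF syz])
  have Xl: "left_module R X" by (rule fg_module_left_module[OF X])
  note reg = left_module_regular[OF left_noetherian_ring[OF noeth]]
  have "fg_module R B'" by (rule short_exact_fg[OF noeth fg_projective_fg[OF F] B' B se])
  then obtain P' :: "nat \<Rightarrow> ('r, 'r fg_elem) module" and \<delta>' \<epsilon>' where res': "projective_resolution R B' P' \<delta>' \<epsilon>'"
    using projective_resolution_exists[OF noeth] by metis
  obtain P \<delta> \<epsilon> where res: "projective_resolution R X P \<delta> \<epsilon>"
    "\<forall>i. P (d + i) = case_nat F P' i" "\<forall>i. \<delta> (d + i) = case_nat (\<lambda>x. j (\<epsilon>' x)) \<delta>' i"
    by (rule is_syzygy_splice[OF Xl syz projective_resolution_prepend[OF B' res' F B se]])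
  have P: "P d = F" "P (Suc d) = P' 0" "P (Suc (Suc d)) = P' (Suc 0)"
    using spec[OF res(2), of 0] spec[OF res(2), of 1] spec[OF res(2), of 2] by (simp_all add: numeral_2_eq_2)
  have \<delta>: "\<delta> d = (\<lambda>x. j (\<epsilon>' x))" "\<delta> (Suc d) = \<delta>' 0"
    using spec[OF res(3), of 0] spec[OF res(3), of 1] by simp_all
  have "carrier (dual_cohomology R P \<delta> (Suc d)) = {\<zero>\<^bsub>dual_cohomology R P \<delta> (Suc d)\<^esub>}"
    by (rule iso_trivial[OF left_module_Ext_ring[OF noeth X] left_module_cohomology[OF Xl res(1)]
          Ext_ring_iso[OF noeth X Xl lmod_iso_refl res(1)] triv])
  then have triv': "carrier (cocycles R P \<delta> (Suc d)) = coboundaries R P \<delta> (Suc d)"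
    by (rule cohomology_trivialD[OF Xl res(1)])
  note e = resolution_epi[OF B' res']
  \<comment> \<open>\<psi> pulled back along the augmentation of \<open>B'\<close> is a cocycle in
    degree d + 1. A cochain on \<open>F\<close> with this coboundary extends \<psi>, because the
    augmentation is onto \<open>B'\<close>.\<close>
  let ?c = "\<lambda>x\<in>carrier (P (Suc d)). \<psi> (\<epsilon>' x)"
  have "?c \<in> carrier (dual R (P (Suc d)))"
    unfolding P by (rule dual_memI[OF resolution_left_module[OF B' res'] hom_compose[OF \<psi> epi_hom[OF e]]])
  moreover have "?c (\<delta> (Suc d) x) = \<zero>\<^bsub>R\<^esub>" if "x \<in> carrier (P (Suc (Suc d)))" for x
    using that hom_closed[OF resolution_hom[OF B' res', of 0]] resolution_complex_0[OF B' res']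
      hom_zero[OF B' reg \<psi>] by (simp add: P \<delta>)
  ultimately have "?c \<in> coboundaries R P \<delta> (Suc d)"
    unfolding triv'[symmetric] mem_cocycles by blast
  then obtain \<chi> where \<chi>: "\<chi> \<in> carrier (dual R F)" "?c = dual_map (P' 0) (\<lambda>x. j (\<epsilon>' x)) \<chi>"
    by (auto simp: coboundaries_def P \<delta> simp del: dual_sel)
  have "\<chi> (j b) = \<psi> b" if b: "b \<in> carrier B'" for b
  proof -
    obtain x where "x \<in> carrier (P' 0)" "\<epsilon>' x = b" using epi_obtain[OF e b] .
    then show ?thesis using fun_cong[OF \<chi>(2), of x] by (simp add: P dual_map_def)
  qed
  then show ?thesis using dual_hom[OF \<chi>(1)] by blast
qed

text \<open>Ext^0 is Hom: pulled back along the augmentation, \<psi> is a cocycle in degree 0, where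
  the only coboundary is zero, and the augmentation is onto \<open>X\<close>.\<close>

lemma grade_ge_hom_zero:
  assumes noeth: "left_noetherian R" and X: "fg_module R X" and grade: "grade_ge R X (Suc i)"
    and \<psi>: "\<psi> \<in> lmod_hom R X (regular_module R)" and x: "x \<in> carrier X"
  shows "\<psi> x = \<zero>\<^bsub>R\<^esub>"
proof -
  have Xl: "left_module R X" by (rule fg_module_left_module[OF X])
  note reg = left_module_regular[OF left_noetherian_ring[OF noeth]]
  obtain P \<delta> \<epsilon> where P: "projective_resolution R X P \<delta> \<epsilon>" "\<And>i. Ext_ring R i X = dual_cohomology R P \<delta> i"
    using Ext_ring_resolution[OF noeth X] by metis
  have "carrier (dual_cohomology R P \<delta> 0) = {\<zero>\<^bsub>dual_cohomology R P \<delta> 0\<^esub>}"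
    using grade unfolding grade_ge_def P(2) by blast
  then have triv: "carrier (cocycles R P \<delta> 0) = coboundaries R P \<delta> 0"
    by (rule cohomology_trivialD[OF Xl P(1)])
  note e = resolution_epi[OF Xl P(1)]
  let ?c = "\<lambda>x\<in>carrier (P 0). \<psi> (\<epsilon> x)"
  have "?c \<in> carrier (dual R (P 0))"
    by (rule dual_memI[OF resolution_left_module[OF Xl P(1)] hom_compose[OF \<psi> epi_hom[OF e]]])
  moreover have "?c (\<delta> 0 x) = \<zero>\<^bsub>R\<^esub>" if "x \<in> carrier (P (Suc 0))" for x
    using that hom_closed[OF resolution_hom[OF Xl P(1), of 0]] resolution_complex_0[OF Xl P(1)]
      hom_zero[OF Xl reg \<psi>] by simp
  ultimately have "?c \<in> coboundaries R P \<delta> 0"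
    unfolding triv[symmetric] mem_cocycles by blast
  then have c: "?c = (\<lambda>x\<in>carrier (P 0). \<zero>\<^bsub>R\<^esub>)" by (simp add: coboundaries_def)
  obtain y where "y \<in> carrier (P 0)" "\<epsilon> y = x" using epi_obtain[OF e x] .
  then show ?thesis using fun_cong[OF c, of y] by simp
qed

subsection \<open>Projective dimension\<close>

lemma pd_leI:
  fixes P :: "nat \<Rightarrow> ('r, 'r fg_elem) module"
  assumes "projective_resolution R X P \<delta> \<epsilon>" "\<forall>i. int i > n \<longrightarrow> carrier (P i) = {\<zero>\<^bsub>P i\<^esub>}"
  shows "pd_le R X n"
  unfolding pd_le_def by (rule exI[of _ P], rule exI[of _ \<delta>], rule exI[of _ \<epsilon>], rule conjI[OF assms])

lemma pd_leE:
  fixes R :: "('r, 'z) ring_scheme"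
  assumes "pd_le R X n"
  obtains P :: "nat \<Rightarrow> ('r, 'r fg_elem) module" and \<delta> \<epsilon> where
    "projective_resolution R X P \<delta> \<epsilon>" "\<forall>i. int i > n \<longrightarrow> carrier (P i) = {\<zero>\<^bsub>P i\<^esub>}"
  using that assms unfolding pd_le_def by (elim exE conjE)

lemma pd_le_iso:
  assumes "left_module R X" "left_module R Y" "lmod_iso R X Y" "pd_le R X n" shows "pd_le R Y n"
proof -
  obtain \<theta> where \<theta>: "\<theta> \<in> lmod_hom R X Y" "bij_betw \<theta> (carrier X) (carrier Y)"
    using assms(3) by (auto simp: lmod_iso_def)
  obtain P :: "nat \<Rightarrow> ('a, 'a fg_elem) module" and \<delta> \<epsilon> where P: "projective_resolution R X P \<delta> \<epsilon>"
    "\<forall>i. int i > n \<longrightarrow> carrier (P i) = {\<zero>\<^bsub>P i\<^esub>}"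
    by (rule pd_leE[OF assms(4)])
  show ?thesis
    by (rule pd_leI[OF projective_resolution_target_iso[OF assms(1,2) P(1) \<theta>] P(2)])
qed

text \<open>The zero module in every place resolves \<open>X\<close>, so the bound holds for every
  integer; the first link of the chain takes \<open>n = - 1\<close>.\<close>

lemma pd_le_trivial:
  assumes X: "left_module R X" and triv: "carrier X = {\<zero>\<^bsub>X\<^esub>}" shows "pd_le R X n"
proof -
  obtain Z :: "('a, 'a fg_elem) module" and f g where Z: "fg_projective R Z"
    "f \<in> lmod_hom R X Z" "g \<in> lmod_hom R Z X" "\<forall>x\<in>carrier X. g (f x) = x" "\<forall>y\<in>carrier Z. f (g y) = y"
    by (rule fg_projective_copy[OF fg_projective_trivial[OF assms]])
  have Zl: "left_module R Z" by (rule fg_projective_left_module[OF Z(1)])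
  interpret Z: left_module R Z by (rule Zl)
  have Z0: "carrier Z = {\<zero>\<^bsub>Z\<^esub>}"
    by (rule iso_trivial[OF X Zl _ triv]) (use Z(2-5) in \<open>auto intro: lmod_isoI\<close>)
  have e: "g \<in> lmod_epi R Z X"
  proof (rule epiI[OF Z(3)])
    fix y assume "y \<in> carrier X"
    then show "\<exists>x\<in>carrier Z. g x = y" using Z(4) hom_closed[OF Z(2)] by (intro bexI[of _ "f y"]) simp_all
  qed
  have "out_kernel X (\<lambda>_. Z) (\<lambda>_ x. x) g i = {\<zero>\<^bsub>Z\<^esub>}" for i
    unfolding out_kernel_def
    by (cases i) (auto simp: a_kernel_def' Z0 hom_zero[OF Zl X Z(3)])
  then have "projective_resolution R X (\<lambda>_. Z) (\<lambda>_ x. x) g"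
    unfolding projective_resolution_iff using Z(1) e by (simp add: Z0 hom_id)
  then show ?thesis by (rule pd_leI) (simp add: Z0)
qed

text \<open>All places move up by one and \<open>F\<close> takes place 0; \<open>n \<ge> - 1\<close>
  says that place 0 is within the new bound.\<close>

lemma pd_le_prepend:
  assumes X': "left_module R X'" and X: "left_module R X" and F: "fg_projective R F"
    and se: "short_exact R X' j F p X" and pd: "pd_le R X' n" and n: "n \<ge> - 1"
  shows "pd_le R X (n + 1)"
proof -
  obtain F' :: "('a, 'a fg_elem) module" and a b where F': "fg_projective R F'"
    "a \<in> lmod_hom R F F'" "b \<in> lmod_hom R F' F"
    "\<forall>x\<in>carrier F. b (a x) = x" "\<forall>y\<in>carrier F'. a (b y) = y"
    by (rule fg_projective_copy[OF F])
  obtain P :: "nat \<Rightarrow> ('a, 'a fg_elem) module" and \<delta> \<epsilon> where P: "projective_resolution R X' P \<delta> \<epsilon>"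
    "\<forall>i. int i > n \<longrightarrow> carrier (P i) = {\<zero>\<^bsub>P i\<^esub>}"
    by (rule pd_leE[OF pd])
  have "short_exact R X' (\<lambda>x. a (j x)) F' (\<lambda>x. p (b x)) X"
    using short_exact_transport[OF se X' fg_projective_left_module[OF F] X
        hom_id hom_id _ _ F'(2-5) hom_id hom_id _ _ X] by simp
  from projective_resolution_prepend[OF X' P(1) F'(1) X this]
  have "projective_resolution R X (case_nat F' P) (case_nat (\<lambda>x. a (j (\<epsilon> x))) \<delta>) (\<lambda>x. p (b x))" .
  moreover have "\<forall>i. int i > n + 1 \<longrightarrow> carrier (case_nat F' P i) = {\<zero>\<^bsub>case_nat F' P i\<^esub>}"
    using P(2) n by (auto split: nat.splits)
  ultimately show ?thesis by (rule pd_leI)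
qed

subsection \<open>The approximation chain\<close>

lemma dual_iso:
  assumes "left_module R M" "left_module R N" "f \<in> lmod_hom R M N" "g \<in> lmod_hom R N M"
    "\<forall>x\<in>carrier M. g (f x) = x" "\<forall>y\<in>carrier N. f (g y) = y"
  shows "lmod_iso (opp R) (dual R M) (dual R N)"
  by (rule lmod_isoI[OF dual_map_hom[OF assms(2,4)] dual_map_hom[OF assms(1,3)]])
    (rule dual_map_retract[where g = g, OF assms(3,5)] dual_map_retract[where g = f, OF assms(4,6)]; assumption)+

text \<open>One link of the chain together with what is claimed about it; \<open>E\<close> is the
  module of which \<open>B\<close> is a syzygy. \<open>B\<close> comes with an embedding instead of
  being the kernel itself, so that it can be exchanged for a copy. Dual exactness takes the form of
  extending functionals, as this is how it arises and it transports along isomorphisms by mere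
  composition.\<close>

definition approximation_step ::
    "('r, 'z) ring_scheme \<Rightarrow> nat \<Rightarrow> ('r, 'e) module \<Rightarrow> ('r, 'b) module \<Rightarrow> ('b \<Rightarrow> 'm) \<Rightarrow>
      ('r, 'm) module \<Rightarrow> ('m \<Rightarrow> 'n) \<Rightarrow> ('r, 'n) module \<Rightarrow> bool"
  where "approximation_step R d E B j M f N \<longleftrightarrow>
    short_exact R B j M f N \<and> is_syzygy R d E B \<and> pd_le (opp R) (dual R B) (int d - 1) \<and>
    (\<forall>\<psi>\<in>lmod_hom R B (regular_module R). \<exists>\<chi>\<in>lmod_hom R M (regular_module R). \<forall>b\<in>carrier B. \<chi> (j b) = \<psi> b)"

lemma approximation_stepD:
  assumes "approximation_step R d E B j M f N"
  shows "short_exact R B j M f N" "is_syzygy R d E B" "pd_le (opp R) (dual R B) (int d - 1)"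
    "\<And>\<psi>. \<psi> \<in> lmod_hom R B (regular_module R) \<Longrightarrow>
      \<exists>\<chi>\<in>lmod_hom R M (regular_module R). \<forall>b\<in>carrier B. \<chi> (j b) = \<psi> b"
  using assms by (simp_all add: approximation_step_def)

lemma approximation_step_transport:
  assumes ok: "approximation_step R d E B j M f N"
    and mods: "left_module R M" "left_module R N" "left_module R B'" "left_module R N'"
    and isos: "iso_pair R B B' b b'" "iso_pair R M M' m m'" "iso_pair R N N' n n'"
  shows "approximation_step R d E B' (\<lambda>x. m (j (b' x))) M' (\<lambda>x. n (f (m' x))) N'"
proof -
  note D = approximation_stepD[OF ok]
  note b = iso_pairD[OF isos(1)] and m = iso_pairD[OF isos(2)] and n = iso_pairD[OF isos(3)]
  have B: "left_module R B" by (rule is_syzygy_left_module[OF D(2)])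
  note bij = iso_pair_bij[OF iso_pair_sym[OF isos(1)]]
  have "\<exists>\<chi>\<in>lmod_hom R M' (regular_module R). \<forall>x\<in>carrier B'. \<chi> (m (j (b' x))) = \<psi> x"
    if \<psi>: "\<psi> \<in> lmod_hom R B' (regular_module R)" for \<psi>
  proof -
    obtain \<chi> where \<chi>: "\<chi> \<in> lmod_hom R M (regular_module R)" "\<forall>x\<in>carrier B. \<chi> (j x) = \<psi> (b x)"
      using D(4)[OF hom_compose[OF \<psi> b(1)]] by (elim bexE)
    have "\<chi> (m' (m (j (b' x)))) = \<psi> x" if x: "x \<in> carrier B'" for x
      using hom_closed[OF b(2) x] hom_closed[OF short_exactD(1)[OF D(1)]] m(3) \<chi>(2) b(4) x by simp
    then show ?thesis by (intro bexI[OF _ hom_compose[OF \<chi>(1) m(2)]] ballI)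
  qed
  moreover have "pd_le (opp R) (dual R B') (int d - 1)"
    by (rule pd_le_iso[OF left_module_dual[OF B] left_module_dual[OF mods(3)] dual_iso[OF B mods(3) b] D(3)])
  ultimately show ?thesis
    unfolding approximation_step_def
    using short_exact_transport[OF D(1) B mods(1,2) b m n mods(4)] is_syzygy_source_iso[OF mods(3) b(2) bij D(2)]
    by (intro conjI ballI)
qed

text \<open>In the use made of it, \<open>i\<close> is \<open>u\<close> regarded as a map onto its
  image, so the link divides out Ker u. Grade at least 1 makes the dual of this kernel zero: the
  bound -1 holds, and the only functional to be extended is zero.\<close>

lemma approximation_step_first:
  assumes noeth: "left_noetherian R" and C: "fg_module R C" and G: "left_module R G"
    and u: "u \<in> lmod_hom R C G" and grade: "grade_ge R (kernel_module C G u) (Suc 0)"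
    and K: "left_module R K" and i: "i \<in> lmod_epi R C K" "a_kernel C K i = a_kernel C G u"
    and T: "left_module R T"
  shows "approximation_step R 0 (kernel_module C G u) (kernel_module C G u) (\<lambda>x. (x, \<zero>\<^bsub>T\<^esub>))
    (direct_sum C T) (\<lambda>x. (i (fst x), snd x)) (direct_sum K T)"
proof -
  let ?E = "kernel_module C G u"
  have Cl: "left_module R C" by (rule fg_module_left_module[OF C])
  have E: "fg_module R ?E" by (rule fg_module_kernel[OF noeth C G u])
  have El: "left_module R ?E" by (rule fg_module_left_module[OF E])
  note reg = left_module_regular[OF left_noetherian_ring[OF noeth]]
  note zero = grade_ge_hom_zero[OF noeth E grade]
  interpret C: left_module R C by (rule Cl)
  have ih: "i \<in> lmod_hom R C K" by (rule epi_hom[OF i(1)])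
  have "(\<lambda>x. x) \<in> lmod_hom R ?E C"
    unfolding kernel_module_def by (rule hom_inclusion) (auto simp: mem_a_kernel)
  then have j: "(\<lambda>x. (x, \<zero>\<^bsub>T\<^esub>)) \<in> lmod_hom R ?E (direct_sum C T)"
    using hom_compose[OF hom_inl[OF T]] by fast
  have f: "(\<lambda>x. (i (fst x), snd x)) \<in> lmod_hom R (direct_sum C T) (direct_sum K T)"
    by (rule hom_pair[OF hom_compose[OF ih hom_fst] hom_snd])
  have "short_exact R ?E (\<lambda>x. (x, \<zero>\<^bsub>T\<^esub>)) (direct_sum C T) (\<lambda>x. (i (fst x), snd x)) (direct_sum K T)"
  proof (rule short_exactI[OF j])
    show "inj_on (\<lambda>x. (x, \<zero>\<^bsub>T\<^esub>)) (carrier ?E)" by (auto intro: inj_onI)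
    show "(\<lambda>x. (i (fst x), snd x)) \<in> lmod_epi R (direct_sum C T) (direct_sum K T)"
    proof (rule epiI[OF f])
      fix y assume y: "y \<in> carrier (direct_sum K T)"
      then have "fst y \<in> carrier K" by auto
      then obtain x where "x \<in> carrier C" "i x = fst y" by (rule epi_obtain[OF i(1)])
      then show "\<exists>x\<in>carrier (direct_sum C T). (i (fst x), snd x) = y"
        using y by (intro bexI[of _ "(x, snd y)"]) auto
    qed
    show "(i (fst (a, \<zero>\<^bsub>T\<^esub>)), snd (a, \<zero>\<^bsub>T\<^esub>)) = \<zero>\<^bsub>direct_sum K T\<^esub>" if "a \<in> carrier ?E" for a
      using that unfolding kernel_module_sel i(2)[symmetric] by (simp add: mem_a_kernel)
    show "\<exists>a\<in>carrier ?E. (a, \<zero>\<^bsub>T\<^esub>) = b"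
      if "b \<in> carrier (direct_sum C T)" "(i (fst b), snd b) = \<zero>\<^bsub>direct_sum K T\<^esub>" for b
      using that unfolding kernel_module_sel i(2)[symmetric]
      by (intro bexI[of _ "fst b"]) (auto simp: mem_a_kernel)
  qed
  moreover have "is_syzygy R 0 ?E ?E" using El by (simp add: is_syzygy_def lmod_iso_refl)
  moreover have "carrier (dual R ?E) = {\<zero>\<^bsub>dual R ?E\<^esub>}"
  proof -
    have z: "\<zero>\<^bsub>dual R ?E\<^esub> \<in> carrier (dual R ?E)"
      using dual_memI[OF El hom_zero_map[OF reg]] by simp
    have "\<phi> = \<zero>\<^bsub>dual R ?E\<^esub>" if "\<phi> \<in> carrier (dual R ?E)" for \<phi>
      by (rule dual_ext[OF that z]) (use zero[OF dual_hom[OF that]] in simp)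
    then show ?thesis using z by blast
  qed
  then have "pd_le (opp R) (dual R ?E) (int 0 - 1)" by (rule pd_le_trivial[OF left_module_dual[OF El]])
  moreover have "\<exists>\<chi>\<in>lmod_hom R (direct_sum C T) (regular_module R). \<forall>b\<in>carrier ?E. \<chi> (b, \<zero>\<^bsub>T\<^esub>) = \<psi> b"
    if "\<psi> \<in> lmod_hom R ?E (regular_module R)" for \<psi>
    by (rule bexI[OF _ hom_zero_map[OF reg]]) (simp add: zero[OF that] del: kernel_module_sel)
  ultimately show ?thesis unfolding approximation_step_def by blast
qed

text \<open>The syzygy \<open>B\<close> of \<open>B'\<close> is the kernel of \<open>F \<rightarrow> B'\<close>; the summand \<open>F\<close> of \<open>T\<close> is used up to
  enlarge \<open>Ker g\<close> by a lift of \<open>B'\<close>. Maps into \<open>R\<close> extend from \<open>B\<close> to \<open>F\<close> since \<open>Ext\<^sup>1(B', R) = 0\<close>.\<close>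

lemma approximation_step_next:
  fixes F :: "('r, 'r fg_elem) module"
  assumes noeth: "left_noetherian R" and E: "fg_module R E"
    and triv: "carrier (Ext_ring R (Suc d) E) = {\<zero>\<^bsub>Ext_ring R (Suc d) E\<^esub>}"
    and ok: "approximation_step R d E B' j' M' f' N'" and M': "left_module R M'" and N': "left_module R N'"
    and H: "left_module R H" and g: "g \<in> lmod_epi R H M'"
    and F: "fg_projective R F" and q: "q \<in> lmod_epi R F B'"
    and T: "left_module R T" and T1: "left_module R T1"
    and e: "e \<in> lmod_hom R T (direct_sum F T1)" "e' \<in> lmod_hom R (direct_sum F T1) T"
      "\<forall>t\<in>carrier T. e' (e t) = t" "\<forall>y\<in>carrier (direct_sum F T1). e (e' y) = y"
  shows "\<exists>j f. approximation_step R (Suc d) E (kernel_module F B' q) j (direct_sum (kernel_module H M' g) T) f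
    (direct_sum (kernel_module H N' (\<lambda>x. f' (g x))) T1)"
proof -
  note D = approximation_stepD[OF ok]
  note S = short_exactD[OF D(1)]
  let ?B = "kernel_module F B' q" and ?K = "kernel_module H M' g" and ?K1 = "kernel_module H N' (\<lambda>x. f' (g x))"
  have B': "left_module R B'" by (rule is_syzygy_left_module[OF D(2)])
  have Fl: "left_module R F" by (rule fg_projective_left_module[OF F])
  have qh: "q \<in> lmod_hom R F B'" and gh: "g \<in> lmod_hom R H M'" and fh: "f' \<in> lmod_hom R M' N'"
    using q g S(4) by (auto intro: epi_hom)
  have B: "left_module R ?B" by (rule left_module_kernel[OF Fl B' qh])
  interpret F: left_module R F by (rule Fl)
  interpret H: left_module R H by (rule H)
  interpret M': left_module R M' by (rule M')
  interpret B': left_module R B' by (rule B')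
  interpret N': left_module R N' by (rule N')
  interpret T1: left_module R T1 by (rule T1)
  \<comment> \<open>\<open>l\<close> lifts F -> B' -> M' through \<open>g\<close>. The elements
    \<open>l x\<close> enlarge Ker g to the kernel of H -> N', since \<open>g\<close> maps the
    latter into the image of \<open>B'\<close>.\<close>
  obtain l where l: "l \<in> lmod_hom R F H" "\<forall>x\<in>carrier F. g (l x) = j' (q x)"
    by (rule fg_projective_lift_epi[OF F H M' g hom_compose[OF S(1) qh]])
  note lc = hom_closed[OF l(1)] and gc = hom_closed[OF gh] and jc = hom_closed[OF S(1)] and qc = hom_closed[OF qh]
  have K_H: "(\<lambda>x. x) \<in> lmod_hom R ?K H"
    unfolding kernel_module_def by (rule hom_inclusion) (auto simp: mem_a_kernel)
  have B_F: "(\<lambda>x. x) \<in> lmod_hom R ?B F"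
    unfolding kernel_module_def by (rule hom_inclusion) (auto simp: mem_a_kernel)
  let ?y = "\<lambda>x. fst (e (snd x))"
  define f where "f = (\<lambda>x. (fst x \<oplus>\<^bsub>H\<^esub> l (?y x), snd (e (snd x))))"
  \<comment> \<open>For \<open>x\<close> in Ker q the lift \<open>l x\<close> already lies in Ker g.
    The sign lets its two contributions cancel under \<open>f\<close>.\<close>
  define j where "j = (\<lambda>x. (\<zero>\<^bsub>H\<^esub> \<ominus>\<^bsub>H\<^esub> l x, e' (x, \<zero>\<^bsub>T1\<^esub>)))"
  have ec: "fst (e t) \<in> carrier F" "snd (e t) \<in> carrier T1" if "t \<in> carrier T" for t
    using hom_closed[OF e(1) that] by auto
  have ee': "e (e' (x, y)) = (x, y)" if "x \<in> carrier F" "y \<in> carrier T1" for x y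
    using e(4) that by simp
  have e'c: "e' (x, y) \<in> carrier T" if "x \<in> carrier F" "y \<in> carrier T1" for x y
    using hom_closed[OF e(2), of "(x, y)"] that by simp
  have fj: "f' (j' b) = \<zero>\<^bsub>N'\<^esub>" if "b \<in> carrier B'" for b
    by (rule short_exact_comp_zero[OF D(1) that])
  have yh: "?y \<in> lmod_hom R (direct_sum ?K T) F"
    by (rule hom_compose[OF hom_compose[OF hom_fst e(1)] hom_snd])
  have "(\<lambda>x. fst x \<oplus>\<^bsub>H\<^esub> l (?y x)) \<in> lmod_hom R (direct_sum ?K T) H"
    by (rule hom_add_maps[OF H hom_compose[OF K_H hom_fst] hom_compose[OF l(1) yh]])
  moreover have "f' (g (k \<oplus>\<^bsub>H\<^esub> l x)) = \<zero>\<^bsub>N'\<^esub>" if "k \<in> carrier ?K" "x \<in> carrier F" for k x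
    using that by (simp add: mem_a_kernel hom_add[OF gh] lc l(2) jc qc fj)
  ultimately have "(\<lambda>x. fst x \<oplus>\<^bsub>H\<^esub> l (?y x)) \<in> lmod_hom R (direct_sum ?K T) ?K1"
    unfolding kernel_module_def[of H N']
    by (intro hom_restrict_codomain) (auto simp: mem_a_kernel ec lc)
  then have f: "f \<in> lmod_hom R (direct_sum ?K T) (direct_sum ?K1 T1)"
    unfolding f_def by (rule hom_pair[OF _ hom_compose[OF hom_compose[OF hom_snd e(1)] hom_snd]])
  have "(\<lambda>x. \<zero>\<^bsub>H\<^esub> \<ominus>\<^bsub>H\<^esub> l x) \<in> lmod_hom R ?B H"
    by (rule hom_minus_maps[OF H hom_zero_map[OF H] hom_compose[OF l(1) B_F]])
  moreover have gj: "g (\<zero>\<^bsub>H\<^esub> \<ominus>\<^bsub>H\<^esub> l x) = \<zero>\<^bsub>M'\<^esub>" if "x \<in> carrier ?B" for x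
    using that hom_zero[OF B' M' S(1)] M'.minus_eq_zero_iff[of "\<zero>\<^bsub>M'\<^esub>" "\<zero>\<^bsub>M'\<^esub>"]
    by (simp add: mem_a_kernel hom_minus[OF H M' gh] lc l(2) hom_zero[OF H M' gh])
  ultimately have "(\<lambda>x. \<zero>\<^bsub>H\<^esub> \<ominus>\<^bsub>H\<^esub> l x) \<in> lmod_hom R ?B ?K"
    unfolding kernel_module_def[of H M'] by (intro hom_restrict_codomain) (auto simp: mem_a_kernel lc)
  then have j: "j \<in> lmod_hom R ?B (direct_sum ?K T)"
    unfolding j_def by (rule hom_pair[OF _ hom_compose[OF hom_compose[OF e(2) hom_inl[OF T1]] B_F]])
  have se: "short_exact R ?B j (direct_sum ?K T) f (direct_sum ?K1 T1)"
  proof (rule short_exactI[OF j])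
    show "inj_on j (carrier ?B)"
    proof (rule inj_onI)
      fix x y assume xy: "x \<in> carrier ?B" "y \<in> carrier ?B" "j x = j y"
      then have "e (e' (x, \<zero>\<^bsub>T1\<^esub>)) = e (e' (y, \<zero>\<^bsub>T1\<^esub>))" by (simp add: j_def)
      then show "x = y" using xy by (simp add: ee' mem_a_kernel)
    qed
    show "f \<in> lmod_epi R (direct_sum ?K T) (direct_sum ?K1 T1)"
    proof (rule epiI[OF f])
      fix z assume "z \<in> carrier (direct_sum ?K1 T1)"
      then obtain k1 t1 where z: "z = (k1, t1)" "k1 \<in> carrier H" "f' (g k1) = \<zero>\<^bsub>N'\<^esub>" "t1 \<in> carrier T1"
        by (auto simp: mem_a_kernel)
      \<comment> \<open>\<open>g k1\<close> comes from \<open>B'\<close>; subtracting the lift of a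
        preimage in \<open>F\<close> moves \<open>k1\<close> into Ker g.\<close>
      obtain b where b: "b \<in> carrier B'" "j' b = g k1" using short_exact_lift[OF D(1) gc[OF z(2)] z(3)] .
      obtain x where x: "x \<in> carrier F" "q x = b" using epi_obtain[OF q b(1)] .
      have "g (k1 \<ominus>\<^bsub>H\<^esub> l x) = \<zero>\<^bsub>M'\<^esub>"
        using z x b M'.minus_eq_zero_iff[of "g k1" "g k1"] gc
        by (simp add: hom_minus[OF H M' gh] lc l(2))
      moreover have "(k1 \<ominus>\<^bsub>H\<^esub> l x) \<oplus>\<^bsub>H\<^esub> l x = k1" using z x by (simp add: H.minus_add_cancel lc)
      ultimately show "\<exists>w\<in>carrier (direct_sum ?K T). f w = z"
        using z x by (intro bexI[of _ "(k1 \<ominus>\<^bsub>H\<^esub> l x, e' (x, t1))"]) (auto simp: f_def ee' e'c mem_a_kernel lc)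
    qed
    show "f (j x) = \<zero>\<^bsub>direct_sum ?K1 T1\<^esub>" if "x \<in> carrier ?B" for x
      using that by (simp add: f_def j_def ee' mem_a_kernel H.minus_add_cancel lc)
    show "\<exists>x\<in>carrier ?B. j x = w" if w: "w \<in> carrier (direct_sum ?K T)" "f w = \<zero>\<^bsub>direct_sum ?K1 T1\<^esub>" for w
    proof -
      obtain k t where kt: "w = (k, t)" "k \<in> carrier H" "g k = \<zero>\<^bsub>M'\<^esub>" "t \<in> carrier T"
        using w(1) by (auto simp: mem_a_kernel)
      obtain x y where xy: "e t = (x, y)" by (cases "e t")
      have x: "x \<in> carrier F" using ec(1)[OF kt(4)] xy by simp
      have 0: "k \<oplus>\<^bsub>H\<^esub> l x = \<zero>\<^bsub>H\<^esub>" "y = \<zero>\<^bsub>T1\<^esub>" using w(2) kt(1) xy by (simp_all add: f_def)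
      have "g k \<oplus>\<^bsub>M'\<^esub> g (l x) = \<zero>\<^bsub>M'\<^esub>"
        using hom_add[OF gh kt(2) lc[OF x]] hom_zero[OF H M' gh] 0(1) by simp
      then have "j' (q x) = j' \<zero>\<^bsub>B'\<^esub>" using kt(3) l(2) x jc[OF qc[OF x]] hom_zero[OF B' M' S(1)] by simp
      then have "q x = \<zero>\<^bsub>B'\<^esub>" using inj_onD[OF S(2)] qc[OF x] by simp
      moreover have "\<zero>\<^bsub>H\<^esub> \<ominus>\<^bsub>H\<^esub> l x = k" using H.add_minus_cancel[OF kt(2) lc[OF x]] 0(1) by simp
      moreover have "e' (x, \<zero>\<^bsub>T1\<^esub>) = t" using e(3) kt(4) xy 0(2) by metis
      ultimately show ?thesis using x kt(1) by (intro bexI[of _ x]) (simp_all add: j_def mem_a_kernel)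
    qed
  qed
  note seF = short_exact_kernel[OF q]
  have syz: "is_syzygy R (Suc d) E ?B"
    by (rule is_syzygy_Suc[OF fg_module_left_module[OF E] D(2) F B seF])
  have ext: "\<exists>\<chi>\<in>lmod_hom R F (regular_module R). \<forall>b\<in>carrier ?B. \<chi> b = \<psi> b"
    if "\<psi> \<in> lmod_hom R ?B (regular_module R)" for \<psi>
    by (rule Ext_trivial_extends[OF noeth E triv D(2) F B seF that])
  \<comment> \<open>After dualizing, the projective dual of \<open>F\<close> maps onto the dual of
    \<open>?B\<close> with the dual of \<open>B'\<close> as kernel, so the bound for
    \<open>B'\<close> rises by one.\<close>
  have "short_exact (opp R) (dual R B') (dual_map F q) (dual R F) (dual_map ?B (\<lambda>x. x)) (dual R ?B)"
    by (rule short_exact_dual[OF B Fl B' seF ext])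
  from pd_le_prepend[OF left_module_dual[OF B'] left_module_dual[OF B] fg_projective_dual[OF F] this D(3)]
  have pd: "pd_le (opp R) (dual R ?B) (int (Suc d) - 1)" by simp
  have "\<exists>\<chi>\<in>lmod_hom R (direct_sum ?K T) (regular_module R). \<forall>b\<in>carrier ?B. \<chi> (j b) = \<psi> b"
    if \<psi>: "\<psi> \<in> lmod_hom R ?B (regular_module R)" for \<psi>
  proof -
    obtain \<chi> where \<chi>: "\<chi> \<in> lmod_hom R F (regular_module R)" "\<forall>b\<in>carrier ?B. \<chi> b = \<psi> b"
      using ext[OF \<psi>] by (elim bexE)
    \<comment> \<open>The component of \<open>j b\<close> in \<open>F\<close> is \<open>b\<close>
      itself, so an extension to \<open>F\<close> becomes one to the whole sum by
      projecting.\<close>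
    have "\<chi> (?y (j b)) = \<psi> b" if "b \<in> carrier ?B" for b
      using that \<chi>(2) by (simp add: j_def ee' mem_a_kernel)
    then show ?thesis by (intro bexI[OF _ hom_compose[OF \<chi>(1) yh]] ballI)
  qed
  then have "approximation_step R (Suc d) E ?B j (direct_sum ?K T) f (direct_sum ?K1 T1)"
    unfolding approximation_step_def using se syz pd by blast
  then show ?thesis by blast
qed

text \<open>\<open>T i\<close> is built as a copy of the sum of F_i, ..., F_(n-1), with
  \<open>T n\<close> zero. Literal sums would have ever larger product types, hence the requirement
  up to isomorphism. The induction is over all families \<open>F\<close>, since a tail grows at its
  front.\<close>

lemma projective_tails:
  fixes F :: "nat \<Rightarrow> ('r, 'r fg_elem) module"
  assumes "ring R" "\<forall>i<n. fg_projective R (F i)"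
  shows "\<exists>T :: nat \<Rightarrow> ('r, 'r fg_elem) module. (\<forall>i\<le>n. fg_projective R (T i)) \<and>
    (\<forall>i<n. lmod_iso R (T i) (direct_sum (F i) (T (Suc i))))"
  using assms(2)
proof (induction n arbitrary: F)
  case 0
  obtain Z :: "('r, 'r fg_elem) module" and f g where "fg_projective R Z"
    "f \<in> lmod_hom R (free_module R 0) Z" "g \<in> lmod_hom R Z (free_module R 0)"
    "\<forall>x\<in>carrier (free_module R 0). g (f x) = x" "\<forall>y\<in>carrier Z. f (g y) = y"
    by (rule fg_projective_copy[OF fg_projective_free[OF assms(1), of 0]])
  then show ?case by (intro exI[of _ "\<lambda>_. Z"]) simp
next
  case (Suc n)
  obtain T :: "nat \<Rightarrow> ('r, 'r fg_elem) module" where T: "\<forall>i\<le>n. fg_projective R (T i)"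
    "\<forall>i<n. lmod_iso R (T i) (direct_sum (F (Suc i)) (T (Suc i)))"
    using Suc.IH[of "\<lambda>i. F (Suc i)"] Suc.prems by auto
  have S: "fg_projective R (direct_sum (F 0) (T 0))"
    using Suc.prems T(1) by (intro fg_projective_direct_sum) simp_all
  obtain Q :: "('r, 'r fg_elem) module" and f g where Q: "fg_projective R Q"
    "f \<in> lmod_hom R (direct_sum (F 0) (T 0)) Q" "g \<in> lmod_hom R Q (direct_sum (F 0) (T 0))"
    "\<forall>x\<in>carrier (direct_sum (F 0) (T 0)). g (f x) = x" "\<forall>y\<in>carrier Q. f (g y) = y"
    by (rule fg_projective_copy[OF S])
  have "lmod_iso R Q (direct_sum (F 0) (T 0))"
    by (rule lmod_isoI[OF Q(3,2)]) (use Q(4,5) in blast)+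
  then show ?case
    using T Q(1) by (intro exI[of _ "case_nat Q T"]) (auto split: nat.splits simp: less_Suc_eq_0_disj)
qed

lemma fg_module_iso_pair:
  fixes M :: "('r, 'm) module"
  assumes "fg_module R M"
  shows "\<exists>(N :: ('r, 'r fg_elem) module) f g. fg_module R N \<and> iso_pair R M N f g"
  by (rule fg_module_copy[OF assms]) (unfold iso_pair_def, intro exI conjI, assumption+)

lemma grade_ge_mono: "grade_ge R X i \<Longrightarrow> j \<le> i \<Longrightarrow> grade_ge R X j"
  by (simp add: grade_ge_def)

lemma approximation_step_left_module: "approximation_step R d E B j M f N \<Longrightarrow> left_module R B"
  by (rule is_syzygy_left_module[OF approximation_stepD(2)])

text \<open>Abstracting from D(M) makes the induction possible: dropping the first terms leaves data
  of the same kind. In the shifted data the module at place i is E_(i+1), of grade at least i + 2,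
  while its chain asks only for i + 1. The difference is the vanishing of Ext^(i+1)(E_(i+1), R) that
  \<open>approximation_step_next\<close> takes as hypothesis.\<close>

lemma approximation_chain:
  fixes R :: "('r, 'z) ring_scheme" and C :: "nat \<Rightarrow> ('r, 'c) module" and G :: "nat \<Rightarrow> ('r, 'g) module"
  assumes noeth: "left_noetherian R"
    and "\<And>i. fg_module R (C i)" "\<And>i. fg_projective R (G i)"
    and "\<And>i. u i \<in> lmod_hom R (C i) (G i)" "\<And>i. v i \<in> lmod_epi R (G i) (C (Suc i))"
    and "\<And>i. a_kernel (G i) (C (Suc i)) (v i) = u i ` carrier (C i)"
    and "\<And>i. i < n \<Longrightarrow> grade_ge R (kernel_module (C i) (G i) (u i)) (Suc i)"
  shows "\<exists>(P :: ('r, 'r fg_elem) module) (M :: nat \<Rightarrow> ('r, 'r fg_elem) module)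
      (B :: nat \<Rightarrow> ('r, 'r fg_elem) module) j f.
    fg_projective R P \<and> lmod_iso R (direct_sum (C 0) P) (M 0) \<and> (\<forall>d\<le>n. syzygy_module R d (M d)) \<and>
    (\<forall>d<n. approximation_step R d (kernel_module (C d) (G d) (u d)) (B d) (j d) (M d) (f d) (M (Suc d)))"
  using assms(2-)
proof (induction n arbitrary: C G u v)
  case 0
  obtain T :: "nat \<Rightarrow> ('r, 'r fg_elem) module" where T: "fg_projective R (T 0)"
    using projective_tails[OF left_noetherian_ring[OF noeth], of 0] by blast
  obtain M :: "('r, 'r fg_elem) module" and a b where
    M: "fg_module R M" "iso_pair R (direct_sum (C 0) (T 0)) M a b"
    using fg_module_iso_pair[OF fg_module_direct_sum[OF 0(1) fg_projective_fg[OF T]]] by blast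
  show ?case
    using T M(1) iso_pair_lmod_iso[OF M(2)]
    by (intro exI[of _ "T 0"] exI[of _ "\<lambda>_. M"]) (simp add: syzygy_module_def)
next
  case (Suc n)
  note C = Suc.prems(1) and G = Suc.prems(2) and u = Suc.prems(3) and v = Suc.prems(4)
    and ex = Suc.prems(5) and grade = Suc.prems(6)
  let ?E = "\<lambda>i. kernel_module (C i) (G i) (u i)"
  have Cl: "left_module R (C i)" and Gl: "left_module R (G i)" for i
    using fg_module_left_module[OF C] fg_projective_left_module[OF G] by blast+
  have E: "fg_module R (?E i)" for i by (rule fg_module_kernel[OF noeth C Gl u])
  have "\<exists>(P :: ('r, 'r fg_elem) module) (M :: nat \<Rightarrow> ('r, 'r fg_elem) module)
      (B :: nat \<Rightarrow> ('r, 'r fg_elem) module) j f.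
    fg_projective R P \<and> lmod_iso R (direct_sum (C (Suc 0)) P) (M 0) \<and> (\<forall>d\<le>n. syzygy_module R d (M d)) \<and>
    (\<forall>d<n. approximation_step R d (?E (Suc d)) (B d) (j d) (M d) (f d) (M (Suc d)))"
    by (rule Suc.IH[of "\<lambda>i. C (Suc i)" "\<lambda>i. G (Suc i)" "\<lambda>i. u (Suc i)" "\<lambda>i. v (Suc i)", OF C G u v ex])
      (rule grade_ge_mono[OF grade], simp_all)
  then obtain P' :: "('r, 'r fg_elem) module" and M' B' :: "nat \<Rightarrow> ('r, 'r fg_elem) module" and j' f' where
    P': "fg_projective R P'" and M'0: "lmod_iso R (direct_sum (C (Suc 0)) P') (M' 0)"
    and M'syz: "\<forall>d\<le>n. syzygy_module R d (M' d)"
    and steps: "\<forall>d<n. approximation_step R d (?E (Suc d)) (B' d) (j' d) (M' d) (f' d) (M' (Suc d))"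
    by (elim exE conjE)
  have M'fg: "fg_module R (M' d)" if "d \<le> n" for d using M'syz that syzygy_module_fg by blast
  note M' = fg_module_left_module[OF M'fg]
  have P'l: "left_module R P'" by (rule fg_projective_left_module[OF P'])
  interpret P': left_module R P' by (rule P'l)
  obtain \<sigma> where \<sigma>: "\<sigma> \<in> lmod_hom R (direct_sum (C (Suc 0)) P') (M' 0)"
    "bij_betw \<sigma> (carrier (direct_sum (C (Suc 0)) P')) (carrier (M' 0))"
    using M'0 by (auto simp: lmod_iso_def)
  define H where "H = direct_sum (G 0) P'"
  have Hp: "fg_projective R H" unfolding H_def by (rule fg_projective_direct_sum[OF G P'])
  have Hl: "left_module R H" by (rule fg_projective_left_module[OF Hp])
  have v0: "v 0 \<in> lmod_hom R (G 0) (C (Suc 0))" by (rule epi_hom[OF v])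
  define w where "w = (\<lambda>x :: 'g \<times> 'r fg_elem. (v 0 (fst x), snd x))"
  have w: "w \<in> lmod_epi R H (direct_sum (C (Suc 0)) P')"
    unfolding w_def H_def
  proof (rule epiI[OF hom_pair[OF hom_compose[OF v0 hom_fst] hom_snd]])
    fix y assume y: "y \<in> carrier (direct_sum (C (Suc 0)) P')"
    then have "fst y \<in> carrier (C (Suc 0))" by auto
    then obtain x where "x \<in> carrier (G 0)" "v 0 x = fst y" by (rule epi_obtain[OF v])
    then show "\<exists>x\<in>carrier (direct_sum (G 0) P'). (v 0 (fst x), snd x) = y"
      using y by (intro bexI[of _ "(x, snd y)"]) auto
  qed
  define g where "g = rec_nat (\<lambda>x. \<sigma> (w x)) (\<lambda>d h x. f' d (h x))"
  have g0: "g 0 = (\<lambda>x. \<sigma> (w x))" and gS: "g (Suc d) = (\<lambda>x. f' d (g d x))" for d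
    by (simp_all add: g_def)
  have g: "g d \<in> lmod_epi R H (M' d)" if "d \<le> n" for d
    using that
  proof (induction d)
    case 0
    show ?case unfolding g0 by (rule epi_compose[OF iso_epi[OF \<sigma>] w])
  next
    case (Suc d)
    have d: "d < n" using Suc.prems by simp
    have "g d \<in> lmod_epi R H (M' d)" using Suc by simp
    then show ?case
      unfolding gS by (rule epi_compose[OF short_exactD(4)[OF approximation_stepD(1)[OF steps[rule_format, OF d]]]])
  qed
  define K where "K d = kernel_module H (M' d) (g d)" for d
  have Kfg: "fg_module R (K d)" if "d \<le> n" for d
    unfolding K_def by (rule fg_module_kernel[OF noeth fg_projective_fg[OF Hp] M'[OF that] epi_hom[OF g[OF that]]])
  have B'fg: "fg_module R (B' d)" if "d < n" for d
    by (rule short_exact_fg[OF noeth M'fg approximation_step_left_module[OF steps[rule_format, OF that]]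
          M' approximation_stepD(1)[OF steps[rule_format, OF that]]]) (use that in simp_all)
  \<comment> \<open>With the guard \<open>d < n\<close> under the quantifiers, a single choice
    yields whole sequences; their values from \<open>n\<close> on are arbitrary.\<close>
  have "\<forall>d. \<exists>F :: ('r, 'r fg_elem) module. \<exists>q. d < n \<longrightarrow> fg_projective R F \<and> q \<in> lmod_epi R F (B' d)"
  proof
    fix d show "\<exists>F :: ('r, 'r fg_elem) module. \<exists>q. d < n \<longrightarrow> fg_projective R F \<and> q \<in> lmod_epi R F (B' d)"
    proof (cases "d < n")
      case True
      show ?thesis by (rule fg_projective_epi[OF B'fg[OF True]]) blast
    qed blast
  qed
  then obtain F :: "nat \<Rightarrow> ('r, 'r fg_elem) module" and q where
    F: "\<forall>d. d < n \<longrightarrow> fg_projective R (F d) \<and> q d \<in> lmod_epi R (F d) (B' d)"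
    by (elim choice[THEN exE])
  then obtain T :: "nat \<Rightarrow> ('r, 'r fg_elem) module" where T: "\<forall>i\<le>n. fg_projective R (T i)"
    "\<forall>i<n. lmod_iso R (T i) (direct_sum (F i) (T (Suc i)))"
    using projective_tails[OF left_noetherian_ring[OF noeth], of n F] by blast
  have Tl: "left_module R (T d)" if "d \<le> n" for d using T(1) that fg_projective_left_module by blast
  define X where "X d = direct_sum (K d) (T d)" for d
  have Xfg: "fg_module R (X d)" if "d \<le> n" for d
    unfolding X_def using that T(1) by (intro fg_module_direct_sum[OF Kfg fg_projective_fg]) simp_all
  note Xl = fg_module_left_module[OF Xfg]
  \<comment> \<open>\<open>X d\<close> is the kernel of the projective H + T_d mapping onto M'_d, so
    it is one syzygy further than M'_d.\<close>
  have Xsyz: "syzygy_module R (Suc d) (X d)" if d: "d \<le> n" for d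
  proof (rule syzygy_module_Suc[OF M'syz[rule_format, OF d] fg_projective_direct_sum[OF Hp T(1)[rule_format, OF d]] Xfg[OF d]])
    interpret Td: left_module R "T d" by (rule Tl[OF d])
    show "short_exact R (X d) (\<lambda>x. x) (direct_sum H (T d)) (\<lambda>x. g d (fst x)) (M' d)"
    proof (rule short_exactI)
      have "(\<lambda>x. x) \<in> lmod_hom R (K d) H"
        unfolding K_def kernel_module_def by (rule hom_inclusion) (auto simp: mem_a_kernel)
      from hom_pair[OF hom_compose[OF this hom_fst] hom_snd]
      show "(\<lambda>x. x) \<in> lmod_hom R (X d) (direct_sum H (T d))" by (simp add: X_def)
      show "(\<lambda>x. g d (fst x)) \<in> lmod_epi R (direct_sum H (T d)) (M' d)"
      proof (rule epiI[OF hom_compose[OF epi_hom[OF g[OF d]] hom_fst]])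
        fix y assume "y \<in> carrier (M' d)"
        then obtain x where "x \<in> carrier H" "g d x = y" by (rule epi_obtain[OF g[OF d]])
        then show "\<exists>x\<in>carrier (direct_sum H (T d)). g d (fst x) = y"
          by (intro bexI[of _ "(x, \<zero>\<^bsub>T d\<^esub>)"]) auto
      qed
    qed (auto simp: X_def K_def mem_a_kernel)
  qed
  have "\<exists>jj ff. approximation_step R (Suc d) (?E (Suc d)) (kernel_module (F d) (B' d) (q d)) jj (X d) ff (X (Suc d))"
    if d: "d < n" for d
  proof -
    have 1: "d \<le> n" "Suc d \<le> n" using d by simp_all
    have 2: "left_module R (direct_sum (F d) (T (Suc d)))"
      using F d by (intro left_module_direct_sum fg_projective_left_module Tl[OF 1(2)]) blast
    obtain e e' where e: "e \<in> lmod_hom R (T d) (direct_sum (F d) (T (Suc d)))"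
      "e' \<in> lmod_hom R (direct_sum (F d) (T (Suc d))) (T d)" "\<forall>t\<in>carrier (T d). e' (e t) = t"
      "\<forall>y\<in>carrier (direct_sum (F d) (T (Suc d))). e (e' y) = y"
      using d by (elim lmod_iso_obtain[OF Tl[OF 1(1)] 2 T(2)[rule_format]])
    \<comment> \<open>At place d + 1 the grade is at least d + 2, which covers degree d + 1.\<close>
    have "carrier (Ext_ring R (Suc d) (?E (Suc d))) = {\<zero>\<^bsub>Ext_ring R (Suc d) (?E (Suc d))\<^esub>}"
      using grade[of "Suc d"] d by (simp add: grade_ge_def)
    from approximation_step_next[OF noeth E this steps[rule_format, OF d] M'[OF 1(1)] M'[OF 1(2)] Hl g[OF 1(1)]
        conjunct1[OF F[rule_format, OF d]] conjunct2[OF F[rule_format, OF d]] Tl[OF 1(1)] Tl[OF 1(2)] e]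
    show ?thesis unfolding X_def K_def gS .
  qed
  then have "\<forall>d. \<exists>jj ff. d < n \<longrightarrow>
      approximation_step R (Suc d) (?E (Suc d)) (kernel_module (F d) (B' d) (q d)) jj (X d) ff (X (Suc d))"
    by blast
  then obtain jj ff where Xstep: "\<forall>d. d < n \<longrightarrow>
      approximation_step R (Suc d) (?E (Suc d)) (kernel_module (F d) (B' d) (q d)) (jj d) (X d) (ff d) (X (Suc d))"
    by (elim choice[THEN exE])
  define X0 where "X0 = direct_sum (C 0) (T 0)"
  have X0fg: "fg_module R X0"
    unfolding X0_def using T(1) by (intro fg_module_direct_sum[OF C fg_projective_fg]) simp
  \<comment> \<open>By exactness at \<open>G 0\<close> and since the component in \<open>P'\<close>
    is zero, this version of \<open>u 0\<close> has image exactly \<open>K 0\<close>, the kernel of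
    H -> M'_0.\<close>
  define i where "i = (\<lambda>c. (u 0 c, \<zero>\<^bsub>P'\<^esub>))"
  have i_H: "i \<in> lmod_hom R (C 0) H"
    unfolding i_def H_def by (rule hom_compose[OF hom_inl[OF P'l] u])
  interpret C1: left_module R "C (Suc 0)" by (rule Cl)
  have CP: "left_module R (direct_sum (C (Suc 0)) P')" by (rule left_module_direct_sum[OF Cl P'l])
  have g0_ker: "g 0 x = \<zero>\<^bsub>M' 0\<^esub> \<longleftrightarrow> v 0 (fst x) = \<zero>\<^bsub>C (Suc 0)\<^esub> \<and> snd x = \<zero>\<^bsub>P'\<^esub>" if "x \<in> carrier H" for x
  proof -
    have "g 0 x = \<zero>\<^bsub>M' 0\<^esub> \<longleftrightarrow> w x = \<zero>\<^bsub>direct_sum (C (Suc 0)) P'\<^esub>"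
      unfolding g0
      by (rule hom_eq_zero_iff[OF CP M'[OF le0] \<sigma>(1) bij_betw_imp_inj_on[OF \<sigma>(2)]
            hom_closed[OF epi_hom[OF w] that]])
    then show ?thesis by (simp add: w_def)
  qed
  have vu: "v 0 (u 0 c) = \<zero>\<^bsub>C (Suc 0)\<^esub>" if "c \<in> carrier (C 0)" for c
  proof -
    have "u 0 c \<in> a_kernel (G 0) (C (Suc 0)) (v 0)" unfolding ex using that by simp
    then show ?thesis by (simp add: mem_a_kernel)
  qed
  have i_ker: "i c \<in> carrier (K 0)" if "c \<in> carrier (C 0)" for c
    using hom_closed[OF i_H that] g0_ker[OF hom_closed[OF i_H that]] vu[OF that]
    by (simp add: K_def mem_a_kernel i_def)
  have i_epi: "i \<in> lmod_epi R (C 0) (K 0)"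
  proof (rule epiI)
    show "i \<in> lmod_hom R (C 0) (K 0)"
      using i_ker unfolding K_def kernel_module_def by (intro hom_restrict_codomain[OF i_H]) auto
    fix y assume "y \<in> carrier (K 0)"
    then have y: "y \<in> carrier H" "g 0 y = \<zero>\<^bsub>M' 0\<^esub>" by (simp_all add: K_def mem_a_kernel)
    then have "fst y \<in> a_kernel (G 0) (C (Suc 0)) (v 0)"
      using g0_ker[OF y(1)] by (auto simp: mem_a_kernel H_def)
    then obtain c where "c \<in> carrier (C 0)" "fst y = u 0 c" unfolding ex by blast
    then show "\<exists>c\<in>carrier (C 0). i c = y"
      using g0_ker[OF y(1)] y(2) by (intro bexI[of _ c]) (auto simp: i_def prod_eq_iff)
  qed
  have i_kernel: "a_kernel (C 0) (K 0) i = a_kernel (C 0) (G 0) (u 0)"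
    by (auto simp: mem_a_kernel K_def i_def H_def)
  have step0: "approximation_step R 0 (?E 0) (?E 0) (\<lambda>x. (x, \<zero>\<^bsub>T 0\<^esub>)) X0 (\<lambda>x. (i (fst x), snd x)) (X 0)"
    unfolding X0_def X_def
    by (rule approximation_step_first[OF noeth C Gl u grade[OF zero_less_Suc] fg_module_left_module[OF Kfg] i_epi i_kernel Tl]) simp_all
  \<comment> \<open>\<open>X0\<close> and the modules \<open>X d\<close> have different carrier
    types and can be joined into one sequence only after copying. \<open>X d\<close> then takes
    place d + 1 in the new chain.\<close>
  obtain M0 :: "('r, 'r fg_elem) module" and a0 b0 where M0: "fg_module R M0" "iso_pair R X0 M0 a0 b0"
    using fg_module_iso_pair[OF X0fg] by blast
  obtain B0 :: "('r, 'r fg_elem) module" and c0 d0 where B0: "fg_module R B0" "iso_pair R (?E 0) B0 c0 d0"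
    using fg_module_iso_pair[OF E] by blast
  have "\<forall>d. \<exists>(N :: ('r, 'r fg_elem) module) a b. d \<le> n \<longrightarrow> fg_module R N \<and> iso_pair R (X d) N a b"
    using fg_module_iso_pair[OF Xfg] by blast
  then obtain N :: "nat \<Rightarrow> ('r, 'r fg_elem) module" and a b where
    N: "\<forall>d. d \<le> n \<longrightarrow> fg_module R (N d) \<and> iso_pair R (X d) (N d) (a d) (b d)"
    by (elim choice[THEN exE])
  have "fg_module R (kernel_module (F d) (B' d) (q d))" if "d < n" for d
    using F that by (intro fg_module_kernel[OF noeth fg_projective_fg fg_module_left_module[OF B'fg] epi_hom]) auto
  then have "\<forall>d. \<exists>(L :: ('r, 'r fg_elem) module) a b. d < n \<longrightarrow>
      fg_module R L \<and> iso_pair R (kernel_module (F d) (B' d) (q d)) L a b"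
    using fg_module_iso_pair by blast
  then obtain L :: "nat \<Rightarrow> ('r, 'r fg_elem) module" and c k where
    L: "\<forall>d. d < n \<longrightarrow> fg_module R (L d) \<and> iso_pair R (kernel_module (F d) (B' d) (q d)) (L d) (c d) (k d)"
    by (elim choice[THEN exE])
  note Nl = fg_module_left_module[OF conjunct1[OF N[rule_format]]]
    and Ll = fg_module_left_module[OF conjunct1[OF L[rule_format]]]
  note Niso = conjunct2[OF N[rule_format]] and Liso = conjunct2[OF L[rule_format]]
  let ?M = "case_nat M0 N" and ?B = "case_nat B0 L"
  let ?j = "case_nat (\<lambda>x. a0 ((d0 x, \<zero>\<^bsub>T 0\<^esub>))) (\<lambda>d x. a d (jj d (k d x)))"
  let ?f = "case_nat (\<lambda>x. a 0 (i (fst (b0 x)), snd (b0 x))) (\<lambda>d x. a (Suc d) (ff d (b d x)))"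
  have "lmod_iso R (direct_sum (C 0) (T 0)) (?M 0)"
    using iso_pair_lmod_iso[OF M0(2)] by (simp add: X0_def)
  moreover have "syzygy_module R d (?M d)" if "d \<le> Suc n" for d
  proof (cases d)
    case 0
    then show ?thesis using M0(1) by (simp add: syzygy_module_def)
  next
    case (Suc e)
    then have e: "e \<le> n" using that by simp
    have "syzygy_module R (Suc e) (N e)"
      by (rule syzygy_module_iso[OF Xsyz[OF e] Nl[OF e] iso_pairD(2)[OF Niso[OF e]] iso_pair_bij[OF iso_pair_sym[OF Niso[OF e]]]])
    then show ?thesis by (simp add: Suc)
  qed
  moreover have "approximation_step R d (?E d) (?B d) (?j d) (?M d) (?f d) (?M (Suc d))" if "d < Suc n" for d
  proof (cases d)
    case 0
    show ?thesis
      unfolding 0 nat.case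
      by (rule approximation_step_transport[OF step0 fg_module_left_module[OF X0fg] Xl fg_module_left_module[OF B0(1)]
            Nl B0(2) M0(2) Niso]) simp_all
  next
    case (Suc e)
    then have e: "e < n" "e \<le> n" "Suc e \<le> n" using that by simp_all
    show ?thesis
      unfolding Suc nat.case
      by (rule approximation_step_transport[OF Xstep[rule_format, OF e(1)] Xl[OF e(2)] Xl[OF e(3)] Ll[OF e(1)] Nl[OF e(3)]
            Liso[OF e(1)] Niso[OF e(2)] Niso[OF e(3)]])
  qed
  ultimately show ?case
    using T(1) by (intro exI[of _ "T 0"] exI[of _ ?M] exI[of _ ?B] exI[of _ ?j] exI[of _ ?f] conjI allI impI) simp_all
qed

section \<open>The transpose, its resolution and its Ext modules\<close>

text \<open>Left exactness of the dual, applied to the presentation. Cutting the codomain down to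
  the image makes the sequence short exact, ready for splicing.\<close>

lemma presentation_dual_exact:
  assumes "left_module R P0" "left_module R P1" "left_module R M" and \<epsilon>: "\<epsilon> \<in> lmod_epi R P0 M"
    and \<delta>: "\<delta> \<in> lmod_hom R P1 P0" "\<delta> ` carrier P1 = a_kernel P0 M \<epsilon>"
  shows "short_exact (opp R) (dual R M) (dual_map P0 \<epsilon>) (dual R P0) (dual_map P1 \<delta>)
    ((dual R P1)\<lparr>carrier := dual_map P1 \<delta> ` carrier (dual R P0)\<rparr>)"
proof (rule short_exactI)
  note reg = left_module_regular[OF left_module_ring[OF assms(1)]]
  note d\<epsilon> = dual_map_hom[OF assms(1) epi_hom[OF \<epsilon>]] and d\<delta> = dual_map_hom[OF assms(2) \<delta>(1)]
  show "dual_map P0 \<epsilon> \<in> lmod_hom (opp R) (dual R M) (dual R P0)" by (rule d\<epsilon>)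
  show "inj_on (dual_map P0 \<epsilon>) (carrier (dual R M))" by (rule dual_map_epi_inj[OF \<epsilon>])
  show "dual_map P1 \<delta> \<in> lmod_epi (opp R) (dual R P0) ((dual R P1)\<lparr>carrier := dual_map P1 \<delta> ` carrier (dual R P0)\<rparr>)"
    using hom_restrict_codomain[OF d\<delta> subset_refl] by (simp add: lmod_epi_def)
  show "dual_map P1 \<delta> (dual_map P0 \<epsilon> \<phi>) = \<zero>\<^bsub>(dual R P1)\<lparr>carrier := dual_map P1 \<delta> ` carrier (dual R P0)\<rparr>\<^esub>"
    if \<phi>: "\<phi> \<in> carrier (dual R M)" for \<phi>
  proof -
    have "\<phi> (\<epsilon> (\<delta> x)) = \<zero>\<^bsub>R\<^esub>" if x: "x \<in> carrier P1" for x
    proof -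
      have "\<delta> x \<in> a_kernel P0 M \<epsilon>" unfolding \<delta>(2)[symmetric] using x by simp
      then show ?thesis using hom_zero[OF assms(3) reg dual_hom[OF \<phi>]] by (simp add: mem_a_kernel)
    qed
    then show ?thesis using hom_closed[OF \<delta>(1)] by (auto simp: dual_map_def fun_eq_iff)
  qed
  show "\<exists>\<psi>\<in>carrier (dual R M). dual_map P0 \<epsilon> \<psi> = \<phi>"
    if \<phi>: "\<phi> \<in> carrier (dual R P0)"
      "dual_map P1 \<delta> \<phi> = \<zero>\<^bsub>(dual R P1)\<lparr>carrier := dual_map P1 \<delta> ` carrier (dual R P0)\<rparr>\<^esub>" for \<phi>
  proof (rule dual_map_epi_image[OF assms(1,3) \<epsilon> \<phi>(1)])
    fix x assume "x \<in> a_kernel P0 M \<epsilon>"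
    then obtain y where y: "y \<in> carrier P1" "x = \<delta> y" unfolding \<delta>(2)[symmetric] by blast
    have "dual_map P1 \<delta> \<phi> y = \<zero>\<^bsub>R\<^esub>" using \<phi>(2) y(1) by simp
    then show "\<phi> x = \<zero>\<^bsub>R\<^esub>" using y by (simp add: dual_map_apply)
  qed
qed

lemma short_exact_quotient:
  assumes "left_module R M" "submodule N R M"
  shows "short_exact R (M\<lparr>carrier := N\<rparr>) (\<lambda>x. x) M (\<lambda>x. N +>\<^bsub>M\<^esub> x) (quotient_module M N)"
  using short_exact_kernel[OF quotient_map_epi[OF assms]]
  by (simp add: kernel_module_def quotient_map_kernel[OF assms])

lemma short_exact_middle_iso:
  assumes "short_exact R A f B g C" "left_module R A" "left_module R B" "left_module R C" "iso_pair R B B' b b'"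
  shows "short_exact R A (\<lambda>x. b (f x)) B' (\<lambda>x. g (b' x)) C"
  using short_exact_transport[OF assms(1-4) hom_id hom_id _ _ iso_pairD[OF assms(5)] hom_id hom_id _ _ assms(4)]
  by simp

lemma fg_projective_iso_pair:
  fixes P :: "('r, 'p) module"
  assumes "fg_projective R P"
  shows "\<exists>(Q :: ('r, 'r fg_elem) module) f g. fg_projective R Q \<and> iso_pair R P Q f g"
  by (rule fg_projective_copy[OF assms]) (unfold iso_pair_def, intro exI conjI, assumption+)

text \<open>As \<open>Q\<close> is a copy of the dual of \<open>P\<close>, its dual is a copy of the
  double dual, which evaluation identifies with \<open>P\<close>.\<close>

lemma double_dual_iso:
  assumes P: "fg_projective R P" and Q: "left_module (opp R) Q" and ab: "iso_pair (opp R) (dual R P) Q a b"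
  shows "(\<lambda>x. dual_map Q b (evaluation R P x)) \<in> lmod_hom R P (dual (opp R) Q)"
    and "bij_betw (\<lambda>x. dual_map Q b (evaluation R P x)) (carrier P) (carrier (dual (opp R) Q))"
proof -
  have Pl: "left_module R P" by (rule fg_projective_left_module[OF P])
  note D = iso_pairD[OF ab]
  have b: "dual_map Q b \<in> lmod_hom R (dual (opp R) (dual R P)) (dual (opp R) Q)"
    using dual_map_hom[OF Q D(2)] by simp
  have a: "dual_map (dual R P) a \<in> lmod_hom R (dual (opp R) Q) (dual (opp R) (dual R P))"
    using dual_map_hom[OF left_module_dual[OF Pl] D(1)] by simp
  show "(\<lambda>x. dual_map Q b (evaluation R P x)) \<in> lmod_hom R P (dual (opp R) Q)"
    by (rule hom_compose[OF b evaluation_hom[OF Pl]])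
  have "iso_pair R (dual (opp R) (dual R P)) (dual (opp R) Q) (dual_map Q b) (dual_map (dual R P) a)"
    unfolding iso_pair_def
    by (intro conjI ballI a b dual_map_retract[where g = b, OF D(1,3)] dual_map_retract[where g = a, OF D(2,4)])
  from bij_betw_trans[OF evaluation_bij[OF P] iso_pair_bij[OF this]]
  show "bij_betw (\<lambda>x. dual_map Q b (evaluation R P x)) (carrier P) (carrier (dual (opp R) Q))"
    by (simp add: comp_def del: dual_sel)
qed

lemma lmod_iso_direct_sum:
  assumes "left_module R M" "left_module R N" "lmod_iso R M N"
  shows "lmod_iso R (direct_sum M P) (direct_sum N P)"
proof -
  obtain f g where fg: "f \<in> lmod_hom R M N" "g \<in> lmod_hom R N M"
    "\<forall>x\<in>carrier M. g (f x) = x" "\<forall>y\<in>carrier N. f (g y) = y"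
    by (rule lmod_iso_obtain[OF assms])
  show ?thesis
    by (rule lmod_isoI[OF hom_pair[OF hom_compose[OF fg(1) hom_fst] hom_snd]
          hom_pair[OF hom_compose[OF fg(2) hom_fst] hom_snd]]) (use fg(3,4) in auto)
qed

lemma transpose_module_presentation:
  assumes "left_noetherian R" "fg_module R M"
  obtains P :: "nat \<Rightarrow> ('r, 'r fg_elem) module" and \<delta> \<epsilon> where "partial_resolution R 2 M P \<delta> \<epsilon>"
    "transpose_module R M = quotient_module (dual R (P 1)) (dual_map (P 1) (\<delta> 0) ` carrier (dual R (P 0)))"
proof -
  let ?t = "SOME (P :: nat \<Rightarrow> ('r, 'r fg_elem) module, \<delta>, \<epsilon>). partial_resolution R 2 M P \<delta> \<epsilon>"
  obtain P0 :: "nat \<Rightarrow> ('r, 'r fg_elem) module" and \<delta>0 \<epsilon>0 where "projective_resolution R M P0 \<delta>0 \<epsilon>0"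
    by (rule projective_resolution_exists[OF assms])
  then have "partial_resolution R 2 M P0 \<delta>0 \<epsilon>0" by (simp add: projective_resolution_def)
  then have "\<exists>t. (\<lambda>(P :: nat \<Rightarrow> ('r, 'r fg_elem) module, \<delta>, \<epsilon>). partial_resolution R 2 M P \<delta> \<epsilon>) t" by auto
  then have t: "(\<lambda>(P, \<delta>, \<epsilon>). partial_resolution R 2 M P \<delta> \<epsilon>) ?t" by (rule someI_ex)
  obtain P \<delta> \<epsilon> where eq: "?t = (P, \<delta>, \<epsilon>)" by (cases ?t) auto
  show ?thesis
    by (rule that[of P \<delta> \<epsilon>]) (use t in \<open>simp_all add: eq transpose_module_def\<close>)
qed

text \<open>\<open>Q\<close> starts with copies of \<open>P\<^sub>1\<^sup>*\<close> and \<open>P\<^sub>0\<^sup>*\<close>, so that its dual gives back the presentation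
  of \<open>M\<close> because finitely generated projectives are reflexive.\<close>

lemma transpose_resolution:
  fixes R :: "('r, 'z) ring_scheme"
  assumes noeth: "left_noetherian R" "left_noetherian (opp R)" and M: "fg_module R M"
  obtains Q D :: "nat \<Rightarrow> ('r, 'r fg_elem) module" and \<Delta> \<epsilon>Q \<delta>D \<epsilon>D where
    "fg_module (opp R) (transpose_module R M)"
    "projective_resolution (opp R) (transpose_module R M) Q \<Delta> \<epsilon>Q"
    "fg_module (opp R) (dual R M)" "projective_resolution (opp R) (dual R M) D \<delta>D \<epsilon>D"
    "\<forall>i. Q (Suc (Suc i)) = D i" "\<forall>i. \<Delta> (Suc (Suc i)) = \<delta>D i"
    "lmod_iso R M (quotient_module (dual (opp R) (Q (Suc 0)))
      (dual_map (Q (Suc 0)) (\<Delta> 0) ` carrier (dual (opp R) (Q 0))))"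
proof -
  let ?S = "opp R" and ?N = "transpose_module R M"
  have Ml: "left_module R M" by (rule fg_module_left_module[OF M])
  obtain P :: "nat \<Rightarrow> ('r, 'r fg_elem) module" and \<delta> \<epsilon> where part: "partial_resolution R 2 M P \<delta> \<epsilon>"
    and N: "?N = quotient_module (dual R (P 1)) (dual_map (P 1) (\<delta> 0) ` carrier (dual R (P 0)))"
    by (rule transpose_module_presentation[OF noeth(1) M])
  have P: "fg_projective R (P 0)" "fg_projective R (P 1)" and \<epsilon>: "\<epsilon> \<in> lmod_epi R (P 0) M"
    and \<delta>: "\<delta> 0 \<in> lmod_hom R (P 1) (P 0)" "\<delta> 0 ` carrier (P 1) = a_kernel (P 0) M \<epsilon>"
    using part by (auto simp: partial_resolution_def out_kernel_0)
  note Pl = fg_projective_left_module[OF P(1)] fg_projective_left_module[OF P(2)]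
  note dP = fg_projective_dual[OF P(1)] fg_projective_dual[OF P(2)]
  note dPl = left_module_dual[OF Pl(1)] left_module_dual[OF Pl(2)]
  have dM: "left_module ?S (dual R M)" by (rule left_module_dual[OF Ml])
  let ?I = "dual_map (P 1) (\<delta> 0) ` carrier (dual R (P 0))"
  let ?IM = "(dual R (P 1))\<lparr>carrier := ?I\<rparr>"
  have I: "submodule ?I ?S (dual R (P 1))"
    by (rule submodule_image[OF dPl dual_map_hom[OF Pl(2) \<delta>(1)] submodule_carrier[OF dPl(1)]])
  have IM: "left_module ?S ?IM" by (rule left_module_submodule[OF dPl(2) I])
  have Nl: "left_module ?S ?N" unfolding N by (rule left_module_quotient[OF dPl(2) I])
  have Nfg: "fg_module ?S ?N"
    unfolding N by (rule fg_module_image[OF fg_projective_fg[OF dP(2)] left_module_quotient[OF dPl(2) I] quotient_map_epi[OF dPl(2) I]])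
  obtain Q0 :: "('r, 'r fg_elem) module" and a1 b1 where Q0: "fg_projective ?S Q0" "iso_pair ?S (dual R (P 1)) Q0 a1 b1"
    using fg_projective_iso_pair[OF dP(2)] by blast
  obtain Q1 :: "('r, 'r fg_elem) module" and a0 b0 where Q1: "fg_projective ?S Q1" "iso_pair ?S (dual R (P 0)) Q1 a0 b0"
    using fg_projective_iso_pair[OF dP(1)] by blast
  have se1: "short_exact ?S (dual R M) (\<lambda>x. a0 (dual_map (P 0) \<epsilon> x)) Q1 (\<lambda>x. dual_map (P 1) (\<delta> 0) (b0 x)) ?IM"
    by (rule short_exact_middle_iso[OF presentation_dual_exact[OF Pl Ml \<epsilon> \<delta>] dM dPl(1) IM Q1(2)])
  have se0: "short_exact ?S ?IM a1 Q0 (\<lambda>x. ?I +>\<^bsub>dual R (P 1)\<^esub> b1 x) ?N"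
    unfolding N using short_exact_middle_iso[OF short_exact_quotient[OF dPl(2) I] IM dPl(2) Nl[unfolded N] Q0(2)] .
  have dMfg: "fg_module ?S (dual R M)"
    by (rule short_exact_fg[OF noeth(2) fg_projective_fg[OF Q1(1)] dM IM se1])
  obtain D :: "nat \<Rightarrow> ('r, 'r fg_elem) module" and \<delta>D \<epsilon>D where D: "projective_resolution ?S (dual R M) D \<delta>D \<epsilon>D"
    by (rule projective_resolution_exists[OF noeth(2) dMfg])
  \<comment> \<open>The two splices put \<open>Q0\<close> and \<open>Q1\<close> in front of a
    resolution of the dual of \<open>M\<close>, which thereby becomes the part of the new resolution
    from place 2 on.\<close>
  note res1 = projective_resolution_prepend[OF dM D Q1(1) IM se1]
  note res = projective_resolution_prepend[OF IM res1 Q0(1) Nl se0]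
  let ?\<Delta>0 = "\<lambda>x. a1 (dual_map (P 1) (\<delta> 0) (b0 x))"
  let ?\<mu> = "\<lambda>x. dual_map Q1 b0 (evaluation R (P 0) x)" and ?\<mu>' = "\<lambda>x. dual_map Q0 b1 (evaluation R (P 1) x)"
  note Q0l = fg_projective_left_module[OF Q0(1)] and Q1l = fg_projective_left_module[OF Q1(1)]
  note \<mu> = double_dual_iso[OF P(1) Q1l Q1(2)] and \<mu>' = double_dual_iso[OF P(2) Q0l Q0(2)]
  have b0c: "b0 z \<in> carrier (dual R (P 0))" if "z \<in> carrier Q1" for z
    by (rule hom_closed[OF iso_pairD(2)[OF Q1(2)] that])
  have \<delta>c: "dual_map (P 1) (\<delta> 0) \<phi> \<in> carrier (dual R (P 1))" if "\<phi> \<in> carrier (dual R (P 0))" for \<phi>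
    by (rule hom_closed[OF dual_map_hom[OF Pl(2) \<delta>(1)] that])
  have a1c: "a1 \<phi> \<in> carrier Q0" if "\<phi> \<in> carrier (dual R (P 1))" for \<phi>
    by (rule hom_closed[OF iso_pairD(1)[OF Q0(2)] that])
  have b1a1: "b1 (a1 \<phi>) = \<phi>" if "\<phi> \<in> carrier (dual R (P 1))" for \<phi>
    using iso_pairD(3)[OF Q0(2)] that by blast
  \<comment> \<open>Naturality of evaluation: once \<open>P 0\<close> and \<open>P 1\<close> are
    identified with the duals of \<open>Q1\<close> and \<open>Q0\<close>, the dual of the first
    differential is \<open>\<delta> 0\<close> again.\<close>
  have sq: "?\<mu> (\<delta> 0 y) = dual_map Q1 ?\<Delta>0 (?\<mu>' y)" if y: "y \<in> carrier (P 1)" for y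
  proof
    fix z
    show "?\<mu> (\<delta> 0 y) z = dual_map Q1 ?\<Delta>0 (?\<mu>' y) z"
    proof (cases "z \<in> carrier Q1")
      case True
      note c = b0c[OF True] \<delta>c[OF b0c[OF True]]
      have "?\<mu> (\<delta> 0 y) z = b0 z (\<delta> 0 y)"
        unfolding dual_map_def evaluation_def using True c by (simp del: dual_sel)
      moreover have "dual_map Q1 ?\<Delta>0 (?\<mu>' y) z = dual_map (P 1) (\<delta> 0) (b0 z) y"
        unfolding dual_map_def[of Q1] dual_map_def[of Q0] evaluation_def using True c a1c b1a1 by (simp del: dual_sel)
      ultimately show ?thesis using y by (simp add: dual_map_apply)
    qed (simp add: dual_map_def)
  qed
  let ?L = "dual_map Q1 ?\<Delta>0 ` carrier (dual ?S Q0)"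
  have \<Delta>0: "?\<Delta>0 \<in> lmod_hom ?S Q1 Q0"
    by (rule hom_compose[OF iso_pairD(1)[OF Q0(2)] hom_compose[OF dual_map_hom[OF Pl(2) \<delta>(1)] iso_pairD(2)[OF Q1(2)]]])
  have dQ: "left_module R (dual ?S Q0)" "left_module R (dual ?S Q1)"
    using left_module_dual[OF Q0l] left_module_dual[OF Q1l] by simp_all
  have d\<Delta>0: "dual_map Q1 ?\<Delta>0 \<in> lmod_hom R (dual ?S Q0) (dual ?S Q1)"
    using dual_map_hom[OF Q1l \<Delta>0] by simp
  have L: "submodule ?L R (dual ?S Q1)"
    by (rule submodule_image[OF dQ d\<Delta>0 submodule_carrier[OF dQ(1)]])
  note qe = quotient_map_epi[OF dQ(2) L]
  have q: "(\<lambda>x. ?L +>\<^bsub>dual ?S Q1\<^esub> ?\<mu> x) \<in> lmod_epi R (P 0) (quotient_module (dual ?S Q1) ?L)"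
    by (rule epi_compose[OF qe iso_epi[OF \<mu>]])
  \<comment> \<open>The square and the bijectivity of both identifications match the two images, so
    \<open>M\<close> and the cokernel are quotients of \<open>P 0\<close> by the same
    submodule.\<close>
  have mem_L: "?\<mu> x \<in> ?L \<longleftrightarrow> x \<in> \<delta> 0 ` carrier (P 1)" if x: "x \<in> carrier (P 0)" for x
  proof
    assume "?\<mu> x \<in> ?L"
    then obtain \<tau> where \<tau>: "\<tau> \<in> carrier (dual ?S Q0)" "?\<mu> x = dual_map Q1 ?\<Delta>0 \<tau>" by blast
    obtain y where y: "y \<in> carrier (P 1)" "?\<mu>' y = \<tau>" by (rule epi_obtain[OF iso_epi[OF \<mu>'] \<tau>(1)])
    have "?\<mu> x = ?\<mu> (\<delta> 0 y)" unfolding sq[OF y(1)] y(2) by (rule \<tau>(2))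
    then have "x = \<delta> 0 y"
      by (rule inj_onD[OF bij_betw_imp_inj_on[OF \<mu>(2)] _ x hom_closed[OF \<delta>(1) y(1)]])
    then show "x \<in> \<delta> 0 ` carrier (P 1)" using y(1) by blast
  next
    assume "x \<in> \<delta> 0 ` carrier (P 1)"
    then obtain y where y: "y \<in> carrier (P 1)" "x = \<delta> 0 y" by blast
    show "?\<mu> x \<in> ?L" unfolding y(2) sq[OF y(1)] by (rule imageI[OF hom_closed[OF \<mu>'(1) y(1)]])
  qed
  have coset_L: "?L +>\<^bsub>dual ?S Q1\<^esub> z = \<zero>\<^bsub>quotient_module (dual ?S Q1) ?L\<^esub> \<longleftrightarrow> z \<in> ?L"
    if "z \<in> carrier (dual ?S Q1)" for z
    using quotient_map_kernel[OF dQ(2) L] that mem_a_kernel by metis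
  have "x \<in> a_kernel (P 0) (quotient_module (dual ?S Q1) ?L) (\<lambda>x. ?L +>\<^bsub>dual ?S Q1\<^esub> ?\<mu> x) \<longleftrightarrow>
    x \<in> \<delta> 0 ` carrier (P 1)" for x
    using mem_L[of x] coset_L[OF hom_closed[OF \<mu>(1), of x]] submoduleD(1)[OF submodule_a_kernel[OF Pl(1) Ml epi_hom[OF \<epsilon>]]]
    unfolding \<delta>(2) mem_a_kernel by blast
  then have "a_kernel (P 0) (quotient_module (dual ?S Q1) ?L) (\<lambda>x. ?L +>\<^bsub>dual ?S Q1\<^esub> ?\<mu> x) = a_kernel (P 0) M \<epsilon>"
    unfolding \<delta>(2) by blast
  then have "lmod_iso R M (quotient_module (dual ?S Q1) ?L)"
    by (intro iso_of_epis[OF Pl(1) Ml left_module_quotient[OF dQ(2) L] \<epsilon> q]) simp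
  then show ?thesis
    by (intro that[OF Nfg res dMfg D]) simp_all
qed

text \<open>Consecutive dualized differentials compose to zero, so each induces a map
  \<open>u i\<close> on the cokernel \<open>C i\<close> of its predecessor. The kernel of
  \<open>u i\<close> is cocycles modulo coboundaries, in degree i + 1; its image is that of the
  differential, and the cokernel is \<open>C (Suc i)\<close>. This is the pattern on which
  \<open>approximation_chain\<close> runs.\<close>

lemma cohomology_as_kernel:
  fixes S :: "('r, 'z) ring_scheme"
  assumes N: "left_module S N" and res: "projective_resolution S N Q \<Delta> \<epsilon>"
  defines "C \<equiv> \<lambda>i. quotient_module (dual S (Q (Suc i))) (dual_map (Q (Suc i)) (\<Delta> i) ` carrier (dual S (Q i)))"
    and "G \<equiv> \<lambda>i. dual S (Q (Suc (Suc i)))"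
  shows "\<exists>u v. (\<forall>i. u i \<in> lmod_hom (opp S) (C i) (G i)) \<and> (\<forall>i. v i \<in> lmod_epi (opp S) (G i) (C (Suc i))) \<and>
    (\<forall>i. a_kernel (G i) (C (Suc i)) (v i) = u i ` carrier (C i)) \<and>
    (\<forall>i. lmod_iso (opp S) (dual_cohomology S Q \<Delta> (Suc i)) (kernel_module (C i) (G i) (u i)))"
proof -
  note Q = resolution_left_module[OF N res] and \<Delta> = resolution_hom[OF N res]
  note dQ = left_module_dual[OF Q]
  note d\<Delta> = dual_map_hom[OF Q \<Delta>]
  let ?B = "\<lambda>i. dual_map (Q (Suc i)) (\<Delta> i) ` carrier (dual S (Q i))"
  let ?\<pi> = "\<lambda>i x. ?B i +>\<^bsub>dual S (Q (Suc i))\<^esub> x"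
  have B: "submodule (?B i) (opp S) (dual S (Q (Suc i)))" for i
    by (rule submodule_image[OF dQ dQ d\<Delta> submodule_carrier[OF dQ]])
  have C: "left_module (opp S) (C i)" and \<pi>: "?\<pi> i \<in> lmod_epi (opp S) (dual S (Q (Suc i))) (C i)"
    and ker\<pi>: "a_kernel (dual S (Q (Suc i))) (C i) (?\<pi> i) = ?B i" for i
    unfolding C_def using quotient_module_props[OF dQ B] by blast+
  have Bcob: "?B i = coboundaries S Q \<Delta> (Suc i)" for i by (simp add: coboundaries_def)
  have G: "left_module (opp S) (G i)" for i unfolding G_def by (rule dQ)
  have "\<forall>i. \<exists>u. u \<in> lmod_hom (opp S) (C i) (G i) \<and>
    (\<forall>x\<in>carrier (dual S (Q (Suc i))). u (?\<pi> i x) = dual_map (Q (Suc (Suc i))) (\<Delta> (Suc i)) x)"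
  proof
    fix i
    have "?B i \<subseteq> a_kernel (dual S (Q (Suc i))) (G i) (dual_map (Q (Suc (Suc i))) (\<Delta> (Suc i)))"
      unfolding Bcob G_def using coboundaries_subset_cocycles[OF N res, of "Suc i"] by (simp add: cocycles_def)
    then have "a_kernel (dual S (Q (Suc i))) (C i) (?\<pi> i) \<subseteq>
      a_kernel (dual S (Q (Suc i))) (G i) (dual_map (Q (Suc (Suc i))) (\<Delta> (Suc i)))"
      by (simp only: ker\<pi>)
    moreover have "dual_map (Q (Suc (Suc i))) (\<Delta> (Suc i)) \<in> lmod_hom (opp S) (dual S (Q (Suc i))) (G i)"
      unfolding G_def by (rule d\<Delta>)
    ultimately have "\<exists>u\<in>lmod_hom (opp S) (C i) (G i).
      \<forall>x\<in>carrier (dual S (Q (Suc i))). u (?\<pi> i x) = dual_map (Q (Suc (Suc i))) (\<Delta> (Suc i)) x"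
      by (intro factor_through_epi[OF dQ C G \<pi>])
    then show "\<exists>u. u \<in> lmod_hom (opp S) (C i) (G i) \<and>
      (\<forall>x\<in>carrier (dual S (Q (Suc i))). u (?\<pi> i x) = dual_map (Q (Suc (Suc i))) (\<Delta> (Suc i)) x)"
      unfolding Bex_def .
  qed
  then obtain u where u: "\<forall>i. u i \<in> lmod_hom (opp S) (C i) (G i) \<and>
    (\<forall>x\<in>carrier (dual S (Q (Suc i))). u i (?\<pi> i x) = dual_map (Q (Suc (Suc i))) (\<Delta> (Suc i)) x)"
    by (rule choice[THEN exE])
  note uh = conjunct1[OF u[rule_format]] and u\<pi> = conjunct2[OF u[rule_format], rule_format]
  have im: "u i ` carrier (C i) = ?B (Suc i)" for i
  proof -
    have "u i ` carrier (C i) = (\<lambda>x. u i (?\<pi> i x)) ` carrier (dual S (Q (Suc i)))"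
      unfolding epi_image[OF \<pi>, symmetric] by (simp only: image_image)
    also have "\<dots> = ?B (Suc i)" by (rule image_cong[OF refl u\<pi>])
    finally show ?thesis .
  qed
  have v: "?\<pi> (Suc i) \<in> lmod_epi (opp S) (G i) (C (Suc i))" for i unfolding G_def by (rule \<pi>)
  have ex: "a_kernel (G i) (C (Suc i)) (?\<pi> (Suc i)) = u i ` carrier (C i)" for i
    unfolding im G_def by (rule ker\<pi>)
  have "lmod_iso (opp S) (dual_cohomology S Q \<Delta> (Suc i)) (kernel_module (C i) (G i) (u i))" for i
  proof (rule iso_of_epis[OF left_module_cocycles[OF N res] left_module_cohomology[OF N res]
        left_module_kernel[OF C G uh] cohomology_quotient(2)[OF N res]])
    let ?Z = "cocycles S Q \<Delta> (Suc i)" and ?E = "kernel_module (C i) (G i) (u i)"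
    have Z: "x \<in> carrier ?Z \<longleftrightarrow> x \<in> carrier (dual S (Q (Suc i))) \<and> u i (?\<pi> i x) = \<zero>\<^bsub>G i\<^esub>" for x
      using u\<pi>[of x i] by (auto simp: cocycles_def mem_a_kernel G_def simp del: dual_sel)
    have "(\<lambda>x. ?\<pi> i x) \<in> lmod_hom (opp S) ?Z (C i)"
      using hom_restrict_domain[OF epi_hom[OF \<pi>] submoduleD(1)[OF submodule_cocycles[OF N res]]]
      by (simp add: cocycles_def kernel_module_def)
    then have h: "?\<pi> i \<in> lmod_hom (opp S) ?Z ?E"
      unfolding kernel_module_def[of "C i"]
      by (rule hom_restrict_codomain) (use Z hom_closed[OF epi_hom[OF \<pi>]] in \<open>auto simp: mem_a_kernel\<close>)
    show "?\<pi> i \<in> lmod_epi (opp S) ?Z ?E"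
    proof (rule epiI[OF h])
      fix y assume "y \<in> carrier ?E"
      then have y: "y \<in> carrier (C i)" "u i y = \<zero>\<^bsub>G i\<^esub>" by (simp_all add: mem_a_kernel)
      obtain x where "x \<in> carrier (dual S (Q (Suc i)))" "?\<pi> i x = y" by (rule epi_obtain[OF \<pi> y(1)])
      then show "\<exists>x\<in>carrier ?Z. ?\<pi> i x = y" using Z y(2) by (intro bexI[of _ x]) simp_all
    qed
    \<comment> \<open>The cocycles that vanish in \<open>C i\<close> are the coboundaries, so
      cohomology and the kernel of \<open>u i\<close> are quotients of the cocycles by the same
      submodule.\<close>
    have "a_kernel ?Z ?E (?\<pi> i) = carrier ?Z \<inter> a_kernel (dual S (Q (Suc i))) (C i) (?\<pi> i)"
      by (auto simp: mem_a_kernel mem_cocycles simp del: dual_sel)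
    also have "\<dots> = coboundaries S Q \<Delta> (Suc i)"
      unfolding ker\<pi> unfolding Bcob using coboundaries_subset_cocycles[OF N res] by blast
    finally show "a_kernel ?Z (dual_cohomology S Q \<Delta> (Suc i)) ((+>\<^bsub>?Z\<^esub>) (coboundaries S Q \<Delta> (Suc i))) =
      a_kernel ?Z ?E (?\<pi> i)"
      using cohomology_quotient(3)[OF N res, of "Suc i"] by simp
  qed
  then show ?thesis
    using uh v ex by (intro exI[of _ u] exI[of _ "\<lambda>i. ?\<pi> (Suc i)"] conjI allI)
qed

text \<open>\<open>j\<close> is an isomorphism from \<open>B\<close> onto the kernel of
  \<open>f\<close>. Transport along it replaces the abstract \<open>B\<close> by this kernel, with
  \<open>j\<close> after its inverse, that is the inclusion, as the embedding.\<close>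

lemma approximation_step_kernel:
  assumes ok: "approximation_step R d E B j M f N" and M: "left_module R M" and N: "left_module R N"
  defines "K \<equiv> kernel_module M N f"
  shows "is_syzygy R d E K" "pd_le (opp R) (dual R K) (int d - 1)"
    "short_exact (opp R) (dual R N) (dual_map M f) (dual R M) (dual_map K (\<lambda>x. x)) (dual R K)"
proof -
  note D = short_exactD[OF approximation_stepD(1)[OF ok]]
  have B: "left_module R B" by (rule approximation_step_left_module[OF ok])
  have K: "left_module R K" unfolding K_def by (rule left_module_kernel[OF M N epi_hom[OF D(4)]])
  have jK: "j \<in> lmod_hom R B K"
    unfolding K_def kernel_module_def by (rule hom_restrict_codomain[OF D(1)]) (simp add: D(3))
  have bij: "bij_betw j (carrier B) (carrier K)" using D(2,3) by (simp add: bij_betw_def K_def)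
  let ?i = "inv_into (carrier B) j"
  have ih: "?i \<in> lmod_hom R K B" by (rule hom_inv_into[OF B K jK bij])
  have ji: "j (?i x) = x" if "x \<in> carrier K" for x by (rule bij_betw_inv_into_right[OF bij that])
  have "iso_pair R B K j ?i"
    unfolding iso_pair_def using jK ih ji bij_betw_inv_into_left[OF bij] by blast
  moreover have "iso_pair R X X (\<lambda>x. x) (\<lambda>x. x)" for X :: "('a, 'x) module"
    by (simp add: iso_pair_def hom_id)
  ultimately have ok': "approximation_step R d E K (\<lambda>x. j (?i x)) M f N"
    using approximation_step_transport[OF ok M N K N, of j ?i M "\<lambda>x. x" "\<lambda>x. x" "\<lambda>x. x" "\<lambda>x. x"]
    by (simp add: iso_pair_def hom_id)
  show "is_syzygy R d E K" "pd_le (opp R) (dual R K) (int d - 1)" by (rule approximation_stepD[OF ok'])+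
  show "short_exact (opp R) (dual R N) (dual_map M f) (dual R M) (dual_map K (\<lambda>x. x)) (dual R K)"
  proof (rule short_exact_dual[OF K M N])
    show "short_exact R K (\<lambda>x. x) M f N" unfolding K_def by (rule short_exact_kernel[OF D(4)])
    fix \<psi> assume "\<psi> \<in> lmod_hom R K (regular_module R)"
    from approximation_stepD(4)[OF ok' this]
    show "\<exists>\<chi>\<in>lmod_hom R M (regular_module R). \<forall>b\<in>carrier K. \<chi> b = \<psi> b" by (simp add: ji)
  qed
qed

section \<open>The chain of epimorphisms starting from M and a projective summand\<close>

theorem proposition4p2:
  fixes k :: nat and R :: "'r ring" and M :: "('r, 'm) module"
  assumes "k \<ge> 1"
    and "ring R"
    and "left_noetherian R" and "left_noetherian (opp R)"
    and "quasi_gorenstein k R"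
    and "fg_module R M"
  shows "\<exists>(P :: ('r, 'r fg_elem) module) (C :: nat \<Rightarrow> ('r, 'r fg_elem) module) f.
    fg_projective R P \<and>
    (\<forall>d\<le>k. fg_module R (C d)) \<and>
    lmod_iso R (direct_sum M P) (C 0) \<and>
    (\<forall>d<k. f d \<in> lmod_epi R (C d) (C (Suc d))) \<and>
    (let B = (\<lambda>d. kernel_module (C d) (C (Suc d)) (f d)) in
      (\<forall>d<k. is_syzygy R d (Ext_ring (opp R) (d + 1) (transpose_module R M)) (B d) \<and>
        (d \<ge> 2 \<longrightarrow> is_syzygy R d (Ext_ring (opp R) (d - 1) (dual R M)) (B d))) \<and>
      (\<forall>d\<le>k. syzygy_module R d (C d)) \<and>
      (\<forall>d<k. pd_le (opp R) (dual R (B d)) (int d - 1)) \<and>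
      (\<forall>d<k. short_exact (opp R)
        (dual R (C (Suc d))) (dual_map (C d) (f d))
        (dual R (C d)) (dual_map (B d) (\<lambda>x. x))
        (dual R (B d))))"
proof -
  note noeth = assms(3,4) and M = assms(6)
  let ?N = "transpose_module R M"
  obtain Q D :: "nat \<Rightarrow> ('r, 'r fg_elem) module" and \<Delta> \<epsilon>Q \<delta>D \<epsilon>D where
    N: "fg_module (opp R) ?N" and res: "projective_resolution (opp R) ?N Q \<Delta> \<epsilon>Q"
    and dM: "fg_module (opp R) (dual R M)" and resD: "projective_resolution (opp R) (dual R M) D \<delta>D \<epsilon>D"
    and QD: "\<forall>i. Q (Suc (Suc i)) = D i" "\<forall>i. \<Delta> (Suc (Suc i)) = \<delta>D i"
    and MC: "lmod_iso R M (quotient_module (dual (opp R) (Q (Suc 0)))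
      (dual_map (Q (Suc 0)) (\<Delta> 0) ` carrier (dual (opp R) (Q 0))))"
    by (rule transpose_resolution[OF noeth M])
  have Ml: "left_module R M" by (rule fg_module_left_module[OF M])
  have Nl: "left_module (opp R) ?N" by (rule fg_module_left_module[OF N])
  have dMl: "left_module (opp R) (dual R M)" by (rule fg_module_left_module[OF dM])
  define A where "A i = quotient_module (dual (opp R) (Q (Suc i)))
      (dual_map (Q (Suc i)) (\<Delta> i) ` carrier (dual (opp R) (Q i)))" for i
  define G where "G i = dual (opp R) (Q (Suc (Suc i)))" for i
  obtain u v where u: "\<And>i. u i \<in> lmod_hom R (A i) (G i)" and v: "\<And>i. v i \<in> lmod_epi R (G i) (A (Suc i))"
    and ex: "\<And>i. a_kernel (G i) (A (Suc i)) (v i) = u i ` carrier (A i)"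
    and coh: "\<And>i. lmod_iso R (dual_cohomology (opp R) Q \<Delta> (Suc i)) (kernel_module (A i) (G i) (u i))"
    using cohomology_as_kernel[OF Nl res] unfolding A_def G_def opp_opp by blast
  note Q = resolution_left_module[OF Nl res]
  have dQ: "fg_projective R (dual (opp R) (Q i))" for i
    using fg_projective_dual[OF resolution_projective[OF Nl res]] by simp
  note dQl = fg_projective_left_module[OF dQ]
  have A: "fg_module R (A i)" for i
  proof -
    have "dual_map (Q (Suc i)) (\<Delta> i) \<in> lmod_hom R (dual (opp R) (Q i)) (dual (opp R) (Q (Suc i)))"
      using dual_map_hom[OF Q resolution_hom[OF Nl res]] by simp
    note sub = submodule_image[OF dQl dQl this submodule_carrier[OF dQl]]
    show ?thesis
      unfolding A_def
      by (rule fg_module_image[OF fg_projective_fg[OF dQ] left_module_quotient[OF dQl sub] quotient_map_epi[OF dQl sub]])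
  qed
  have G: "fg_projective R (G i)" for i unfolding G_def by (rule dQ)
  let ?E = "\<lambda>i. kernel_module (A i) (G i) (u i)"
  have E: "fg_module R (?E i)" for i by (rule fg_module_kernel[OF noeth(1) A fg_projective_left_module[OF G] u])
  note El = fg_module_left_module[OF E]
  have H: "left_module R (dual_cohomology (opp R) Q \<Delta> i)" for i
    using left_module_cohomology[OF Nl res] by simp
  \<comment> \<open>\<open>quasi_gorenstein\<close> ranges over modules with elements in
    \<open>fg_elem\<close>, so D(M) is replaced by a copy of that type before its Ext modules are
    compared with the kernels.\<close>
  have grade: "grade_ge R (?E i) (Suc i)" if i: "i < k" for i
  proof -
    obtain N' :: "('r, 'r fg_elem) module" and a b where N': "fg_module (opp R) N'" "iso_pair (opp R) ?N N' a b"
      using fg_module_iso_pair[OF N] by blast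
    let ?X = "Ext_ring (opp R) (Suc i) N'"
    have X: "left_module R ?X" using left_module_Ext_ring[OF noeth(2) N'(1)] by simp
    have "lmod_iso R ?X (dual_cohomology (opp R) Q \<Delta> (Suc i))"
      using Ext_ring_iso[OF noeth(2) N'(1) Nl iso_pair_lmod_iso[OF iso_pair_sym[OF N'(2)]] res] by simp
    then have iso: "lmod_iso R ?X (?E i)" by (rule lmod_iso_trans[OF _ coh])
    have "grade_ge R ?X (Suc i)"
      using assms(5) N'(1) i unfolding quasi_gorenstein_def by simp
    then show ?thesis
      by (rule grade_ge_cong[OF noeth(1) fg_module_iso[OF E X lmod_iso_sym[OF X El iso]] El iso])
  qed
  have "\<exists>(P :: ('r, 'r fg_elem) module) (C :: nat \<Rightarrow> ('r, 'r fg_elem) module)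
      (B :: nat \<Rightarrow> ('r, 'r fg_elem) module) j f.
    fg_projective R P \<and> lmod_iso R (direct_sum (A 0) P) (C 0) \<and> (\<forall>d\<le>k. syzygy_module R d (C d)) \<and>
    (\<forall>d<k. approximation_step R d (?E d) (B d) (j d) (C d) (f d) (C (Suc d)))"
    by (rule approximation_chain[OF noeth(1) A G u v ex grade])
  then obtain P :: "('r, 'r fg_elem) module" and C B :: "nat \<Rightarrow> ('r, 'r fg_elem) module" and j f where
    P: "fg_projective R P" and C0: "lmod_iso R (direct_sum (A 0) P) (C 0)"
    and C: "\<forall>d\<le>k. syzygy_module R d (C d)"
    and steps: "\<forall>d<k. approximation_step R d (?E d) (B d) (j d) (C d) (f d) (C (Suc d))"
    by (elim exE conjE)
  have Cfg: "fg_module R (C d)" if "d \<le> k" for d using C that syzygy_module_fg by blast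
  note Cl = fg_module_left_module[OF Cfg]
  have iso: "lmod_iso R (direct_sum M P) (C 0)"
    by (rule lmod_iso_trans[OF lmod_iso_direct_sum[OF Ml fg_module_left_module[OF A] MC[folded A_def]] C0])
  have epi: "f d \<in> lmod_epi R (C d) (C (Suc d))" if "d < k" for d
    by (rule short_exactD(4)[OF approximation_stepD(1)[OF steps[rule_format, OF that]]])
  note K = approximation_step_kernel[OF steps[rule_format] Cl[OF less_imp_le] Cl[OF Suc_leI]]
  have syz: "is_syzygy R d (Ext_ring (opp R) (d + 1) ?N) (kernel_module (C d) (C (Suc d)) (f d)) \<and>
      (d \<ge> 2 \<longrightarrow> is_syzygy R d (Ext_ring (opp R) (d - 1) (dual R M)) (kernel_module (C d) (C (Suc d)) (f d)))"
    if d: "d < k" for d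
  proof -
    have syz: "is_syzygy R d (dual_cohomology (opp R) Q \<Delta> (Suc d)) (kernel_module (C d) (C (Suc d)) (f d))"
      by (rule is_syzygy_target_iso[OF El H lmod_iso_sym[OF H El coh] K(1)[OF d d d]])
    \<comment> \<open>The cohomology of \<open>Q\<close> in degree d + 1 may be exchanged for any
      Ext module computed by an equal cohomology module. Both descriptions of the kernel, by D(M)
      and by the dual of \<open>M\<close>, come from this.\<close>
    have transfer: "is_syzygy R d (Ext_ring (opp R) i X) (kernel_module (C d) (C (Suc d)) (f d))"
      if X: "fg_module (opp R) X" "projective_resolution (opp R) X Q' \<Delta>' \<epsilon>'"
        "dual_cohomology (opp R) Q' \<Delta>' i = dual_cohomology (opp R) Q \<Delta> (Suc d)"
      for i and X :: "('r, 'x) module" and Q' :: "nat \<Rightarrow> ('r, 'r fg_elem) module" and \<Delta>' \<epsilon>'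
    proof -
      have L: "left_module R (Ext_ring (opp R) i X)" using left_module_Ext_ring[OF noeth(2) X(1)] by simp
      have "lmod_iso R (Ext_ring (opp R) i X) (dual_cohomology (opp R) Q \<Delta> (Suc d))"
        by (rule Ext_ring_iso[OF noeth(2) X(1) fg_module_left_module[OF X(1)] lmod_iso_refl X(2), of i,
              unfolded X(3) opp_opp])
      then show ?thesis by (rule is_syzygy_target_iso[OF H L lmod_iso_sym[OF L H] syz])
    qed
    have "is_syzygy R d (Ext_ring (opp R) (d - 1) (dual R M)) (kernel_module (C d) (C (Suc d)) (f d))" if "d \<ge> 2"
    proof (rule transfer[OF dM resD])
      \<comment> \<open>Since d - 1 \<ge> 1, the cohomology of \<open>D\<close> in this degree
        involves both an incoming and an outgoing differential, and these are the ones of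
        \<open>Q\<close> two places higher. In degree 0 the incoming one would be absent, whence the
        restriction to d \<ge> 2.\<close>
      define c where "c = d - 2"
      then have "d = Suc (Suc c)" using that by simp
      then show "dual_cohomology (opp R) D \<delta>D (d - 1) = dual_cohomology (opp R) Q \<Delta> (Suc d)"
        using QD by (simp add: dual_cohomology_def)
    qed
    moreover have "is_syzygy R d (Ext_ring (opp R) (d + 1) ?N) (kernel_module (C d) (C (Suc d)) (f d))"
      by (rule transfer[OF N res]) simp
    ultimately show ?thesis by blast
  qed
  show ?thesis
    unfolding Let_def
    by (intro exI[of _ P] exI[of _ C] exI[of _ f] conjI allI impI P Cfg iso epi C[rule_format]
        syz[THEN conjunct1] syz[THEN conjunct2, rule_format] K(2,3); assumption)
qed

end
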